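(* Let $\alpha\in(0,1)$ and $\lambda_1>0$, and let $(\mathcal N_t)_{t\ge 0}$ be an inhomogeneous Poisson process with rate function $\lambda_t=\lambda_1 t^{\alpha-1}$, $t>0$, with epochs $T_i$ and gaps $R_i$. Put $b_t=\alpha\log t-\log\log t-\log(\alpha(1-\alpha)/\lambda_1)$. Let $\xi_t$ be the point process on $(-\infty,\infty]^2$ consisting of the points $$\Big(\lambda_t R_i-b_t,\ \frac{t-T_i}{t}\log t\Big),\qquad i=1,2,\ldots$$ Then $\xi_t$ converges in distribution to $\xi$ as $t\to\infty$, where $\xi$ is a Poisson point process with intensity measure $$\mu(\mathrm dx,\mathrm dz)=e^{-x}\,\mathrm dx\times\alpha(1-\alpha)e^{-\alpha(1-\alpha)z}\,\mathrm dz .$$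
   Context: The epochs (points) of $\mathcal N$ in increasing order are $0<T_1<T_2<\cdots$, with $T_0=0$, and the gaps are $R_i=T_i-T_{i-1}$, $i\ge1$. The measure $\mu$ is carried by $\mathbb R^2$ (the density is with respect to $(x,z)\in\mathbb R^2$). The space $(-\infty,\infty]^2$ is the Euclidean plane compactified at $+\infty$ in each coordinate, so that the sets $[x,\infty]\times[z,\infty]$, $x,z\in\mathbb R$, are compact. Convergence in distribution of point processes is with respect to the vague topology on the space of Radon measures on $(-\infty,\infty]^2$. *)

theory Defs
  imports "HOL-Probability.Probability"
begin

section \<open>Radon measures, the vague topology and convergence in distribution\<close>

text \<open>
  The state space is a Borel subset \<open>E\<close> of a topological space, carrying the subspace topology
  and the Borel sets \<open>restrict_space borel E\<close>. Locally finite Borel measures are automatically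
  regular when \<open>E\<close> is locally compact, Hausdorff and second countable, which is the only case used
  below, so finiteness on compact sets is all that is asked of a Radon measure.
\<close>

definition radon_measures :: "'c::topological_space set \<Rightarrow> 'c measure set" where
  "radon_measures E =
     {\<nu>. sets \<nu> = sets (restrict_space borel E) \<and>
         (\<forall>K. compact K \<and> K \<subseteq> E \<longrightarrow> emeasure \<nu> K < \<infinity>)}"

definition test_functions :: "'c::topological_space set \<Rightarrow> ('c \<Rightarrow> real) set" where
  "test_functions E =
     {f. continuous_on E f \<and> (\<forall>x\<in>E. 0 \<le> f x) \<and>
         (\<exists>K. compact K \<and> K \<subseteq> E \<and> (\<forall>x\<in>E - K. f x = 0))}"

text \<open>
  The coarsest topology on the Radon measures that makes \<open>\<nu> \<mapsto> \<integral>f d\<nu>\<close> continuous for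
  every nonnegative continuous \<open>f\<close> with compact support.
\<close>

definition vague_topology :: "'c::topological_space set \<Rightarrow> 'c measure topology" where
  "vague_topology E =
     topology_generated_by
       {{\<nu> \<in> radon_measures E. integral\<^sup>L \<nu> f \<in> U} | f U. f \<in> test_functions E \<and> open U}"

lemma topspace_vague_topology: "topspace (vague_topology E) = radon_measures E"
proof -
  have "(\<lambda>_. 0) \<in> test_functions E"
    unfolding test_functions_def by (auto intro!: exI[of _ "{}"])
  then have "radon_measures E \<in>
      {{\<nu> \<in> radon_measures E. integral\<^sup>L \<nu> f \<in> U} | f U. f \<in> test_functions E \<and> open U}"
    by (auto intro!: exI[of _ "\<lambda>_. 0 :: real"] exI[of _ UNIV])
  then show ?thesis
    unfolding vague_topology_def topology_generated_by_topspace by auto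
qed

definition borel_of_topology :: "'c topology \<Rightarrow> 'c measure" where
  "borel_of_topology X = sigma (topspace X) {U. openin X U}"

text \<open>
  \<open>Y i\<close>, random elements of the topological space \<open>X\<close> defined on \<open>M\<close>, converge in distribution
  along the filter \<open>F\<close> to the random element \<open>Z\<close> defined on \<open>M'\<close>. Only eventual measurability
  is asked for, since a family indexed by \<open>t\<close> may make sense for large \<open>t\<close> only.
\<close>

definition converges_in_distribution ::
  "'c topology \<Rightarrow> 'i filter \<Rightarrow> 'a measure \<Rightarrow> ('i \<Rightarrow> 'a \<Rightarrow> 'c) \<Rightarrow> 'b measure \<Rightarrow> ('b \<Rightarrow> 'c) \<Rightarrow> bool"
where
  "converges_in_distribution X F M Y M' Z \<longleftrightarrow>
     prob_space M \<and> prob_space M' \<and>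
     (\<forall>\<^sub>F i in F. Y i \<in> measurable M (borel_of_topology X)) \<and>
     Z \<in> measurable M' (borel_of_topology X) \<and>
     (\<forall>g :: 'c \<Rightarrow> real. continuous_map X euclideanreal g \<and> bounded (g ` topspace X) \<longrightarrow>
        ((\<lambda>i. \<integral>\<omega>. g (Y i \<omega>) \<partial>M) \<longlongrightarrow> (\<integral>\<omega>. g (Z \<omega>) \<partial>M')) F)"


section \<open>Poisson processes\<close>

text \<open>The library's \<^const>\<open>poisson_pmf\<close> is specified for positive means only.\<close>

definition poisson_law :: "real \<Rightarrow> nat pmf" where
  "poisson_law m = (if m = 0 then return_pmf 0 else poisson_pmf m)"

text \<open>
  That a Poisson point process is almost surely integer valued follows from the Poisson laws of
  the counts, and is therefore not listed.
\<close>

definition poisson_point_process ::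
  "'b measure \<Rightarrow> 'c::topological_space set \<Rightarrow> 'c measure \<Rightarrow> ('b \<Rightarrow> 'c measure) \<Rightarrow> bool"
where
  "poisson_point_process M E \<mu> \<xi> \<longleftrightarrow>
     prob_space M \<and>
     \<xi> \<in> measurable M (borel_of_topology (vague_topology E)) \<and>
     (\<forall>B \<in> sets (restrict_space borel E). emeasure \<mu> B < \<infinity> \<longrightarrow>
        (\<forall>k::nat. measure M {\<omega> \<in> space M. emeasure (\<xi> \<omega>) B = of_nat k}
                  = pmf (poisson_law (measure \<mu> B)) k)) \<and>
     (\<forall>(B :: nat \<Rightarrow> 'c set) n.
        (\<forall>i<n. B i \<in> sets (restrict_space borel E)) \<and> disjoint_family_on B {..<n} \<longrightarrow>
        prob_space.indep_vars M (\<lambda>_. borel) (\<lambda>i \<omega>. emeasure (\<xi> \<omega>) (B i)) {..<n})"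

text \<open>
  Inhomogeneous Poisson process on \<open>[0, \<infinity>)\<close> as a counting process: \<open>N t \<omega>\<close> is the number of
  epochs in \<open>(0, t]\<close>. Right-continuity is with respect to the discrete topology of
  \<^typ>\<open>nat\<close>. That jumps have size one almost surely follows from the remaining conditions.
\<close>

definition inhomogeneous_poisson_process ::
  "'a measure \<Rightarrow> (real \<Rightarrow> real) \<Rightarrow> (real \<Rightarrow> 'a \<Rightarrow> nat) \<Rightarrow> bool"
where
  "inhomogeneous_poisson_process M rate N \<longleftrightarrow>
     prob_space M \<and>
     (\<forall>t>0. 0 \<le> rate t) \<and>
     (\<forall>t\<ge>0. set_integrable lborel {0..t} rate) \<and>
     (\<forall>t\<ge>0. N t \<in> measurable M (count_space UNIV)) \<and>
     (\<forall>\<omega>\<in>space M. N 0 \<omega> = 0 \<and> mono_on {0..} (\<lambda>t. N t \<omega>) \<and>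
        (\<forall>t\<ge>0. continuous (at_right t) (\<lambda>s. N s \<omega>))) \<and>
     (\<forall>s t. 0 \<le> s \<and> s \<le> t \<longrightarrow>
        distr M (count_space UNIV) (\<lambda>\<omega>. N t \<omega> - N s \<omega>)
          = measure_pmf (poisson_law (set_lebesgue_integral lborel {s..t} rate))) \<and>
     (\<forall>(\<tau> :: nat \<Rightarrow> real) n. 0 \<le> \<tau> 0 \<and> mono \<tau> \<longrightarrow>
        prob_space.indep_vars M (\<lambda>_. count_space UNIV)
          (\<lambda>i \<omega>. N (\<tau> (Suc i)) \<omega> - N (\<tau> i) \<omega>) {..<n})"

text \<open>
  The \<open>i\<close>-th epoch \<open>T\<^sub>i\<close>; in particular \<open>T\<^sub>0 = 0\<close>. On the event that there are fewer than
  \<open>i\<close> epochs (a null event if the rate has infinite integral) the infimum is over the empty set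
  and meaningless, hence the restriction to \<open>epoch_indices\<close> wherever epochs are collected.
\<close>

definition epoch :: "(real \<Rightarrow> 'a \<Rightarrow> nat) \<Rightarrow> nat \<Rightarrow> 'a \<Rightarrow> real" where
  "epoch N i \<omega> = Inf {t. 0 \<le> t \<and> i \<le> N t \<omega>}"

definition epoch_indices :: "(real \<Rightarrow> 'a \<Rightarrow> nat) \<Rightarrow> 'a \<Rightarrow> nat set" where
  "epoch_indices N \<omega> = {i. 1 \<le> i \<and> (\<exists>t\<ge>0. i \<le> N t \<omega>)}"

definition gap :: "(real \<Rightarrow> 'a \<Rightarrow> nat) \<Rightarrow> nat \<Rightarrow> 'a \<Rightarrow> real" where
  "gap N i \<omega> = epoch N i \<omega> - epoch N (i - 1) \<omega>"


section \<open>The process of normalised gaps and its limit\<close>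

definition rate :: "real \<Rightarrow> real \<Rightarrow> real \<Rightarrow> real" where
  "rate \<alpha> lam1 t = lam1 * t powr (\<alpha> - 1)"

definition centering :: "real \<Rightarrow> real \<Rightarrow> real \<Rightarrow> real" where
  "centering \<alpha> lam1 t = \<alpha> * ln t - ln (ln t) - ln (\<alpha> * (1 - \<alpha>) / lam1)"

text \<open>The space \<open>(-\<infinity>, \<infinity>]\<^sup>2\<close>, in which the sets \<open>[x, \<infinity>] \<times> [z, \<infinity>]\<close> are compact.\<close>

definition plane :: "(ereal \<times> ereal) set" where
  "plane = {-\<infinity><..} \<times> {-\<infinity><..}"

definition gap_point ::
  "real \<Rightarrow> real \<Rightarrow> (real \<Rightarrow> 'a \<Rightarrow> nat) \<Rightarrow> real \<Rightarrow> 'a \<Rightarrow> nat \<Rightarrow> ereal \<times> ereal"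
where
  "gap_point \<alpha> lam1 N t \<omega> i =
     (ereal (rate \<alpha> lam1 t * gap N i \<omega> - centering \<alpha> lam1 t),
      ereal ((t - epoch N i \<omega>) / t * ln t))"

text \<open>
  The point process is the image of counting measure on the indices, that is, the sum of the
  unit point masses at the points, counted with multiplicity.
\<close>

definition gap_process ::
  "real \<Rightarrow> real \<Rightarrow> (real \<Rightarrow> 'a \<Rightarrow> nat) \<Rightarrow> real \<Rightarrow> 'a \<Rightarrow> (ereal \<times> ereal) measure"
where
  "gap_process \<alpha> lam1 N t \<omega> =
     distr (count_space (epoch_indices N \<omega>)) (restrict_space borel plane) (gap_point \<alpha> lam1 N t \<omega>)"

definition limit_intensity :: "real \<Rightarrow> (ereal \<times> ereal) measure" where
  "limit_intensity \<alpha> =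
     distr (density lborel (\<lambda>(x :: real, z :: real).
              ennreal (exp (- x) * (\<alpha> * (1 - \<alpha>) * exp (- (\<alpha> * (1 - \<alpha>) * z))))))
       (restrict_space borel plane) (\<lambda>(x, z). (ereal x, ereal z))"

end

theory Submission
  imports Defs "HOL-Real_Asymp.Real_Asymp"
begin

text \<open>
  Write \<open>L t\<close> for the integrated rate. The empty stretch of length \<open>r\<close> before an epoch at time \<open>s\<close> has
  probability \<open>exp (- (L s - L (s - r)))\<close>, which is close to \<open>\<phi>(s) = exp (- r \<lambda>\<^sub>s)\<close>, so about
  \<open>\<integral> \<lambda>\<^sub>s \<phi>(s) ds\<close> gaps longer than \<open>r\<close> are expected before a given time. For a power rate the integrand
  is \<open>s / (r (1 - \<alpha>))\<close> times the derivative of \<open>\<phi>\<close>, and since \<open>\<phi>\<close> lives on the scale \<open>t / log t\<close>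
  near \<open>t\<close>, the integral up to \<open>s\<close> is asymptotically \<open>s / (r (1 - \<alpha>)) \<phi>(s)\<close>. With \<open>\<lambda>\<^sub>t r = b\<^sub>t + x\<close> and
  \<open>s = t (1 - z / log t)\<close> this tends to \<open>exp (- x - \<alpha> (1 - \<alpha>) z)\<close>, the mass that the limiting intensity
  gives to \<open>[x, \<infinity>] \<times> [z, \<infinity>]\<close>; early epochs contribute nothing because the bound holds from time
  \<open>0\<close> on (\<open>sum_run_prob_limit\<close>).

  The remaining question is independence. Time is cut into slots so short that, up to the times that
  matter, no slot contains two epochs. That a slot ends a long gap depends on a bounded number of earlier slots only;
  two such events for nearby slots exclude each other or are independent, because the slots inside
  a long gap are empty, and for distant slots they are independent. For events of this
  kind the probability that none occurs is \<open>exp (- mean)\<close> up to an error controlled by the largest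
  mean over a window of one gap length (\<open>dissociated_void_probability\<close>). Hence, for every finite union of
  rectangles, the probability of finding no point in it converges to that of the Poisson process
  (\<open>void_limit\<close>).

  Void probabilities determine the law of the set of nonempty cells of a finite grid
  (\<open>random_set_law_tendsto\<close>). If the grid is fine, it is unlikely for either process that a cell holds two
  points, and then the set of nonempty cells determines the integrals of finitely many test functions up to
  a small error (\<open>integral_close\<close>). Countably many test functions generate the vague topology, so this gives
  the lower bound on probabilities of open sets (\<open>open_set_lower_bound\<close>) that is equivalent to
  convergence in distribution (\<open>converges_in_distributionI_open\<close>).

  Throughout, the plane is described by the coordinates \<open>u = exp (- x)\<close> and \<open>v = exp (- z)\<close>, which carry
  \<open>(-\<infinity>, \<infinity>]\<close> to \<open>[0, \<infinity>)\<close>. In them, the sets \<open>[x, \<infinity>] \<times> [z, \<infinity>]\<close> are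
  boxes at the origin, of limiting mass \<open>u v powr (\<alpha> (1 - \<alpha>))\<close>.
\<close>

section \<open>Convergence in distribution from lower bounds on open sets\<close>

lemma space_borel_of_topology [simp]: "space (borel_of_topology X) = topspace X"
  unfolding borel_of_topology_def by (intro space_measure_of) (auto dest: openin_subset)

lemma sets_borel_of_topology: "sets (borel_of_topology X) = sigma_sets (topspace X) {U. openin X U}"
  unfolding borel_of_topology_def by (intro sets_measure_of) (auto dest: openin_subset)

lemma openin_sets_borel_of_topology: "openin X U \<Longrightarrow> U \<in> sets (borel_of_topology X)"
  by (auto simp: sets_borel_of_topology)

lemma continuous_map_borel_measurable:
  assumes "continuous_map X euclideanreal g"
  shows "g \<in> borel_measurable (borel_of_topology X)"
proof (rule borel_measurableI)
  fix S :: "real set" assume "open S"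
  then have "openin X {x \<in> topspace X. g x \<in> S}"
    using openin_continuous_map_preimage[OF assms] by simp
  then show "g -` S \<inter> space (borel_of_topology X) \<in> sets (borel_of_topology X)"
    by (auto simp: vimage_def Int_def conj_commute intro!: openin_sets_borel_of_topology)
qed

text \<open>
  A step function below the identity on \<open>[0, 1]\<close>; its expectation is an average of
  probabilities of open sets.
\<close>

definition staircase :: "nat \<Rightarrow> real \<Rightarrow> real" where
  "staircase n y = (\<Sum>k=1..n. indicat_real {real k / real n<..} y) / real n"

lemma staircase_bounds:
  assumes "0 \<le> y" "y \<le> 1" "0 < n"
  shows "staircase n y \<le> y" "y \<le> staircase n y + 1 / real n"
proof -
  define m where "m = nat (\<lceil>y * n\<rceil> - 1)"
  have m: "real m \<le> y * n" "y * n \<le> real m + 1" and k: "real k < y * n \<longleftrightarrow> k \<le> m" if "1 \<le> k" for k :: nat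
  proof -
    have "0 \<le> y * n" using assms by simp
    then show "real m \<le> y * n" "y * n \<le> real m + 1" "real k < y * n \<longleftrightarrow> k \<le> m"
      using that unfolding m_def by linarith+
  qed
  have mn: "m \<le> n"
  proof -
    have "real m \<le> y * n" using m(1)[of 1] by simp
    also have "\<dots> \<le> 1 * real n" using assms by (intro mult_right_mono) auto
    finally show ?thesis by simp
  qed
  have "(\<Sum>k=1..n. indicat_real {real k / real n<..} y) = (\<Sum>k=1..n. if k \<le> m then 1 else 0)"
    using k assms by (intro sum.cong refl) (auto simp: indicator_def field_simps)
  also have "\<dots> = (\<Sum>k\<in>{1..m}. 1)"
  proof -
    have "{k \<in> {1..n}. k \<le> m} = {1..m}" using mn by auto
    then show ?thesis by (subst sum.inter_filter[symmetric]) simp_all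
  qed
  finally have "staircase n y = real m / real n" by (simp add: staircase_def)
  then show "staircase n y \<le> y" "y \<le> staircase n y + 1 / real n"
    using m[of 1] assms(3) by (auto simp: divide_le_eq le_divide_eq simp flip: add_divide_distrib)
qed

lemma (in prob_space) expectation_staircase:
  assumes "f \<in> borel_measurable M"
  shows "expectation (\<lambda>\<omega>. staircase n (f \<omega>)) = (\<Sum>k=1..n. prob {\<omega> \<in> space M. real k / real n < f \<omega>}) / real n"
    and "integrable M (\<lambda>\<omega>. staircase n (f \<omega>))"
proof -
  have eq: "indicat_real {real k / real n<..} (f \<omega>) = indicat_real {\<omega> \<in> space M. real k / real n < f \<omega>} \<omega>"
    if "\<omega> \<in> space M" for k \<omega> using that by (auto simp: indicator_def)
  have s: "{\<omega> \<in> space M. real k / real n < f \<omega>} \<in> events" for k using assms by measurable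
  have i: "integrable M (\<lambda>\<omega>. indicat_real {real k / real n<..} (f \<omega>))" for k
    using s[of k] by (subst Bochner_Integration.integrable_cong[OF refl eq]) (simp_all add: integrable_real_indicator emeasure_eq_measure)
  show "integrable M (\<lambda>\<omega>. staircase n (f \<omega>))"
    unfolding staircase_def using i by auto
  have "expectation (\<lambda>\<omega>. indicat_real {real k / real n<..} (f \<omega>)) = prob {\<omega> \<in> space M. real k / real n < f \<omega>}" for k
    by (subst Bochner_Integration.integral_cong[OF refl eq]) (use s in auto)
  then show "expectation (\<lambda>\<omega>. staircase n (f \<omega>)) = (\<Sum>k=1..n. prob {\<omega> \<in> space M. real k / real n < f \<omega>}) / real n"
    unfolding staircase_def using i by simp
qed

text \<open>
  Half of the portmanteau theorem: \<open>g\<close> is, up to \<open>1/n\<close>, the average of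
  the indicators of the open sets \<open>g > k/n\<close>.
\<close>

lemma portmanteau_lower:
  fixes g :: "'c \<Rightarrow> real"
  assumes M: "prob_space M" and M': "prob_space M'"
    and Y: "\<forall>\<^sub>F i in F. Y i \<in> measurable M (borel_of_topology X)"
    and Z: "Z \<in> measurable M' (borel_of_topology X)"
    and open_sets: "\<And>V d. openin X V \<Longrightarrow> 0 < d \<Longrightarrow>
       \<forall>\<^sub>F i in F. measure M' {\<omega> \<in> space M'. Z \<omega> \<in> V} - d \<le> measure M {\<omega> \<in> space M. Y i \<omega> \<in> V}"
    and g: "continuous_map X euclideanreal g" "\<And>x. x \<in> topspace X \<Longrightarrow> 0 \<le> g x \<and> g x \<le> 1"
    and e: "0 < e"
  shows "\<forall>\<^sub>F i in F. (\<integral>\<omega>. g (Z \<omega>) \<partial>M') - e \<le> (\<integral>\<omega>. g (Y i \<omega>) \<partial>M)"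
proof -
  interpret M: prob_space M by fact
  interpret M': prob_space M' by fact
  obtain n :: nat where n: "0 < n" "1 / real n < e / 2"
    using reals_Archimedean[of "e/2"] e by (metis half_gt_zero inverse_eq_divide zero_less_Suc)
  define V where "V k = {x \<in> topspace X. g x \<in> {real k / real n<..}}" for k
  have V: "openin X (V k)" for k
    unfolding V_def by (rule openin_continuous_map_preimage[OF g(1)]) simp
  have "\<forall>\<^sub>F i in F. \<forall>k\<in>{1..n}. measure M' {\<omega> \<in> space M'. Z \<omega> \<in> V k} - e/2 \<le> measure M {\<omega> \<in> space M. Y i \<omega> \<in> V k}"
    using V e by (intro eventually_ball_finite) (auto intro: open_sets)
  with Y show ?thesis
  proof eventually_elim
    case (elim i)
    have gm: "g \<in> borel_measurable (borel_of_topology X)"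
      by (rule continuous_map_borel_measurable[OF g(1)])
    have mY: "(\<lambda>\<omega>. g (Y i \<omega>)) \<in> borel_measurable M" using elim(1) gm by (rule measurable_compose)
    have mZ: "(\<lambda>\<omega>. g (Z \<omega>)) \<in> borel_measurable M'" using Z gm by (rule measurable_compose)
    have tY: "Y i \<omega> \<in> topspace X" if "\<omega> \<in> space M" for \<omega> using measurable_space[OF elim(1) that] by simp
    have tZ: "Z \<omega> \<in> topspace X" if "\<omega> \<in> space M'" for \<omega> using measurable_space[OF Z that] by simp
    have iY: "integrable M (\<lambda>\<omega>. g (Y i \<omega>))"
      using mY tY g(2) by (intro M.integrable_const_bound[where B=1]) auto
    have iZ: "integrable M' (\<lambda>\<omega>. g (Z \<omega>))"
      using mZ tZ g(2) by (intro M'.integrable_const_bound[where B=1]) auto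
    have "(\<integral>\<omega>. g (Z \<omega>) \<partial>M') \<le> (\<integral>\<omega>. staircase n (g (Z \<omega>)) + 1 / real n \<partial>M')"
      using iZ M'.expectation_staircase(2)[OF mZ, of n] staircase_bounds(2)[OF _ _ n(1)] tZ g(2)
      by (intro integral_mono) auto
    also have "\<dots> = (\<Sum>k=1..n. M'.prob {\<omega> \<in> space M'. real k / real n < g (Z \<omega>)}) / real n + 1 / real n"
      using M'.expectation_staircase[OF mZ, of n] by (simp add: M'.prob_space)
    also have "\<dots> \<le> (\<Sum>k=1..n. M.prob {\<omega> \<in> space M. real k / real n < g (Y i \<omega>)} + e/2) / real n + e/2"
    proof (intro add_mono divide_right_mono sum_mono)
      fix k assume k: "k \<in> {1..n}"
      have "{\<omega> \<in> space M'. real k / real n < g (Z \<omega>)} = {\<omega> \<in> space M'. Z \<omega> \<in> V k}"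
        using tZ by (auto simp: V_def)
      moreover have "{\<omega> \<in> space M. real k / real n < g (Y i \<omega>)} = {\<omega> \<in> space M. Y i \<omega> \<in> V k}"
        using tY by (auto simp: V_def)
      ultimately show "M'.prob {\<omega> \<in> space M'. real k / real n < g (Z \<omega>)} \<le>
          M.prob {\<omega> \<in> space M. real k / real n < g (Y i \<omega>)} + e/2"
        using elim(2) k by (auto simp: field_simps)
    qed (use n in auto)
    also have "\<dots> = (\<Sum>k=1..n. M.prob {\<omega> \<in> space M. real k / real n < g (Y i \<omega>)}) / real n + e"
      using n(1) by (simp add: sum.distrib add_divide_distrib)
    also have "\<dots> = (\<integral>\<omega>. staircase n (g (Y i \<omega>)) \<partial>M) + e"
      using M.expectation_staircase[OF mY, of n] by simp
    also have "\<dots> \<le> (\<integral>\<omega>. g (Y i \<omega>) \<partial>M) + e"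
      using iY M.expectation_staircase(2)[OF mY, of n] staircase_bounds(1)[OF _ _ n(1)] tY g(2)
      by (intro add_right_mono integral_mono) auto
    finally show ?case by simp
  qed
qed

text \<open>
  The lower bound for a function and the one for its negative together give the limit; both are
  brought into \<open>[0, 1]\<close> by an affine map.
\<close>

lemma converges_in_distributionI_open:
  fixes X :: "'c topology"
  assumes M: "prob_space M" and M': "prob_space M'"
    and Y: "\<forall>\<^sub>F i in F. Y i \<in> measurable M (borel_of_topology X)"
    and Z: "Z \<in> measurable M' (borel_of_topology X)"
    and open_sets: "\<And>V d. openin X V \<Longrightarrow> 0 < d \<Longrightarrow>
       \<forall>\<^sub>F i in F. measure M' {\<omega> \<in> space M'. Z \<omega> \<in> V} - d \<le> measure M {\<omega> \<in> space M. Y i \<omega> \<in> V}"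
  shows "converges_in_distribution X F M Y M' Z"
  unfolding converges_in_distribution_def
proof (intro conjI allI impI M M' Y Z)
  fix g :: "'c \<Rightarrow> real" assume "continuous_map X euclideanreal g \<and> bounded (g ` topspace X)"
  then have g: "continuous_map X euclideanreal g" and "bounded (g ` topspace X)" by auto
  then obtain B where B: "0 < B" "\<And>x. x \<in> topspace X \<Longrightarrow> \<bar>g x\<bar> \<le> B"
    by (auto simp: bounded_pos)
  interpret M: prob_space M by fact
  interpret M': prob_space M' by fact
  \<comment> \<open>\<open>s = 1\<close> yields the lower and \<open>s = -1\<close> the upper bound\<close>
  define h where "h s x = (1 + s * g x / B) / 2" for s x
  have ch: "continuous_map X euclideanreal (h s)" for s
    unfolding h_def by (intro continuous_intros g) (use B in auto)
  have bh: "0 \<le> h s x \<and> h s x \<le> 1" if "\<bar>s\<bar> = 1" "x \<in> topspace X" for s x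
  proof -
    have "\<bar>s * g x / B\<bar> \<le> 1" using B that by (simp add: abs_mult)
    then show ?thesis unfolding h_def by (simp only: abs_le_iff) auto
  qed
  have gm: "g \<in> borel_measurable (borel_of_topology X)"
    by (rule continuous_map_borel_measurable[OF g])
  have iZ: "integrable M' (\<lambda>\<omega>. g (Z \<omega>))"
    using measurable_space[OF Z] measurable_compose[OF Z gm] B by (intro M'.integrable_const_bound[where B=B]) auto
  show "((\<lambda>i. \<integral>\<omega>. g (Y i \<omega>) \<partial>M) \<longlongrightarrow> (\<integral>\<omega>. g (Z \<omega>) \<partial>M')) F"
  proof (rule tendstoI)
    fix e :: real assume e: "0 < e"
    have ev: "\<forall>\<^sub>F i in F. (\<integral>\<omega>. h s (Z \<omega>) \<partial>M') - e / (4*B) \<le> (\<integral>\<omega>. h s (Y i \<omega>) \<partial>M)" if s: "\<bar>s\<bar> = 1" for s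
      using e B by (intro portmanteau_lower[OF M M' Y Z open_sets ch bh[OF s]]) auto
    have 1: "\<bar>1\<bar> = (1::real)" "\<bar>-1\<bar> = (1::real)" by auto
    show "\<forall>\<^sub>F i in F. dist (\<integral>\<omega>. g (Y i \<omega>) \<partial>M) (\<integral>\<omega>. g (Z \<omega>) \<partial>M') < e"
      using Y ev[OF 1(1)] ev[OF 1(2)]
    proof eventually_elim
      case (elim i)
      have iY: "integrable M (\<lambda>\<omega>. g (Y i \<omega>))"
        using measurable_space[OF elim(1)] measurable_compose[OF elim(1) gm] B
        by (intro M.integrable_const_bound[where B=B]) auto
      have hY: "(\<integral>\<omega>. h s (Y i \<omega>) \<partial>M) = (1 + s * (\<integral>\<omega>. g (Y i \<omega>) \<partial>M) / B) / 2" for s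
        using iY by (simp add: h_def M.prob_space)
      have hZ: "(\<integral>\<omega>. h s (Z \<omega>) \<partial>M') = (1 + s * (\<integral>\<omega>. g (Z \<omega>) \<partial>M') / B) / 2" for s
        using iZ by (simp add: h_def M'.prob_space)
      have "\<bar>(\<integral>\<omega>. g (Y i \<omega>) \<partial>M) - (\<integral>\<omega>. g (Z \<omega>) \<partial>M')\<bar> \<le> e/2"
      proof -
        let ?y = "(\<integral>\<omega>. g (Y i \<omega>) \<partial>M) / B" and ?z = "(\<integral>\<omega>. g (Z \<omega>) \<partial>M') / B"
        have "\<bar>?y - ?z\<bar> \<le> 2 * (e / (4*B))"
        proof -
          have "(1 + ?z) / 2 - e / (4*B) \<le> (1 + ?y) / 2"
            using elim(2) unfolding hY hZ by (simp only: mult_1)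
          moreover have "(1 - ?z) / 2 - e / (4*B) \<le> (1 - ?y) / 2"
            using elim(3) unfolding hY hZ by (simp only: mult_minus1 minus_divide_left[symmetric] add_uminus_conv_diff)
          moreover have "(1+z)/2 - k \<le> (1+y)/2 \<Longrightarrow> (1-z)/2 - k \<le> (1-y)/2 \<Longrightarrow> \<bar>y-z\<bar> \<le> 2*k" for y z k :: real
            by (auto simp: abs_le_iff field_simps)
          ultimately show ?thesis by blast
        qed
        then have "\<bar>?y - ?z\<bar> * B \<le> 2 * (e / (4*B)) * B"
          using B(1) by (intro mult_right_mono) auto
        moreover have "\<bar>?y - ?z\<bar> * B = \<bar>(?y - ?z) * B\<bar>" using B(1) by (simp add: abs_mult)
        ultimately show ?thesis using B(1) by (simp add: left_diff_distrib)
      qed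
      then show ?case using e by (simp add: dist_real_def)
    qed
  qed
qed

section \<open>The vague topology on the compactified plane\<close>

text \<open>
  The homeomorphism of \<open>(-\<infinity>, \<infinity>]\<close> onto \<open>[0,
  \<infinity>)\<close> that serves as coordinate.
\<close>

definition neg_exp :: "ereal \<Rightarrow> real" where
  "neg_exp x = (if x = \<infinity> then 0 else exp (- real_of_ereal x))"

lemma neg_exp_simps [simp]: "neg_exp \<infinity> = 0" "neg_exp (ereal x) = exp (- x)"
  by (auto simp: neg_exp_def)

lemma neg_exp_nonneg [simp]: "0 \<le> neg_exp x"
  by (simp add: neg_exp_def)

lemma neg_exp_le_iff:
  assumes "-\<infinity> < x" "0 < r"
  shows "neg_exp x \<le> r \<longleftrightarrow> ereal (- ln r) \<le> x"
proof (cases x)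
  case (real y)
  have "exp (-y) \<le> r \<longleftrightarrow> -y \<le> ln r"
    using assms(2) by (metis exp_le_cancel_iff exp_ln)
  with real show ?thesis by auto
qed (use assms in auto)

lemma inj_on_neg_exp: "inj_on neg_exp {-\<infinity><..}"
proof (rule inj_onI)
  fix x y :: ereal assume "x \<in> {-\<infinity><..}" "y \<in> {-\<infinity><..}" "neg_exp x = neg_exp y"
  then show "x = y"
    by (cases x; cases y) (auto simp: neg_exp_def)
qed

lemma continuous_on_neg_exp: "continuous_on {-\<infinity><..} neg_exp"
proof -
  have "isCont neg_exp x" if "-\<infinity> < x" for x
  proof (cases "x = \<infinity>")
    case False
    have "\<forall>\<^sub>F y in nhds x. y \<in> {-\<infinity><..<\<infinity>}"
      using that False by (intro eventually_nhds_in_open) auto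
    then have ev: "\<forall>\<^sub>F y in nhds x. neg_exp y = exp (- real_of_ereal y)"
      by eventually_elim (auto simp: neg_exp_def)
    have "isCont (\<lambda>y. exp (- real_of_ereal y)) x"
      using that False by (intro continuous_intros continuous_at_of_ereal) auto
    then show ?thesis
      using isCont_cong[OF ev] by simp
  next
    case True
    have "(neg_exp \<longlongrightarrow> 0) (at \<infinity>)"
    proof (rule tendstoI)
      fix e :: real assume "0 < e"
      have "\<forall>\<^sub>F y in at \<infinity>. y \<in> {ereal (- ln (e/2))<..}"
        by (intro eventually_at_in_open') auto
      then show "\<forall>\<^sub>F y in at \<infinity>. dist (neg_exp y) 0 < e"
      proof eventually_elim
        case (elim y)
        then have "-\<infinity> < y" by auto
        with elim neg_exp_le_iff[of y "e/2"] \<open>0 < e\<close> have "neg_exp y \<le> e/2" by auto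
        then show ?case using \<open>0 < e\<close> by (auto simp: dist_norm)
      qed
    qed
    with True show ?thesis by (simp add: isCont_def)
  qed
  then show ?thesis by (auto intro!: continuous_at_imp_continuous_on)
qed

lemma continuous_on_neg_exp_plane:
  "continuous_on plane (\<lambda>p. neg_exp (fst p))" "continuous_on plane (\<lambda>p. neg_exp (snd p))"
  by (auto simp: plane_def intro!: continuous_on_compose2[OF continuous_on_neg_exp] continuous_intros)

text \<open>These sets exhaust the compact subsets of the plane.\<close>

definition quadrant :: "real \<Rightarrow> (ereal \<times> ereal) set" where
  "quadrant r = {p \<in> plane. neg_exp (fst p) \<le> r \<and> neg_exp (snd p) \<le> r}"

lemma quadrant_subset_plane: "quadrant r \<subseteq> plane"
  by (auto simp: quadrant_def)

lemma compact_quadrant: "0 < r \<Longrightarrow> compact (quadrant r)"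
proof -
  assume r: "0 < r"
  have *: "-\<infinity> < x \<and> neg_exp x \<le> r \<longleftrightarrow> ereal (- ln r) \<le> x" for x
    using r neg_exp_le_iff[of x r] less_le_trans[of "-\<infinity>" "ereal (- ln r)" x] by auto
  have "p \<in> quadrant r \<longleftrightarrow> p \<in> {ereal (- ln r)..} \<times> {ereal (- ln r)..}" for p
    using *[of "fst p"] *[of "snd p"] by (auto simp: quadrant_def plane_def mem_Times_iff)
  then have "quadrant r = {ereal (- ln r)..} \<times> {ereal (- ln r)..}" by blast
  then show ?thesis
    by (simp add: compact_Times compact_eq_closed)
qed

lemma compact_subset_quadrant:
  assumes "compact K" "K \<subseteq> plane"
  obtains n :: nat where "K \<subseteq> quadrant (real n)"
proof -
  have 1: "bounded ((\<lambda>p. neg_exp (fst p)) ` K)" "bounded ((\<lambda>p. neg_exp (snd p)) ` K)"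
    using assms continuous_on_neg_exp_plane
    by (auto intro!: compact_imp_bounded compact_continuous_image intro: continuous_on_subset)
  from 1(1) obtain a where a: "\<And>p. p \<in> K \<Longrightarrow> neg_exp (fst p) \<le> a"
    by (force simp: bounded_iff)
  from 1(2) obtain b where b: "\<And>p. p \<in> K \<Longrightarrow> neg_exp (snd p) \<le> b"
    by (force simp: bounded_iff)
  obtain n :: nat where n: "max a b \<le> real n" using real_arch_simple by blast
  have "K \<subseteq> quadrant (real n)"
  proof
    fix p assume "p \<in> K"
    with a[of p] b[of p] n assms(2) show "p \<in> quadrant (real n)"
      by (auto simp: quadrant_def)
  qed
  then show ?thesis by (rule that)
qed

text \<open>
  The numbering of triples by \<^const>\<open>prod_encode\<close> makes the test functions
  \<open>u ^ a * v ^ b\<close>, cut off outside a box of side \<open>n\<close>, into a sequence.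
\<close>

definition cut_monomial :: "nat \<Rightarrow> real \<times> real \<Rightarrow> real" where
  "cut_monomial j = (\<lambda>(u, v). case prod_decode j of (n, l) \<Rightarrow> case prod_decode l of (a, b) \<Rightarrow>
     \<bar>u\<bar> ^ a * \<bar>v\<bar> ^ b * max 0 (min 1 (real n + 1 - max \<bar>u\<bar> \<bar>v\<bar>)))"

definition cutoff :: "nat \<Rightarrow> ereal \<times> ereal \<Rightarrow> real" where
  "cutoff n p = max 0 (min 1 (real n + 1 - max (neg_exp (fst p)) (neg_exp (snd p))))"

definition probe :: "nat \<Rightarrow> ereal \<times> ereal \<Rightarrow> real" where
  "probe j p = cut_monomial j (neg_exp (fst p), neg_exp (snd p))"

lemma continuous_cut_monomial: "continuous_on S (cut_monomial j)"
  unfolding cut_monomial_def split_beta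
  by (intro continuous_intros)

lemma cut_monomial_support:
  "\<exists>n::nat. \<forall>w. real n \<le> max \<bar>fst w\<bar> \<bar>snd w\<bar> \<longrightarrow> cut_monomial j w = 0"
  by (rule exI[of _ "fst (prod_decode j) + 1"])
     (auto simp: cut_monomial_def split_beta)

lemma probe_eq:
  "probe (prod_encode (n, prod_encode (a, b))) p =
     neg_exp (fst p) ^ a * neg_exp (snd p) ^ b * cutoff n p"
  by (simp add: probe_def cut_monomial_def cutoff_def)

lemma continuous_on_cutoff: "continuous_on plane (cutoff n)"
  unfolding cutoff_def by (intro continuous_intros continuous_on_neg_exp_plane)

lemma cutoff_nonneg: "0 \<le> cutoff n p" by (simp add: cutoff_def)

lemma cutoff_eq_0: "p \<in> plane \<Longrightarrow> p \<notin> quadrant (real n + 1) \<Longrightarrow> cutoff n p = 0"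
  by (auto simp: cutoff_def quadrant_def)

lemma cutoff_eq_1: "p \<in> quadrant (real n) \<Longrightarrow> cutoff n p = 1"
  by (auto simp: cutoff_def quadrant_def)

lemma probe_test_function: "probe j \<in> test_functions plane"
proof -
  obtain n l where j: "j = prod_encode (n, l)" by (metis prod_decode_inverse surj_pair)
  obtain a b where l: "l = prod_encode (a, b)" by (metis prod_decode_inverse surj_pair)
  have "probe j = (\<lambda>p. neg_exp (fst p) ^ a * neg_exp (snd p) ^ b * cutoff n p)"
    by (simp add: fun_eq_iff j l probe_eq)
  then have eq: "probe j = (\<lambda>p. neg_exp (fst p) ^ a * neg_exp (snd p) ^ b * cutoff n p)" .
  have "continuous_on plane (probe j)"
    unfolding eq by (intro continuous_on_mult continuous_on_power continuous_on_neg_exp_plane continuous_on_cutoff)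
  moreover have "0 \<le> probe j p" for p
    unfolding eq by (intro mult_nonneg_nonneg zero_le_power cutoff_nonneg neg_exp_nonneg)
  moreover have "\<forall>p \<in> plane - quadrant (real n + 1). probe j p = 0"
    unfolding eq using cutoff_eq_0 by auto
  moreover have "compact (quadrant (real n + 1))" "quadrant (real n + 1) \<subseteq> plane"
    by (intro compact_quadrant quadrant_subset_plane; simp)+
  ultimately show ?thesis
    unfolding test_functions_def by blast
qed

text \<open>
  The algebra spanned by the monomials in the two coordinates, to which the Stone--Weierstrass
  theorem is applied.
\<close>

inductive bipolynomial :: "(ereal \<times> ereal \<Rightarrow> real) \<Rightarrow> bool" where
  monomial: "bipolynomial (\<lambda>p. c * (neg_exp (fst p) ^ a * neg_exp (snd p) ^ b))"
| add: "bipolynomial f \<Longrightarrow> bipolynomial g \<Longrightarrow> bipolynomial (\<lambda>p. f p + g p)"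

lemma bipolynomial_mult:
  assumes "bipolynomial f" "bipolynomial g"
  shows "bipolynomial (\<lambda>p. f p * g p)"
  using assms(1)
proof induction
  case (monomial c a b)
  show ?case using assms(2)
  proof induction
    case (monomial d a' b')
    have "(\<lambda>p. c * (neg_exp (fst p) ^ a * neg_exp (snd p) ^ b) *
        (d * (neg_exp (fst p) ^ a' * neg_exp (snd p) ^ b'))) =
      (\<lambda>p. (c * d) * (neg_exp (fst p) ^ (a + a') * neg_exp (snd p) ^ (b + b')))"
      by (simp add: fun_eq_iff power_add mult_ac)
    then show ?case using bipolynomial.monomial[of "c * d" "a + a'" "b + b'"] by simp
  next
    case (add f g)
    then show ?case by (simp add: distrib_left bipolynomial.add)
  qed
next
  case (add f g)
  then show ?case by (simp add: distrib_right bipolynomial.add)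
qed

lemma continuous_on_bipolynomial: "bipolynomial f \<Longrightarrow> continuous_on plane f"
proof (induction rule: bipolynomial.induct)
  case (monomial c a b)
  show ?case
    by (intro continuous_on_mult continuous_on_power continuous_on_neg_exp_plane continuous_on_const)
qed (rule continuous_on_add)

lemma bipolynomial_approximation:
  assumes f: "continuous_on plane f" and r: "0 < r" and e: "0 < e"
  obtains g where "bipolynomial g" "\<And>p. p \<in> quadrant r \<Longrightarrow> \<bar>f p - g p\<bar> < e"
proof -
  interpret function_ring_on "Collect bipolynomial" "quadrant r"
  proof
    show "compact (quadrant r)" using r by (rule compact_quadrant)
  next
    fix f assume "f \<in> Collect bipolynomial"
    then show "continuous_on (quadrant r) f"
      using continuous_on_bipolynomial continuous_on_subset[OF _ quadrant_subset_plane] by auto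
  next
    fix c show "(\<lambda>_. c) \<in> Collect bipolynomial"
      using bipolynomial.monomial[of c 0 0] by simp
  next
    fix x y assume xy: "x \<in> quadrant r" "y \<in> quadrant r" "x \<noteq> y"
    have "neg_exp (fst x) \<noteq> neg_exp (fst y) \<or> neg_exp (snd x) \<noteq> neg_exp (snd y)"
      using xy by (auto simp: quadrant_def plane_def prod_eq_iff inj_on_eq_iff[OF inj_on_neg_exp])
    then show "\<exists>f\<in>Collect bipolynomial. f x \<noteq> f y"
      using bipolynomial.monomial[of 1 1 0] bipolynomial.monomial[of 1 0 1] by auto
  qed (auto intro: bipolynomial.add bipolynomial_mult)
  from Stone_Weierstrass_basic[OF continuous_on_subset[OF f quadrant_subset_plane] e] that show ?thesis
    by auto
qed

lemma sets_restrict_plane: "B \<in> sets (restrict_space borel plane) \<longleftrightarrow> B \<in> sets borel \<and> B \<subseteq> plane"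
proof -
  have "open plane" unfolding plane_def by (intro open_Times) auto
  then show ?thesis by (subst sets_restrict_space_iff) auto
qed

lemma integrable_test_function:
  assumes nu: "\<nu> \<in> radon_measures plane" and f: "f \<in> test_functions plane"
  shows "integrable \<nu> f"
proof -
  from f obtain K where K: "compact K" "K \<subseteq> plane" "\<And>p. p \<in> plane - K \<Longrightarrow> f p = 0"
      and cf: "continuous_on plane f"
    by (auto simp: test_functions_def)
  have sets: "sets \<nu> = sets (restrict_space borel plane)"
    and fin: "emeasure \<nu> K < \<infinity>"
    using nu K by (auto simp: radon_measures_def)
  have sp: "space \<nu> = plane"
    using sets_eq_imp_space_eq[OF sets] by (simp add: space_restrict_space)
  have "bounded (f ` K)"
    by (intro compact_imp_bounded compact_continuous_image continuous_on_subset[OF cf] K)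
  then obtain B where B: "\<And>p. p \<in> K \<Longrightarrow> norm (f p) \<le> B"
    by (force simp: bounded_iff)
  show ?thesis
  proof (rule integrableI_bounded_set[where A=K and B=B])
    show "K \<in> sets \<nu>"
      using K by (auto simp: sets sets_restrict_plane compact_imp_closed)
    show "f \<in> borel_measurable \<nu>"
      using borel_measurable_continuous_on_restrict[OF cf] measurable_cong_sets[OF sets refl] by auto
  qed (use fin B K in \<open>auto simp: sp\<close>)
qed

definition probe_integrals :: "(ereal \<times> ereal) measure \<Rightarrow> nat \<Rightarrow> real" where
  "probe_integrals \<nu> j = integral\<^sup>L \<nu> (probe j)"

text \<open>
  Continuity at \<open>\<nu>0\<close> of \<open>\<nu> \<mapsto> \<integral>f d\<nu>\<close> with
  respect to finitely many of the sequence of probes.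
\<close>

definition probe_continuous_at :: "(ereal \<times> ereal) measure \<Rightarrow> (ereal \<times> ereal \<Rightarrow> real) \<Rightarrow> bool" where
  "probe_continuous_at \<nu>0 f \<longleftrightarrow> (\<forall>e>0. \<exists>N d. 0 < d \<and> (\<forall>\<nu>\<in>radon_measures plane.
      (\<forall>j<N. \<bar>probe_integrals \<nu> j - probe_integrals \<nu>0 j\<bar> < d) \<longrightarrow>
      \<bar>integral\<^sup>L \<nu> f - integral\<^sup>L \<nu>0 f\<bar> < e))"

lemma probe_continuous_at_bipolynomial:
  assumes nu0: "\<nu>0 \<in> radon_measures plane" and g: "bipolynomial g"
  shows "probe_continuous_at \<nu>0 (\<lambda>p. g p * cutoff n p) \<and>
         (\<forall>\<nu>\<in>radon_measures plane. integrable \<nu> (\<lambda>p. g p * cutoff n p))"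
  using g
proof induction
  case (monomial c a b)
  define j where "j = prod_encode (n, prod_encode (a, b))"
  have eq: "(\<lambda>p. c * (neg_exp (fst p) ^ a * neg_exp (snd p) ^ b) * cutoff n p) = (\<lambda>p. c * probe j p)"
    by (simp add: fun_eq_iff j_def probe_eq mult_ac)
  have int: "integrable \<nu> (probe j)" if "\<nu> \<in> radon_measures plane" for \<nu>
    using integrable_test_function[OF that probe_test_function] .
  have "probe_continuous_at \<nu>0 (\<lambda>p. c * probe j p)"
    unfolding probe_continuous_at_def
  proof (intro allI impI)
    fix e :: real assume e: "0 < e"
    show "\<exists>N d. 0 < d \<and> (\<forall>\<nu>\<in>radon_measures plane.
      (\<forall>j<N. \<bar>probe_integrals \<nu> j - probe_integrals \<nu>0 j\<bar> < d) \<longrightarrow>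
      \<bar>integral\<^sup>L \<nu> (\<lambda>p. c * probe j p) - integral\<^sup>L \<nu>0 (\<lambda>p. c * probe j p)\<bar> < e)"
    proof (intro exI conjI ballI impI)
      show "0 < e / (\<bar>c\<bar> + 1)" using e by simp
      fix \<nu> assume nu: "\<nu> \<in> radon_measures plane" and
        *: "\<forall>i<Suc j. \<bar>probe_integrals \<nu> i - probe_integrals \<nu>0 i\<bar> < e / (\<bar>c\<bar> + 1)"
      have "\<bar>integral\<^sup>L \<nu> (\<lambda>p. c * probe j p) - integral\<^sup>L \<nu>0 (\<lambda>p. c * probe j p)\<bar> =
          \<bar>c\<bar> * \<bar>probe_integrals \<nu> j - probe_integrals \<nu>0 j\<bar>"
        by (simp add: probe_integrals_def abs_mult flip: right_diff_distrib)
      also have "\<dots> \<le> \<bar>c\<bar> * (e / (\<bar>c\<bar> + 1))"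
        using *[rule_format, of j] by (intro mult_left_mono) auto
      also have "\<dots> < e"
        using e by (simp add: field_simps)
      finally show "\<bar>integral\<^sup>L \<nu> (\<lambda>p. c * probe j p) - integral\<^sup>L \<nu>0 (\<lambda>p. c * probe j p)\<bar> < e" .
    qed
  qed
  then show ?case
    unfolding eq using int by (intro conjI ballI integrable_mult_right) auto
next
  case (add f g)
  let ?f = "\<lambda>p. f p * cutoff n p" and ?g = "\<lambda>p. g p * cutoff n p"
  have "probe_continuous_at \<nu>0 (\<lambda>p. ?f p + ?g p)"
    unfolding probe_continuous_at_def
  proof (intro allI impI)
    fix e :: real assume e: "0 < e"
    obtain N1 d1 where 1: "0 < d1" "\<And>\<nu>. \<nu> \<in> radon_measures plane \<Longrightarrow> 
      (\<forall>j<N1. \<bar>probe_integrals \<nu> j - probe_integrals \<nu>0 j\<bar> < d1) \<Longrightarrow>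
      \<bar>integral\<^sup>L \<nu> ?f - integral\<^sup>L \<nu>0 ?f\<bar> < e/2"
      using add(3)[THEN conjunct1, unfolded probe_continuous_at_def, rule_format, of "e/2"] e by auto
    obtain N2 d2 where 2: "0 < d2" "\<And>\<nu>. \<nu> \<in> radon_measures plane \<Longrightarrow> 
      (\<forall>j<N2. \<bar>probe_integrals \<nu> j - probe_integrals \<nu>0 j\<bar> < d2) \<Longrightarrow>
      \<bar>integral\<^sup>L \<nu> ?g - integral\<^sup>L \<nu>0 ?g\<bar> < e/2"
      using add(4)[THEN conjunct1, unfolded probe_continuous_at_def, rule_format, of "e/2"] e by auto
    show "\<exists>N d. 0 < d \<and> (\<forall>\<nu>\<in>radon_measures plane.
      (\<forall>j<N. \<bar>probe_integrals \<nu> j - probe_integrals \<nu>0 j\<bar> < d) \<longrightarrow>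
      \<bar>integral\<^sup>L \<nu> (\<lambda>p. ?f p + ?g p) - integral\<^sup>L \<nu>0 (\<lambda>p. ?f p + ?g p)\<bar> < e)"
    proof (intro exI conjI ballI impI)
      show "0 < min d1 d2" using 1 2 by simp
      fix \<nu> assume nu: "\<nu> \<in> radon_measures plane" and
        *: "\<forall>i<max N1 N2. \<bar>probe_integrals \<nu> i - probe_integrals \<nu>0 i\<bar> < min d1 d2"
      have a: "\<bar>integral\<^sup>L \<nu> ?f - integral\<^sup>L \<nu>0 ?f\<bar> < e/2"
        using * by (intro 1 nu) auto
      have b: "\<bar>integral\<^sup>L \<nu> ?g - integral\<^sup>L \<nu>0 ?g\<bar> < e/2"
        using * by (intro 2 nu) auto
      have s: "integral\<^sup>L \<nu>' (\<lambda>p. ?f p + ?g p) = integral\<^sup>L \<nu>' ?f + integral\<^sup>L \<nu>' ?g"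
        if "\<nu>' \<in> radon_measures plane" for \<nu>'
        using add(3,4) that by (intro Bochner_Integration.integral_add) auto
      show "\<bar>integral\<^sup>L \<nu> (\<lambda>p. ?f p + ?g p) - integral\<^sup>L \<nu>0 (\<lambda>p. ?f p + ?g p)\<bar> < e"
        using a b s[OF nu] s[OF nu0] by linarith
    qed
  qed
  moreover have "integrable \<nu> (\<lambda>p. ?f p + ?g p)" if "\<nu> \<in> radon_measures plane" for \<nu>
    using add(3,4) that by (intro Bochner_Integration.integrable_add) auto
  ultimately show ?case
    by (simp add: distrib_right)
qed

text \<open>
  A test function supported in a box differs from a polynomial times the cutoff by at most a
  small multiple of the cutoff, and the mass of the cutoff is itself controlled by a probe.
\<close>

lemma probe_continuous_at_test_function:
  assumes nu0: "\<nu>0 \<in> radon_measures plane" and f: "f \<in> test_functions plane"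
  shows "probe_continuous_at \<nu>0 f"
  unfolding probe_continuous_at_def
proof (intro allI impI)
  fix e :: real assume e: "0 < e"
  from f obtain K where K: "compact K" "K \<subseteq> plane" "\<And>p. p \<in> plane - K \<Longrightarrow> f p = 0"
      and cf: "continuous_on plane f"
    by (auto simp: test_functions_def)
  obtain n where n: "K \<subseteq> quadrant (real n)" using compact_subset_quadrant[OF K(1,2)] .
  let ?c = "integral\<^sup>L \<nu>0 (cutoff n)"
  have c0: "0 \<le> ?c" by (intro integral_nonneg_AE) (auto simp: cutoff_nonneg)
  \<comment> \<open>the cutoff has mass at most \<open>?c + 1\<close> under all measures near \<open>\<nu>0\<close>\<close>
  define e' where "e' = e / (4 * (?c + 1))"
  have e': "0 < e'" using e c0 by (simp add: e'_def)
  obtain g where g: "bipolynomial g" "\<And>p. p \<in> quadrant (real n + 1) \<Longrightarrow> \<bar>f p - g p\<bar> < e'"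
    using bipolynomial_approximation[OF cf _ e', of "real n + 1"] by auto
  have appr: "\<bar>f p - g p * cutoff n p\<bar> \<le> e' * cutoff n p" if p: "p \<in> plane" for p
  proof -
    have "f p = f p * cutoff n p"
    proof (cases "p \<in> quadrant (real n)")
      case True then show ?thesis by (simp add: cutoff_eq_1)
    next
      case False
      with n p have "p \<in> plane - K" by auto
      then show ?thesis using K(3) by simp
    qed
    then have "\<bar>f p - g p * cutoff n p\<bar> = \<bar>f p - g p\<bar> * cutoff n p"
      using cutoff_nonneg[of n p] by (metis abs_mult abs_of_nonneg left_diff_distrib)
    also have "\<dots> \<le> e' * cutoff n p"
    proof (cases "p \<in> quadrant (real n + 1)")
      case True
      then show ?thesis using g(2)[OF True] cutoff_nonneg[of n p] by (intro mult_right_mono) auto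
    next
      case False
      then show ?thesis using cutoff_eq_0[OF p False] by simp
    qed
    finally show ?thesis .
  qed
  have pc: "probe_continuous_at \<nu>0 (\<lambda>p. g p * cutoff n p)"
    and ig: "\<And>\<nu>. \<nu>\<in>radon_measures plane \<Longrightarrow> integrable \<nu> (\<lambda>p. g p * cutoff n p)"
    using probe_continuous_at_bipolynomial[OF nu0 g(1), of n] by auto
  have "bipolynomial (\<lambda>_. 1)" using bipolynomial.monomial[of 1 0 0] by simp
  from probe_continuous_at_bipolynomial[OF nu0 this, of n]
  have pc1: "probe_continuous_at \<nu>0 (cutoff n)"
    and i1: "\<And>\<nu>. \<nu>\<in>radon_measures plane \<Longrightarrow> integrable \<nu> (cutoff n)" by auto
  have diff: "\<bar>integral\<^sup>L \<nu> f - integral\<^sup>L \<nu> (\<lambda>p. g p * cutoff n p)\<bar> \<le> e' * integral\<^sup>L \<nu> (cutoff n)"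
    if nu: "\<nu>\<in>radon_measures plane" for \<nu>
  proof -
    have sp: "space \<nu> = plane"
      using nu sets_eq_imp_space_eq[of \<nu> "restrict_space borel plane"]
      by (simp add: radon_measures_def space_restrict_space)
    have if': "integrable \<nu> f" by (rule integrable_test_function[OF nu f])
    have "\<bar>integral\<^sup>L \<nu> f - integral\<^sup>L \<nu> (\<lambda>p. g p * cutoff n p)\<bar> = 
        \<bar>integral\<^sup>L \<nu> (\<lambda>p. f p - g p * cutoff n p)\<bar>"
      using if' ig[OF nu] by simp
    also have "\<dots> \<le> integral\<^sup>L \<nu> (\<lambda>p. \<bar>f p - g p * cutoff n p\<bar>)"
      by (rule integral_abs_bound)
    also have "\<dots> \<le> integral\<^sup>L \<nu> (\<lambda>p. e' * cutoff n p)"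
      using if' ig[OF nu] i1[OF nu] appr sp by (intro integral_mono) auto
    finally show ?thesis by simp
  qed
  obtain N1 d1 where 1: "0 < d1" "\<And>\<nu>. \<nu> \<in> radon_measures plane \<Longrightarrow> 
      (\<forall>j<N1. \<bar>probe_integrals \<nu> j - probe_integrals \<nu>0 j\<bar> < d1) \<Longrightarrow>
      \<bar>integral\<^sup>L \<nu> (\<lambda>p. g p * cutoff n p) - integral\<^sup>L \<nu>0 (\<lambda>p. g p * cutoff n p)\<bar> < e/4"
    using pc[unfolded probe_continuous_at_def, rule_format, of "e/4"] e by auto
  obtain N2 d2 where 2: "0 < d2" "\<And>\<nu>. \<nu> \<in> radon_measures plane \<Longrightarrow> 
      (\<forall>j<N2. \<bar>probe_integrals \<nu> j - probe_integrals \<nu>0 j\<bar> < d2) \<Longrightarrow>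
      \<bar>integral\<^sup>L \<nu> (cutoff n) - integral\<^sup>L \<nu>0 (cutoff n)\<bar> < 1"
    using pc1[unfolded probe_continuous_at_def, rule_format, of 1] by auto
  show "\<exists>N d. 0 < d \<and> (\<forall>\<nu>\<in>radon_measures plane.
      (\<forall>j<N. \<bar>probe_integrals \<nu> j - probe_integrals \<nu>0 j\<bar> < d) \<longrightarrow>
      \<bar>integral\<^sup>L \<nu> f - integral\<^sup>L \<nu>0 f\<bar> < e)"
  proof (intro exI conjI ballI impI)
    show "0 < min d1 d2" using 1 2 by simp
    fix \<nu> assume nu: "\<nu> \<in> radon_measures plane" and
      *: "\<forall>i<max N1 N2. \<bar>probe_integrals \<nu> i - probe_integrals \<nu>0 i\<bar> < min d1 d2"
    have a: "\<bar>integral\<^sup>L \<nu> (\<lambda>p. g p * cutoff n p) - integral\<^sup>L \<nu>0 (\<lambda>p. g p * cutoff n p)\<bar> < e/4"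
      using * by (intro 1 nu) auto
    have b: "\<bar>integral\<^sup>L \<nu> (cutoff n) - ?c\<bar> < 1"
      using * by (intro 2 nu) auto
    have "e' * integral\<^sup>L \<nu> (cutoff n) \<le> e' * (?c + 1)"
      using b e' by (intro mult_left_mono) auto
    also have "\<dots> = e/4" using c0 by (simp add: e'_def field_simps)
    finally have x: "e' * integral\<^sup>L \<nu> (cutoff n) \<le> e/4" .
    have "e' * ?c \<le> e' * (?c + 1)" using e' by simp
    also have "\<dots> = e/4" using c0 by (simp add: e'_def field_simps)
    finally have y: "e' * ?c \<le> e/4" .
    show "\<bar>integral\<^sup>L \<nu> f - integral\<^sup>L \<nu>0 f\<bar> < e"
      using a x y diff[OF nu] diff[OF nu0] e by linarith
  qed
qed

text \<open>
  The sequence of probe integrals embeds the Radon measures into the space of real sequences.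
  This replaces second countability of the vague topology: a vaguely open set is described by
  countably many numbers.
\<close>

lemma openin_vague_topology_pullback:
  assumes "openin (vague_topology plane) V"
  shows "\<exists>G. open G \<and> V = {\<nu> \<in> radon_measures plane. probe_integrals \<nu> \<in> G}"
proof -
  have "generate_topology_on {{\<nu> \<in> radon_measures plane. integral\<^sup>L \<nu> f \<in> U} | f U. 
      f \<in> test_functions plane \<and> open U} V"
    using assms unfolding vague_topology_def openin_topology_generated_by_iff .
  then show ?thesis
  proof induction
    case Empty
    show ?case by (rule exI[of _ "{}"]) auto
  next
    case (Int a b)
    from Int.IH obtain O1 where O1: "open O1" "a = {\<nu> \<in> radon_measures plane. probe_integrals \<nu> \<in> O1}"
      by (elim exE conjE)
    from Int.IH obtain O2 where O2: "open O2" "b = {\<nu> \<in> radon_measures plane. probe_integrals \<nu> \<in> O2}"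
      by (elim exE conjE)
    have "a \<inter> b = {\<nu> \<in> radon_measures plane. probe_integrals \<nu> \<in> O1 \<inter> O2}"
      unfolding O1(2) O2(2) by auto
    with O1(1) O2(1) show ?case by (intro exI[of _ "O1 \<inter> O2"] conjI open_Int)
  next
    case (UN K)
    then have "\<forall>k\<in>K. \<exists>G. open G \<and> k = {\<nu> \<in> radon_measures plane. probe_integrals \<nu> \<in> G}"
      by blast
    from bchoice[OF this] obtain G where
      G: "\<And>k. k \<in> K \<Longrightarrow> open (G k)" "\<And>k. k \<in> K \<Longrightarrow> k = {\<nu> \<in> radon_measures plane. probe_integrals \<nu> \<in> G k}"
      by auto
    have "\<Union>K = {\<nu> \<in> radon_measures plane. probe_integrals \<nu> \<in> (\<Union>k\<in>K. G k)}"
      using G(2) by auto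
    with G(1) show ?case by (intro exI[of _ "\<Union>k\<in>K. G k"] conjI open_UN) auto
  next
    case (Basis s)
    then obtain f U where f: "f \<in> test_functions plane" and U: "open U" 
      and s: "s = {\<nu> \<in> radon_measures plane. integral\<^sup>L \<nu> f \<in> U}" by blast
    let ?nb = "\<lambda>\<nu>0 N d. {w :: nat \<Rightarrow> real. \<forall>j<N. \<bar>w j - probe_integrals \<nu>0 j\<bar> < d}"
    define O' where "O' = \<Union>{?nb \<nu>0 N d | \<nu>0 N d. 
        {\<nu> \<in> radon_measures plane. probe_integrals \<nu> \<in> ?nb \<nu>0 N d} \<subseteq> s}"
    have op: "open (?nb \<nu>0 N d)" for \<nu>0 N d
    proof -
      have "?nb \<nu>0 N d = (\<Inter>j<N. {w. \<bar>w j - probe_integrals \<nu>0 j\<bar> < d})" by auto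
      moreover have "open {w :: nat \<Rightarrow> real. \<bar>w j - probe_integrals \<nu>0 j\<bar> < d}" for j
        by (intro open_Collect_less continuous_intros) auto
      ultimately show ?thesis by auto
    qed
    have "open O'" unfolding O'_def using op by (intro open_Union) auto
    moreover have "s = {\<nu> \<in> radon_measures plane. probe_integrals \<nu> \<in> O'}"
    proof (intro equalityI subsetI)
      fix \<nu>0 assume nu0: "\<nu>0 \<in> s"
      then have r: "\<nu>0 \<in> radon_measures plane" and "integral\<^sup>L \<nu>0 f \<in> U" by (auto simp: s)
      then obtain e where e: "0 < e" "\<And>y. dist y (integral\<^sup>L \<nu>0 f) < e \<Longrightarrow> y \<in> U"
        using U unfolding open_dist by blast
      obtain N d where d: "0 < d" and nd: "\<And>\<nu>. \<nu> \<in> radon_measures plane \<Longrightarrow> 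
        (\<forall>j<N. \<bar>probe_integrals \<nu> j - probe_integrals \<nu>0 j\<bar> < d) \<Longrightarrow>
        \<bar>integral\<^sup>L \<nu> f - integral\<^sup>L \<nu>0 f\<bar> < e"
        using probe_continuous_at_test_function[OF r f, unfolded probe_continuous_at_def, rule_format, OF e(1)] by auto
      have "{\<nu> \<in> radon_measures plane. probe_integrals \<nu> \<in> ?nb \<nu>0 N d} \<subseteq> s"
        using nd e(2) by (auto simp: s dist_norm)
      moreover have "probe_integrals \<nu>0 \<in> ?nb \<nu>0 N d" using d by auto
      ultimately show "\<nu>0 \<in> {\<nu> \<in> radon_measures plane. probe_integrals \<nu> \<in> O'}"
        using r unfolding O'_def by blast
    qed (auto simp: O'_def)
    ultimately show ?case by blast
  qed
qed

lemma measurable_integral_vague: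
  assumes "f \<in> test_functions E"
  shows "(\<lambda>\<nu>. integral\<^sup>L \<nu> f) \<in> borel_measurable (borel_of_topology (vague_topology E))"
proof (rule borel_measurableI)
  fix S :: "real set" assume "open S"
  then have "openin (vague_topology E) {\<nu> \<in> radon_measures E. integral\<^sup>L \<nu> f \<in> S}"
    unfolding vague_topology_def using assms by (intro topology_generated_by_Basis) auto
  then show "(\<lambda>\<nu>. integral\<^sup>L \<nu> f) -` S \<inter> space (borel_of_topology (vague_topology E))
      \<in> sets (borel_of_topology (vague_topology E))"
    by (auto simp: topspace_vague_topology vimage_def Int_def conj_commute intro!: openin_sets_borel_of_topology)
qed

lemma measurable_probe_integrals:
  "probe_integrals \<in> borel_measurable (borel_of_topology (vague_topology plane))"
  by (intro measurable_coordinatewise_then_product)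
     (auto simp: probe_integrals_def intro: measurable_integral_vague[OF probe_test_function])

text \<open>
  Measurability with respect to uncountably many open sets reduces to the coordinates because
  the space of real sequences is second countable.
\<close>

lemma measurable_into_vague_topology:
  assumes r: "\<And>\<omega>. \<omega> \<in> space M \<Longrightarrow> Y \<omega> \<in> radon_measures plane"
    and m: "\<And>f. f \<in> test_functions plane \<Longrightarrow> (\<lambda>\<omega>. integral\<^sup>L (Y \<omega>) f) \<in> borel_measurable M"
  shows "Y \<in> measurable M (borel_of_topology (vague_topology plane))"
  unfolding borel_of_topology_def
proof (rule measurable_measure_of)
  show "Y \<in> space M \<rightarrow> topspace (vague_topology plane)"
    using r by (auto simp: topspace_vague_topology)
  fix V assume "V \<in> {U. openin (vague_topology plane) U}"
  then obtain O' where O': "open O'" "V = {\<nu> \<in> radon_measures plane. probe_integrals \<nu> \<in> O'}"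
    using openin_vague_topology_pullback by blast
  have "(\<lambda>\<omega>. probe_integrals (Y \<omega>)) \<in> borel_measurable M"
    by (intro measurable_coordinatewise_then_product)
       (auto simp: probe_integrals_def intro: m probe_test_function)
  then have "(\<lambda>\<omega>. probe_integrals (Y \<omega>)) -` O' \<inter> space M \<in> sets M"
    using O'(1) by (intro measurable_sets[where A = borel]) auto
  also have "(\<lambda>\<omega>. probe_integrals (Y \<omega>)) -` O' \<inter> space M = Y -` V \<inter> space M"
    using r by (auto simp: O'(2))
  finally show "Y -` V \<inter> space M \<in> sets M" .
qed (auto dest: openin_subset)

text \<open>
  The set \<open>W n\<close> consists of the points from which no change of the first
  \<open>n\<close> coordinates by less than \<open>1/(n+1)\<close>, together with any change of
  the others, leaves the open set. Its complement is a union of open sets.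
\<close>

lemma open_eq_Union_stable:
  fixes G :: "(nat \<Rightarrow> real) set"
  assumes G: "open G"
  obtains W where "\<And>n. closed (W n)" "incseq W" "G = (\<Union>n. W n)"
    "\<And>n v w. v \<in> W n \<Longrightarrow> (\<And>j. j < n \<Longrightarrow> \<bar>w j - v j\<bar> < 1 / (real n + 1)) \<Longrightarrow> w \<in> G"
proof -
  define W where "W n = {v. \<forall>w. (\<forall>j<n. \<bar>w j - v j\<bar> < 1 / (real n + 1)) \<longrightarrow> w \<in> G}" for n
  show ?thesis
  proof
    fix n
    have "- W n = (\<Union>w\<in>-G. {v. \<forall>j<n. \<bar>w j - v j\<bar> < 1 / (real n + 1)})"
      by (auto simp: W_def)
    also have "open \<dots>"
    proof (rule open_UN, rule ballI)
      fix w :: "nat \<Rightarrow> real"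
      have "{v. \<forall>j<n. \<bar>w j - v j\<bar> < 1 / (real n + 1)} = (\<Inter>j<n. {v. \<bar>w j - v j\<bar> < 1 / (real n + 1)})" by auto
      moreover have "open {v. \<bar>w j - v j\<bar> < 1 / (real n + 1)}" for j
        by (intro open_Collect_less continuous_intros) auto
      ultimately show "open {v. \<forall>j<n. \<bar>w j - v j\<bar> < 1 / (real n + 1)}" by auto
    qed
    finally show "closed (W n)" by (simp add: closed_def)
  next
    show "incseq W"
    proof (rule incseq_SucI, rule subsetI)
      fix n v assume v: "v \<in> W n"
      show "v \<in> W (Suc n)"
        unfolding W_def
      proof (intro CollectI allI impI)
        fix w assume *: "\<forall>j<Suc n. \<bar>w j - v j\<bar> < 1 / (real (Suc n) + 1)"
        have "\<bar>w j - v j\<bar> < 1 / (real n + 1)" if "j < n" for j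
          using *[rule_format, of j] that
          by (auto intro: less_le_trans simp: frac_le)
        then show "w \<in> G" using v by (auto simp: W_def)
      qed
    qed
  next
    show "G = (\<Union>n. W n)"
    proof (intro equalityI subsetI)
      fix v assume "v \<in> G"
      then obtain U where U: "finite {i. U i \<noteq> UNIV}" "\<And>i. open (U i)" "\<And>i. v i \<in> U i" "Pi\<^sub>E UNIV U \<subseteq> G"
        using G unfolding open_fun_def openin_product_topology_alt
        by (auto simp: PiE_UNIV_domain Pi_iff)
      have "\<exists>e>0. \<forall>y. \<bar>y - v i\<bar> < e \<longrightarrow> y \<in> U i" for i
        using U(2)[of i] U(3)[of i] unfolding open_dist by (auto simp: dist_norm)
      then obtain e where e: "\<And>i. 0 < e i" "\<And>i y. \<bar>y - v i\<bar> < e i \<Longrightarrow> y \<in> U i" by metis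
      have "\<forall>\<^sub>F n in sequentially. \<forall>i\<in>{i. U i \<noteq> UNIV}. i < n \<and> 1 / (real n + 1) < e i"
      proof (intro eventually_ball_finite U(1) ballI eventually_conj eventually_gt_at_top)
        fix i
        have "(\<lambda>n. 1 / (real n + 1)) \<longlonglongrightarrow> 0"
          using LIMSEQ_inverse_real_of_nat by (simp add: inverse_eq_divide add.commute)
        then show "\<forall>\<^sub>F n in sequentially. 1 / (real n + 1) < e i"
          using e(1) by (rule order_tendstoD)
      qed
      then obtain n where n: "\<And>i. U i \<noteq> UNIV \<Longrightarrow> i < n \<and> 1 / (real n + 1) < e i"
        by (auto simp: eventually_sequentially)
      have "v \<in> W n"
        unfolding W_def
      proof (intro CollectI allI impI)
        fix w assume w: "\<forall>j<n. \<bar>w j - v j\<bar> < 1 / (real n + 1)"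
        have "w i \<in> U i" for i
          using n[of i] w e(2)[of "w i" i] by (cases "U i = UNIV") force+
        then show "w \<in> G" using U(4) by (auto simp: PiE_UNIV_domain)
      qed
      then show "v \<in> (\<Union>n. W n)" by blast
    qed (auto simp: W_def)
  qed (auto simp: W_def)
qed

section \<open>Dissociated events and random finite sets\<close>

definition depends_on :: "nat set \<Rightarrow> ((nat \<Rightarrow> nat) \<Rightarrow> bool) \<Rightarrow> bool" where
  "depends_on A P \<longleftrightarrow> (\<forall>s s'. (\<forall>i\<in>A. s i = s' i) \<longrightarrow> P s = P s')"

lemma depends_onD: "depends_on A P \<Longrightarrow> (\<And>i. i \<in> A \<Longrightarrow> s i = s' i) \<Longrightarrow> P s = P s'"
  unfolding depends_on_def by blast

lemma depends_on_restrict: "depends_on A P \<Longrightarrow> P (restrict s A) = P s"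
  by (rule depends_onD) auto

lemma restrict_predicate_event:
  fixes X :: "nat \<Rightarrow> 'a \<Rightarrow> nat"
  assumes A: "finite A" "\<And>i. i \<in> A \<Longrightarrow> X i \<in> measurable M (count_space UNIV)" and P: "depends_on A P"
  shows "{\<omega> \<in> space M. P (\<lambda>i. X i \<omega>)} = (\<lambda>\<omega>. restrict (\<lambda>i. X i \<omega>) A) -` {s \<in> space (PiM A (\<lambda>_. count_space UNIV)). P s} \<inter> space M"
    and "{s \<in> space (PiM A (\<lambda>_. count_space (UNIV::nat set))). P s} \<in> sets (PiM A (\<lambda>_. count_space UNIV))"
    and "{\<omega> \<in> space M. P (\<lambda>i. X i \<omega>)} \<in> sets M"
proof -
  show 1: "{\<omega> \<in> space M. P (\<lambda>i. X i \<omega>)} = (\<lambda>\<omega>. restrict (\<lambda>i. X i \<omega>) A) -` {s \<in> space (PiM A (\<lambda>_. count_space UNIV)). P s} \<inter> space M"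
    using depends_on_restrict[OF P] by (auto simp: space_PiM PiE_def)
  show 2: "{s \<in> space (PiM A (\<lambda>_. count_space (UNIV::nat set))). P s} \<in> sets (PiM A (\<lambda>_. count_space UNIV))"
    using count_space_PiM_finite[OF A(1), of "\<lambda>_. UNIV :: nat set"] by simp
  have "(\<lambda>\<omega>. restrict (\<lambda>i. X i \<omega>) A) \<in> measurable M (PiM A (\<lambda>_. count_space UNIV))"
    using A(2) by (intro measurable_restrict) auto
  from measurable_sets[OF this 2] show "{\<omega> \<in> space M. P (\<lambda>i. X i \<omega>)} \<in> sets M" unfolding 1 .
qed

lemma (in prob_space) indep_predicates:
  fixes X :: "nat \<Rightarrow> 'a \<Rightarrow> nat"
  assumes X: "indep_vars (\<lambda>_. count_space UNIV) X I"
    and A: "finite A" "A \<subseteq> I" and B: "finite B" "B \<subseteq> I" and AB: "A \<inter> B = {}"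
    and P: "depends_on A P" and Q: "depends_on B Q"
  shows "prob {\<omega> \<in> space M. P (\<lambda>i. X i \<omega>) \<and> Q (\<lambda>i. X i \<omega>)} =
         prob {\<omega> \<in> space M. P (\<lambda>i. X i \<omega>)} * prob {\<omega> \<in> space M. Q (\<lambda>i. X i \<omega>)}"
proof -
  have X': "X i \<in> measurable M (count_space UNIV)" if "i \<in> I" for i
    using X that by (auto simp: indep_vars_def)
  have XA: "\<And>i. i \<in> A \<Longrightarrow> X i \<in> measurable M (count_space UNIV)"
    and XB: "\<And>i. i \<in> B \<Longrightarrow> X i \<in> measurable M (count_space UNIV)" using X' A B by auto
  let ?A = "{s \<in> space (PiM A (\<lambda>_. count_space UNIV)). P s}"
  let ?B = "{s \<in> space (PiM B (\<lambda>_. count_space UNIV)). Q s}"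
  let ?XA = "\<lambda>\<omega>. restrict (\<lambda>i. X i \<omega>) A" and ?XB = "\<lambda>\<omega>. restrict (\<lambda>i. X i \<omega>) B"
  have ind: "indep_var (PiM A (\<lambda>_. count_space UNIV)) ?XA (PiM B (\<lambda>_. count_space UNIV)) ?XB"
    by (rule indep_var_restrict[OF X AB A(2) B(2)])
  have "prob (?XA -` ?A \<inter> space M \<inter> (?XB -` ?B \<inter> space M)) = prob (?XA -` ?A \<inter> space M) * prob (?XB -` ?B \<inter> space M)"
    using indep_varD[OF ind restrict_predicate_event(2)[OF A(1) XA P] restrict_predicate_event(2)[OF B(1) XB Q]]
    by (simp add: vimage_def Int_def conj_ac) 
  also have "?XA -` ?A \<inter> space M \<inter> (?XB -` ?B \<inter> space M) = {\<omega> \<in> space M. P (\<lambda>i. X i \<omega>) \<and> Q (\<lambda>i. X i \<omega>)}"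
    by (simp only: restrict_predicate_event(1)[OF A(1) XA P, symmetric] 
          restrict_predicate_event(1)[OF B(1) XB Q, symmetric]) auto
  finally show ?thesis
    by (simp only: restrict_predicate_event(1)[OF A(1) XA P, symmetric] 
          restrict_predicate_event(1)[OF B(1) XB Q, symmetric])
qed

text \<open>
  The events \<open>G\<close> are the rare events proper and \<open>H\<close> are simpler events
  containing them. Conditioning on the past changes the probability of \<open>G n\<close> only
  through the last \<open>m\<close> indices: dropping these from the void event makes it
  independent of \<open>G n\<close>, and costs at most the mean number of \<open>H\<close> in
  the window. So each step multiplies the void probability by \<open>1 - prob (G n)\<close> up
  to an error of order \<open>s * prob (H n)\<close>.
\<close>

lemma (in prob_space) dissociated_void_probability:
  fixes G H :: "nat \<Rightarrow> 'a set" and m n :: nat and s :: real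
  assumes G: "\<And>k. k < n \<Longrightarrow> G k \<in> events" and H: "\<And>k. k < n \<Longrightarrow> H k \<in> events"
    and GH: "\<And>k. k < n \<Longrightarrow> G k \<subseteq> H k"
    and far: "\<And>k. k < n \<Longrightarrow> prob ((space M - (\<Union>j<k-m. G j)) \<inter> G k) = prob (space M - (\<Union>j<k-m. G j)) * prob (G k)"
    and near: "\<And>j k. k < n \<Longrightarrow> j < k \<Longrightarrow> k - m \<le> j \<Longrightarrow> prob (H j \<inter> H k) \<le> prob (H j) * prob (H k)"
    and window: "\<And>k. k < n \<Longrightarrow> (\<Sum>j\<in>{k-m..k}. prob (H j)) \<le> s"
  shows "\<bar>prob (space M - (\<Union>k<n. G k)) - exp (- (\<Sum>k<n. prob (G k)))\<bar> \<le> 3 * s * (\<Sum>k<n. prob (H k))"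
  using assms
proof (induction n)
  case 0
  then show ?case by (simp add: prob_space)
next
  case (Suc n)
  define D where "D k = space M - (\<Union>j<k. G j)" for k
  define p where "p = prob (G n)"
  define q where "q = prob (H n)"
  have Ge: "G j \<in> events" if "j < Suc n" for j using Suc.prems(1) that .
  have He: "H j \<in> events" if "j < Suc n" for j using Suc.prems(2) that .
  have De: "D k \<in> events" if "k \<le> Suc n" for k unfolding D_def using Ge that by auto
  have w: "(\<Sum>j\<in>{n-m..n}. prob (H j)) \<le> s" using Suc.prems(6) by simp
  have split: "{n-m..n} = insert n {n-m..<n}" by auto
  have w': "(\<Sum>j\<in>{n-m..<n}. prob (H j)) \<le> s" "q \<le> s"
  proof -
    have "q + (\<Sum>j\<in>{n-m..<n}. prob (H j)) \<le> s" using w unfolding split q_def by simp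
    moreover have "0 \<le> (\<Sum>j\<in>{n-m..<n}. prob (H j))" "0 \<le> q" by (auto simp: q_def intro: sum_nonneg)
    ultimately show "(\<Sum>j\<in>{n-m..<n}. prob (H j)) \<le> s" "q \<le> s" by auto
  qed
  have pq: "p \<le> q" unfolding p_def q_def using Suc.prems(3) He by (intro finite_measure_mono) auto
  have p0: "0 \<le> p" "p \<le> 1" "0 \<le> q" by (auto simp: p_def q_def)
  have s0: "0 \<le> s" using w'(2) p0 by simp
  have IH: "\<bar>prob (D n) - exp (- (\<Sum>k<n. prob (G k)))\<bar> \<le> 3 * s * (\<Sum>k<n. prob (H k))"
    unfolding D_def by (rule Suc.IH) (use Suc.prems in auto)
  \<comment> \<open>compare the void event up to \<open>n\<close> with the one that stops \<open>m\<close> indices earlier\<close>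
  have Dsuc: "D (Suc n) = D n - G n" unfolding D_def by (auto simp: lessThan_Suc)
  have step1: "prob (D (Suc n)) = prob (D n) - prob (D n \<inter> G n)"
    unfolding Dsuc using De[of n] Ge[of n] by (simp add: finite_measure_Diff')
  have dec: "D n \<subseteq> D (n - m)" unfolding D_def by auto
  have "D (n - m) - D n \<subseteq> (\<Union>j\<in>{n-m..<n}. G j)"
  proof -
    have "{..<n} = {..<n-m} \<union> {n-m..<n}" by auto
    then show ?thesis unfolding D_def by auto
  qed
  also have "\<dots> \<subseteq> (\<Union>j\<in>{n-m..<n}. H j)"
    by (intro UN_mono order_refl Suc.prems(3)) auto
  finally have diff: "D (n - m) - D n \<subseteq> (\<Union>j\<in>{n-m..<n}. H j)" .
  have GHn: "G n \<subseteq> H n" by (rule Suc.prems(3)) simp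
  have sub: "prob (D n) \<le> prob (D (n-m))" using dec De by (intro finite_measure_mono) auto
  have a: "prob (D (n-m)) - prob (D n) \<le> s"
  proof -
    have "prob (D (n-m)) - prob (D n) = prob (D (n-m) - D n)"
      using finite_measure_Diff[OF De De dec] by simp
    also have "\<dots> \<le> prob (\<Union>j\<in>{n-m..<n}. H j)"
      using diff He by (intro finite_measure_mono sets.finite_UN) auto
    also have "\<dots> \<le> (\<Sum>j\<in>{n-m..<n}. prob (H j))"
      using He by (intro finite_measure_subadditive_finite) auto
    finally show ?thesis using w' by simp
  qed
  have b: "prob (D (n-m) \<inter> G n) - prob (D n \<inter> G n) \<le> q * s"
  proof -
    have "prob (D (n-m) \<inter> G n) - prob (D n \<inter> G n) = prob ((D (n-m) - D n) \<inter> G n)"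
    proof -
      have "(D (n-m) - D n) \<inter> G n = D (n-m) \<inter> G n - D n \<inter> G n" by auto
      moreover have "D n \<inter> G n \<subseteq> D (n-m) \<inter> G n" using dec by auto
      ultimately show ?thesis using De Ge finite_measure_Diff[of "D (n-m) \<inter> G n" "D n \<inter> G n"] by simp
    qed
    also have "\<dots> \<le> prob (\<Union>j\<in>{n-m..<n}. H j \<inter> H n)"
    proof (intro finite_measure_mono sets.finite_UN sets.Int He)
      show "(D (n - m) - D n) \<inter> G n \<subseteq> (\<Union>j\<in>{n-m..<n}. H j \<inter> H n)"
        using diff GHn by blast
    qed auto
    also have "\<dots> \<le> (\<Sum>j\<in>{n-m..<n}. prob (H j \<inter> H n))"
      using He by (intro finite_measure_subadditive_finite) auto
    also have "\<dots> \<le> (\<Sum>j\<in>{n-m..<n}. prob (H j) * prob (H n))"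
      by (intro sum_mono Suc.prems(5)) auto
    also have "\<dots> = q * (\<Sum>j\<in>{n-m..<n}. prob (H j))" by (simp add: q_def sum_distrib_left mult.commute)
    also have "\<dots> \<le> q * s" using w' p0 by (intro mult_left_mono) auto
    finally show ?thesis .
  qed
  have b': "prob (D n \<inter> G n) \<le> prob (D (n-m) \<inter> G n)" using dec De Ge by (intro finite_measure_mono) auto
  have c: "prob (D (n-m) \<inter> G n) = prob (D (n-m)) * p" unfolding D_def p_def by (rule Suc.prems(4)) simp
  have d: "p * (prob (D (n-m)) - prob (D n)) \<le> p * s" "0 \<le> p * (prob (D (n-m)) - prob (D n))"
    using a p0 sub by (auto intro: mult_left_mono)
  have ps: "p * s \<le> q * s" using pq s0 by (rule mult_right_mono)
  have step2: "\<bar>prob (D (Suc n)) - prob (D n) * (1 - p)\<bar> \<le> q * s"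
    using step1 b b' c d ps by (auto simp: algebra_simps abs_le_iff)
  have ex: "\<bar>(1 - p) - exp (- p)\<bar> \<le> q * s"
  proof -
    have "1 - p \<le> exp (- p)" using exp_ge_add_one_self[of "-p"] by simp
    moreover have "exp (- p) \<le> 1 - p + p * p"
    proof -
      have "exp (- p) \<le> 1 / (1 + p)"
        using exp_ge_add_one_self[of p] p0 by (simp add: exp_minus field_simps)
      also have "\<dots> \<le> 1 - p + p * p"
        using p0 by (simp add: field_simps)
      finally show ?thesis .
    qed
    moreover have "p * p \<le> q * s" using pq w'(2) p0 by (intro mult_mono) auto
    ultimately show ?thesis by (auto simp: abs_le_iff)
  qed
  let ?E = "exp (- (\<Sum>k<n. prob (G k)))"
  have E: "exp (- (\<Sum>k<Suc n. prob (G k))) = ?E * exp (- p)" by (simp add: p_def flip: exp_add)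
  have x1: "\<bar>prob (D n) * (1 - p) - ?E * (1 - p)\<bar> \<le> 3 * s * (\<Sum>k<n. prob (H k))"
  proof -
    have "\<bar>prob (D n) * (1 - p) - ?E * (1 - p)\<bar> = \<bar>prob (D n) - ?E\<bar> * (1 - p)"
      using p0 by (simp add: abs_mult flip: left_diff_distrib)
    also have "\<dots> \<le> \<bar>prob (D n) - ?E\<bar> * 1" using p0 by (intro mult_left_mono) auto
    finally show ?thesis using IH by simp
  qed
  have x2: "\<bar>?E * (1 - p) - ?E * exp (- p)\<bar> \<le> q * s"
  proof -
    have E1: "?E \<le> 1" by (auto intro: sum_nonneg)
    have "\<bar>?E * (1 - p) - ?E * exp (- p)\<bar> = ?E * \<bar>(1 - p) - exp (- p)\<bar>"
      by (simp add: abs_mult flip: right_diff_distrib)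
    also have "\<dots> \<le> 1 * \<bar>(1 - p) - exp (- p)\<bar>" using E1 by (intro mult_right_mono) auto
    finally show ?thesis using ex by simp
  qed
  have "\<bar>prob (D (Suc n)) - ?E * exp (- p)\<bar> \<le> q * s + 3 * s * (\<Sum>k<n. prob (H k)) + q * s"
    using step2 x1 x2 by linarith
  also have "\<dots> \<le> 3 * s * (\<Sum>k<Suc n. prob (H k))"
    using p0 s0 mult_nonneg_nonneg[of q s] by (simp add: q_def algebra_simps)
  finally show ?case unfolding E D_def by simp
qed

text \<open>
  The first set collects indices that must be empty and the second those that must not; an index
  moves from the second set to the first by inclusion and exclusion, so the case of an empty
  second set suffices.
\<close>

lemma tendsto_indicator_law:
  fixes P :: "'i \<Rightarrow> 'c set \<Rightarrow> 'c set \<Rightarrow> real" and Q :: "'c set \<Rightarrow> 'c set \<Rightarrow> real"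
  assumes fin: "finite K"
    and P: "\<And>i J K a. a \<notin> K \<Longrightarrow> a \<notin> J \<Longrightarrow> insert a (J \<union> K) \<subseteq> I \<Longrightarrow> P i J (insert a K) = P i J K - P i (insert a J) K"
    and Q: "\<And>J K a. a \<notin> K \<Longrightarrow> a \<notin> J \<Longrightarrow> insert a (J \<union> K) \<subseteq> I \<Longrightarrow> Q J (insert a K) = Q J K - Q (insert a J) K"
    and lim: "\<And>J. J \<subseteq> I \<Longrightarrow> ((\<lambda>i. P i J {}) \<longlongrightarrow> Q J {}) F"
    and JK: "J \<union> K \<subseteq> I" "J \<inter> K = {}"
  shows "((\<lambda>i. P i J K) \<longlongrightarrow> Q J K) F"
  using fin JK
proof (induction K arbitrary: J rule: finite_induct)
  case empty
  then show ?case using lim by auto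
next
  case (insert a K)
  have "((\<lambda>i. P i J K - P i (insert a J) K) \<longlongrightarrow> Q J K - Q (insert a J) K) F"
    using insert by (intro tendsto_diff insert.IH) auto
  moreover have "P i J (insert a K) = P i J K - P i (insert a J) K" for i
    using insert by (intro P) auto
  moreover have "Q J (insert a K) = Q J K - Q (insert a J) K"
    using insert by (intro Q) auto
  ultimately show ?case by simp
qed

definition pattern_event :: "'x measure \<Rightarrow> ('x \<Rightarrow> 'c set) \<Rightarrow> 'c set \<Rightarrow> 'c set \<Rightarrow> 'x set" where
  "pattern_event N T J K = {\<omega> \<in> space N. T \<omega> \<inter> J = {} \<and> K \<subseteq> T \<omega>}"

lemma pattern_event_sets:
  assumes T: "\<And>c. c \<in> I \<Longrightarrow> {\<omega> \<in> space N. c \<in> T \<omega>} \<in> sets N" and I: "finite I" and JK: "J \<subseteq> I" "K \<subseteq> I"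
  shows "pattern_event N T J K \<in> sets N"
proof -
  have fin: "finite J" "finite K" using JK I finite_subset by auto
  have "pattern_event N T J K = (space N - (\<Union>c\<in>J. {\<omega> \<in> space N. c \<in> T \<omega>})) \<inter> (space N - (\<Union>c\<in>K. space N - {\<omega> \<in> space N. c \<in> T \<omega>}))"
    by (auto simp: pattern_event_def)
  also have "\<dots> \<in> sets N" using T JK fin by (intro sets.Int sets.Diff sets.finite_UN) auto
  finally show ?thesis .
qed

lemma (in prob_space) pattern_event_insert:
  assumes T: "\<And>c. c \<in> I \<Longrightarrow> {\<omega> \<in> space M. c \<in> T \<omega>} \<in> events" and I: "finite I" and JK: "insert a (J \<union> K) \<subseteq> I"
  shows "prob (pattern_event M T J (insert a K)) = prob (pattern_event M T J K) - prob (pattern_event M T (insert a J) K)"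
proof -
  have "pattern_event M T J (insert a K) = pattern_event M T J K - pattern_event M T (insert a J) K" by (auto simp: pattern_event_def)
  moreover have "pattern_event M T (insert a J) K \<subseteq> pattern_event M T J K" by (auto simp: pattern_event_def)
  ultimately show ?thesis using pattern_event_sets[OF T I] JK by (simp add: finite_measure_Diff)
qed

lemma (in prob_space) prob_random_set_mem:
  assumes T0: "\<And>\<omega>. \<omega> \<in> space M \<Longrightarrow> T \<omega> \<subseteq> I" and T: "\<And>c. c \<in> I \<Longrightarrow> {\<omega> \<in> space M. c \<in> T \<omega>} \<in> events"
    and I: "finite I" and A: "A \<subseteq> Pow I"
  shows "{\<omega> \<in> space M. T \<omega> \<in> A} \<in> events"
    and "prob {\<omega> \<in> space M. T \<omega> \<in> A} = (\<Sum>B\<in>A. prob (pattern_event M T (I - B) B))"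
proof -
  have fA: "finite A" using A I by (meson finite_Pow_iff finite_subset)
  have pe: "pattern_event M T (I - B) B = {\<omega> \<in> space M. T \<omega> = B}" if "B \<in> A" for B
    unfolding pattern_event_def using that A T0 by blast
  then have eq: "{\<omega> \<in> space M. T \<omega> \<in> A} = (\<Union>B\<in>A. pattern_event M T (I - B) B)" by auto
  have ev: "pattern_event M T (I - B) B \<in> events" if "B \<in> A" for B
    using that A by (intro pattern_event_sets[OF T I]) auto
  show "{\<omega> \<in> space M. T \<omega> \<in> A} \<in> events" unfolding eq using fA ev by auto
  have "disjoint_family_on (\<lambda>B. pattern_event M T (I - B) B) A"
    by (auto simp: disjoint_family_on_def pe)
  then show "prob {\<omega> \<in> space M. T \<omega> \<in> A} = (\<Sum>B\<in>A. prob (pattern_event M T (I - B) B))"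
    unfolding eq using fA ev by (intro finite_measure_finite_Union) auto
qed

text \<open>
  A finite form of the theorem of Renyi: by inclusion and exclusion, the probability that the
  set takes a given value is an alternating sum of void probabilities.
\<close>

lemma random_set_law_tendsto:
  fixes S :: "'i \<Rightarrow> 'a \<Rightarrow> 'c set" and S' :: "'b \<Rightarrow> 'c set"
  assumes M: "prob_space M" and M': "prob_space M'" and I: "finite I"
    and S: "\<And>i \<omega>. \<omega> \<in> space M \<Longrightarrow> S i \<omega> \<subseteq> I" "\<And>i c. c \<in> I \<Longrightarrow> {\<omega> \<in> space M. c \<in> S i \<omega>} \<in> sets M"
    and S': "\<And>\<omega>. \<omega> \<in> space M' \<Longrightarrow> S' \<omega> \<subseteq> I" "\<And>c. c \<in> I \<Longrightarrow> {\<omega> \<in> space M'. c \<in> S' \<omega>} \<in> sets M'"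
    and void: "\<And>U. U \<subseteq> I \<Longrightarrow> ((\<lambda>i. measure M {\<omega> \<in> space M. S i \<omega> \<inter> U = {}}) \<longlongrightarrow> measure M' {\<omega> \<in> space M'. S' \<omega> \<inter> U = {}}) F"
    and A: "A \<subseteq> Pow I"
  shows "((\<lambda>i. measure M {\<omega> \<in> space M. S i \<omega> \<in> A}) \<longlongrightarrow> measure M' {\<omega> \<in> space M'. S' \<omega> \<in> A}) F"
proof -
  interpret M: prob_space M by fact
  interpret M': prob_space M' by fact
  have lim: "((\<lambda>i. measure M (pattern_event M (S i) J K)) \<longlongrightarrow> measure M' (pattern_event M' S' J K)) F"
    if "J \<union> K \<subseteq> I" "J \<inter> K = {}" for J K
  proof (rule tendsto_indicator_law[where I=I])
    show "finite K" using that I finite_subset by auto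
    show "((\<lambda>i. measure M (pattern_event M (S i) J {})) \<longlongrightarrow> measure M' (pattern_event M' S' J {})) F" if "J \<subseteq> I" for J
      using void[OF that] by (simp add: pattern_event_def)
    show "measure M (pattern_event M (S i) J (insert a K)) = measure M (pattern_event M (S i) J K) - measure M (pattern_event M (S i) (insert a J) K)"
      if "insert a (J \<union> K) \<subseteq> I" for i J K a using M.pattern_event_insert[OF S(2) I that] .
    show "measure M' (pattern_event M' S' J (insert a K)) = measure M' (pattern_event M' S' J K) - measure M' (pattern_event M' S' (insert a J) K)"
      if "insert a (J \<union> K) \<subseteq> I" for J K a using M'.pattern_event_insert[OF S'(2) I that] .
  qed (use that in auto)
  have "measure M {\<omega> \<in> space M. S i \<omega> \<in> A} = (\<Sum>B\<in>A. measure M (pattern_event M (S i) (I - B) B))" for i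
    by (rule M.prob_random_set_mem(2)[OF S(1) S(2) I A])
  moreover have "measure M' {\<omega> \<in> space M'. S' \<omega> \<in> A} = (\<Sum>B\<in>A. measure M' (pattern_event M' S' (I - B) B))"
    by (rule M'.prob_random_set_mem(2)[OF S'(1) S'(2) I A])
  ultimately show ?thesis
    using A by (auto intro!: tendsto_sum lim)
qed

text \<open>The right-hand side is the mean number of events that occur beyond the first one.\<close>

lemma (in prob_space) prob_two_events_le:
  fixes n :: nat
  assumes "\<And>k. k < n \<Longrightarrow> E k \<in> events"
  shows "prob {\<omega> \<in> space M. \<exists>k<n. \<exists>j<k. \<omega> \<in> E j \<and> \<omega> \<in> E k} \<le> (\<Sum>k<n. prob (E k)) - prob (\<Union>k<n. E k)"
  using assms
proof (induction n)
  case (Suc n)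
  let ?D = "\<lambda>n. {\<omega> \<in> space M. \<exists>k<n. \<exists>j<k. \<omega> \<in> E j \<and> \<omega> \<in> E k}" and ?U = "\<lambda>n. \<Union>k<n. E k"
  have ev: "E k \<in> events" if "k < Suc n" for k using Suc.prems that .
  have U: "?U n \<in> events" using ev by auto
  have D: "?D n \<in> events"
  proof -
    have "?D n = (\<Union>k<n. \<Union>j<k. E j \<inter> E k) \<inter> space M" by auto
    also have "\<dots> \<in> events"
      by (intro sets.Int sets.finite_UN sets.top ev) auto
    finally show ?thesis .
  qed
  have "?D (Suc n) \<subseteq> ?D n \<union> (?U n \<inter> E n)" by (auto simp: less_Suc_eq)
  then have "prob (?D (Suc n)) \<le> prob (?D n \<union> (?U n \<inter> E n))"
    using D U ev by (intro finite_measure_mono) auto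
  also have "\<dots> \<le> prob (?D n) + prob (?U n \<inter> E n)"
    using D U ev by (intro measure_Un_le) auto
  also have "\<dots> \<le> (\<Sum>k<n. prob (E k)) - prob (?U n) + prob (?U n \<inter> E n)"
    using Suc.IH Suc.prems by simp
  also have "\<dots> = (\<Sum>k<Suc n. prob (E k)) - prob (?U (Suc n))"
    using measure_Un3[of "?U n" M "E n"] U ev by (simp add: lessThan_Suc fmeasurable_eq_sets Un_commute)
  finally show ?case .
qed simp

section \<open>Epochs and gaps seen through a time grid\<close>

definition counting_path :: "(real \<Rightarrow> 'a \<Rightarrow> nat) \<Rightarrow> 'a \<Rightarrow> bool" where
  "counting_path N \<omega> \<longleftrightarrow> N 0 \<omega> = 0 \<and> mono_on {0..} (\<lambda>t. N t \<omega>) \<and>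
     (\<forall>t\<ge>0. continuous (at_right t) (\<lambda>s. N s \<omega>))"

lemma counting_pathI:
  "inhomogeneous_poisson_process M r N \<Longrightarrow> \<omega> \<in> space M \<Longrightarrow> counting_path N \<omega>"
  by (auto simp: inhomogeneous_poisson_process_def counting_path_def)

lemma counting_path_mono: "counting_path N \<omega> \<Longrightarrow> 0 \<le> s \<Longrightarrow> s \<le> t \<Longrightarrow> N s \<omega> \<le> N t \<omega>"
  by (auto simp: counting_path_def mono_on_def)

text \<open>Right-continuity makes the infimum that defines the epoch a minimum.\<close>

lemma epoch_le_iff:
  assumes path: "counting_path N \<omega>" and ex: "\<exists>t\<ge>0. i \<le> N t \<omega>" and t: "0 \<le> t"
  shows "epoch N i \<omega> \<le> t \<longleftrightarrow> i \<le> N t \<omega>"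
proof
  assume "i \<le> N t \<omega>"
  then show "epoch N i \<omega> \<le> t"
    unfolding epoch_def using t by (intro cInf_lower) (auto intro: bdd_belowI[of _ 0])
next
  let ?S = "{t. 0 \<le> t \<and> i \<le> N t \<omega>}"
  let ?T = "epoch N i \<omega>"
  assume le: "?T \<le> t"
  have ne: "?S \<noteq> {}" using ex by auto
  have T0: "0 \<le> ?T" unfolding epoch_def using ne by (intro cInf_greatest) auto
  have "i \<le> N ?T \<omega>"
  proof -
    have "((\<lambda>t. N t \<omega>) \<longlongrightarrow> N ?T \<omega>) (at_right ?T)"
      using path T0 by (auto simp: counting_path_def continuous_within)
    then have "\<forall>\<^sub>F s in at_right ?T. N s \<omega> = N ?T \<omega>"
      by (auto simp: tendsto_discrete)
    then obtain b where b: "?T < b" "\<And>s. ?T < s \<Longrightarrow> s < b \<Longrightarrow> N s \<omega> = N ?T \<omega>"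
      unfolding eventually_at_right_field by auto
    have "Inf ?S < b" using b(1) by (simp add: epoch_def)
    then obtain s where s: "s \<in> ?S" "s < b" using cInf_lessD[OF ne] by blast
    have "?T \<le> s" unfolding epoch_def using s(1) by (intro cInf_lower) (auto intro: bdd_belowI[of _ 0])
    then show ?thesis using b(2)[of s] s by (cases "s = ?T") auto
  qed
  also have "\<dots> \<le> N t \<omega>" using counting_path_mono[OF path T0 le] .
  finally show "i \<le> N t \<omega>" .
qed

lemma epoch_nonneg: "\<exists>t\<ge>0. i \<le> N t \<omega> \<Longrightarrow> 0 \<le> epoch N i \<omega>"
  unfolding epoch_def by (intro cInf_greatest) auto

lemma epoch_0 [simp]: "epoch N 0 \<omega> = 0"
proof -
  have "{t::real. 0 \<le> t} = {0..}" by auto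
  then show ?thesis by (simp add: epoch_def)
qed

lemma early_epoch_indices:
  assumes path: "counting_path N \<omega>" and c: "0 \<le> c"
  shows "{i \<in> epoch_indices N \<omega>. epoch N i \<omega> \<le> c} = {1..N c \<omega>}"
proof (intro set_eqI)
  fix i
  show "i \<in> {i \<in> epoch_indices N \<omega>. epoch N i \<omega> \<le> c} \<longleftrightarrow> i \<in> {1..N c \<omega>}"
  proof (cases "\<exists>t\<ge>0. i \<le> N t \<omega>")
    case True
    then show ?thesis using epoch_le_iff[OF path True c] by (auto simp: epoch_indices_def)
  next
    case False
    then show ?thesis using c by (auto simp: epoch_indices_def)
  qed
qed

definition slot_count :: "(real \<Rightarrow> 'a \<Rightarrow> nat) \<Rightarrow> real \<Rightarrow> nat \<Rightarrow> 'a \<Rightarrow> nat" where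
  "slot_count N h k \<omega> = N (real (Suc k) * h) \<omega> - N (real k * h) \<omega>"

text \<open>
  The run counts back from slot \<open>k\<close> and stops at time \<open>0\<close> at the
  latest, where the first gap starts.
\<close>

primrec empty_run :: "(nat \<Rightarrow> nat) \<Rightarrow> nat \<Rightarrow> nat" where
  "empty_run s 0 = 0"
| "empty_run s (Suc k) = (if s k = 0 then Suc (empty_run s k) else 0)"

lemma le_empty_run_iff: "m \<le> empty_run s k \<longleftrightarrow> m \<le> k \<and> (\<forall>j<k. k - m \<le> j \<longrightarrow> s j = 0)"
proof (induction k arbitrary: m)
  case (Suc k)
  show ?case
  proof (cases m)
    case (Suc m')
    then show ?thesis using Suc.IH[of m'] by (auto simp: less_Suc_eq)
  qed auto
qed auto

lemma empty_run_le: "empty_run s k \<le> k"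
  using le_empty_run_iff[of "empty_run s k" s k] by simp

context
  fixes N :: "real \<Rightarrow> 'a \<Rightarrow> nat" and \<omega> :: 'a and h :: real and n :: nat and s :: "nat \<Rightarrow> nat"
  assumes path: "counting_path N \<omega>" and h: "0 < h"
    and s_def: "\<And>k. s k = slot_count N h k \<omega>"
    and simple: "\<And>k. k < n \<Longrightarrow> s k \<le> 1"
begin

lemma count_Suc: "N (real (Suc k) * h) \<omega> = N (real k * h) \<omega> + s k"
proof -
  have "N (real k * h) \<omega> \<le> N (real (Suc k) * h) \<omega>"
    using h by (intro counting_path_mono[OF path] mult_right_mono) auto
  then show ?thesis by (simp add: s_def slot_count_def)
qed

lemma count_empty_run: "N (real (k - empty_run s k) * h) \<omega> = N (real k * h) \<omega>"
proof (induction k)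
  case (Suc k)
  then show ?case using count_Suc[of k] by auto
qed simp

lemma epoch_of_slot:
  assumes "k < n" "s k \<noteq> 0"
  shows "N (real (Suc k) * h) \<omega> \<in> epoch_indices N \<omega>"
    and "real k * h < epoch N (N (real (Suc k) * h) \<omega>) \<omega>"
    and "epoch N (N (real (Suc k) * h) \<omega>) \<omega> \<le> real (Suc k) * h"
proof -
  let ?i = "N (real (Suc k) * h) \<omega>"
  have ex: "\<exists>t\<ge>0. ?i \<le> N t \<omega>" using h by (intro exI[of _ "real (Suc k) * h"]) auto
  then show "?i \<in> epoch_indices N \<omega>"
    using count_Suc[of k] assms(2) by (auto simp: epoch_indices_def)
  show "epoch N ?i \<omega> \<le> real (Suc k) * h" using epoch_le_iff[OF path ex, of "real (Suc k) * h"] h by simp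
  have "\<not> ?i \<le> N (real k * h) \<omega>" using count_Suc[of k] assms(2) by simp
  then show "real k * h < epoch N ?i \<omega>" using epoch_le_iff[OF path ex, of "real k * h"] h by simp
qed

text \<open>
  The gap that ends in slot \<open>k\<close> begins in the last slot before the empty run, or at
  time \<open>0\<close> if the run reaches back to it. This fixes its length up to two slots.
\<close>

lemma gap_of_slot:
  assumes k: "k < n" "s k \<noteq> 0"
  shows "real (empty_run s k) * h \<le> gap N (N (real (Suc k) * h) \<omega>) \<omega>"
    and "gap N (N (real (Suc k) * h) \<omega>) \<omega> \<le> real (empty_run s k) * h + 2 * h"
proof -
  let ?i = "N (real (Suc k) * h) \<omega>" and ?L = "empty_run s k"
  have "s k = 1" using simple[OF k(1)] k(2) by simp
  then have i1: "?i - 1 = N (real (k - ?L) * h) \<omega>" using count_Suc[of k] count_empty_run[of k] by simp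
  have T: "real k * h < epoch N ?i \<omega>" "epoch N ?i \<omega> \<le> real (Suc k) * h"
    using epoch_of_slot[OF k] by auto
  have T': "real (k - ?L) * h - h \<le> epoch N (?i - 1) \<omega>" "epoch N (?i - 1) \<omega> \<le> real (k - ?L) * h"
  proof -
    have "real (k - ?L) * h - h \<le> epoch N (?i - 1) \<omega> \<and> epoch N (?i - 1) \<omega> \<le> real (k - ?L) * h"
    proof (cases "k - ?L")
      case 0
      then have "?i - 1 = 0" using i1 path by (simp add: counting_path_def)
      with 0 h show ?thesis by simp
    next
      case (Suc j)
      have "\<not> Suc ?L \<le> empty_run s k" by simp
      moreover have "Suc ?L \<le> k" using Suc by simp
      ultimately obtain j' where "j' < k" "k - Suc ?L \<le> j'" "s j' \<noteq> 0"
        unfolding le_empty_run_iff by blast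
      moreover have "s j'' = 0" if "j'' < k" "k - ?L \<le> j''" for j''
        using le_empty_run_iff[of ?L s k] that by simp
      ultimately have "j' = j" using Suc by (metis Suc_diff_Suc Suc_le_lessD diff_Suc_Suc 
            \<open>Suc ?L \<le> k\<close> diff_is_0_eq' le_SucE le_neq_implies_less less_antisym linorder_not_le not_less_eq_eq order_le_less)
      then have "s j \<noteq> 0" using \<open>s j' \<noteq> 0\<close> by simp
      moreover have "j < n" using Suc k(1) by linarith
      ultimately show ?thesis
        using epoch_of_slot[of j] i1 Suc by (simp add: algebra_simps)
    qed
    then show "real (k - ?L) * h - h \<le> epoch N (?i - 1) \<omega>" "epoch N (?i - 1) \<omega> \<le> real (k - ?L) * h" by auto
  qed
  have kL: "real (k - ?L) * h = real k * h - real ?L * h"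
    using empty_run_le[of s k] by (simp add: of_nat_diff algebra_simps)
  show "real ?L * h \<le> gap N ?i \<omega>" "gap N ?i \<omega> \<le> real ?L * h + 2 * h"
    using T T' unfolding gap_def kL by (auto simp: algebra_simps)
qed

text \<open>
  When no slot holds two epochs, the number of epochs up to the end of an occupied slot is the
  index of the epoch in it.
\<close>

lemma bij_betw_slots_epochs:
  "bij_betw (\<lambda>k. N (real (Suc k) * h) \<omega>) {k. k < n \<and> s k \<noteq> 0} {i \<in> epoch_indices N \<omega>. epoch N i \<omega> \<le> real n * h}"
  unfolding bij_betw_def
proof
  let ?f = "\<lambda>k. N (real (Suc k) * h) \<omega>"
  have less: "?f k < ?f k'" if "k < k'" "s k' \<noteq> 0" for k k'
  proof -
    have "?f k \<le> N (real k' * h) \<omega>"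
      using that h by (intro counting_path_mono[OF path] mult_right_mono) auto
    also have "\<dots> < ?f k'" using count_Suc[of k'] that by simp
    finally show ?thesis .
  qed
  show "inj_on ?f {k. k < n \<and> s k \<noteq> 0}"
  proof (rule inj_onI)
    fix k k' assume "k \<in> {k. k < n \<and> s k \<noteq> 0}" "k' \<in> {k. k < n \<and> s k \<noteq> 0}" "?f k = ?f k'"
    then show "k = k'" using less[of k k'] less[of k' k] by (cases k k' rule: linorder_cases) auto
  qed
  show "?f ` {k. k < n \<and> s k \<noteq> 0} = {i \<in> epoch_indices N \<omega>. epoch N i \<omega> \<le> real n * h}"
  proof (intro equalityI subsetI)
    fix i assume "i \<in> ?f ` {k. k < n \<and> s k \<noteq> 0}"
    then obtain k where k: "k < n" "s k \<noteq> 0" "i = ?f k" by auto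
    have "real (Suc k) * h \<le> real n * h" using k h by (intro mult_right_mono) auto
    then show "i \<in> {i \<in> epoch_indices N \<omega>. epoch N i \<omega> \<le> real n * h}"
      using epoch_of_slot[OF k(1,2)] k(3) by auto
  next
    fix i assume i: "i \<in> {i \<in> epoch_indices N \<omega>. epoch N i \<omega> \<le> real n * h}"
    then have i1: "1 \<le> i" and iN: "i \<le> N (real n * h) \<omega>"
      using early_epoch_indices[OF path, of "real n * h"] h by auto
    have "n \<noteq> 0" using i1 iN path by (cases n) (auto simp: counting_path_def)
    then have ex: "i \<le> ?f (n - 1)" using iN by simp
    define k where "k = (LEAST k. i \<le> ?f k)"
    have k: "i \<le> ?f k" unfolding k_def using ex by (rule LeastI)
    have kn: "k < n" using Least_le[of "\<lambda>k. i \<le> ?f k", OF ex] \<open>n \<noteq> 0\<close> unfolding k_def by simp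
    have "N (real k * h) \<omega> < i"
    proof (cases k)
      case 0
      then show ?thesis using i1 path by (auto simp: counting_path_def)
    next
      case (Suc k')
      then have "\<not> i \<le> ?f k'" unfolding k_def by (intro not_less_Least) simp
      then show ?thesis using Suc by simp
    qed
    then have "s k \<noteq> 0" "i = ?f k" using k count_Suc[of k] simple[OF kn] by auto
    then show "i \<in> ?f ` {k. k < n \<and> s k \<noteq> 0}" using kn by auto
  qed
qed

end

lemma gap_point_in_plane: "gap_point \<alpha> lam1 N t \<omega> i \<in> plane"
  by (simp add: gap_point_def plane_def)

lemma gap_point_in_quadrantD:
  assumes "1 < t" "0 < r" "neg_exp (snd (gap_point \<alpha> lam1 N t \<omega> i)) \<le> r"
  shows "epoch N i \<omega> \<le> t * (1 + ln r / ln t)"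
proof -
  have "exp (- ((t - epoch N i \<omega>) / t * ln t)) \<le> r"
    using assms by (simp add: gap_point_def)
  then have "- ((t - epoch N i \<omega>) / t * ln t) \<le> ln r"
    using assms(2) by (metis exp_le_cancel_iff exp_ln)
  then show ?thesis using assms(1) by (simp add: field_simps)
qed

text \<open>
  Only finitely many epochs are seen by a function with compact support, because the second
  coordinate of a point of a compact set bounds the epoch from above.
\<close>

lemma integral_gap_process:
  assumes path: "counting_path N \<omega>" and t: "1 < t" and r: "0 < r"
    and f: "f \<in> borel_measurable (restrict_space borel plane)"
    and supp: "\<And>p. p \<in> plane \<Longrightarrow> f p \<noteq> 0 \<Longrightarrow> p \<in> quadrant r"
    and c: "0 \<le> c" "t * (1 + ln r / ln t) \<le> c"
  shows "integral\<^sup>L (gap_process \<alpha> lam1 N t \<omega>) f =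
      (\<Sum>i | i \<in> epoch_indices N \<omega> \<and> epoch N i \<omega> \<le> c. f (gap_point \<alpha> lam1 N t \<omega> i) :: real)"
proof -
  let ?p = "gap_point \<alpha> lam1 N t \<omega>"
  have late: "i \<in> {i \<in> epoch_indices N \<omega>. epoch N i \<omega> \<le> c}" if "i \<in> epoch_indices N \<omega>" "f (?p i) \<noteq> 0" for i
    using gap_point_in_quadrantD[OF t r, of \<alpha> lam1 N \<omega> i] supp[OF gap_point_in_plane that(2)] that(1) c
    by (auto simp: quadrant_def)
  have fin: "finite {i \<in> epoch_indices N \<omega>. epoch N i \<omega> \<le> c}"
    using early_epoch_indices[OF path c(1)] by simp
  have "integral\<^sup>L (gap_process \<alpha> lam1 N t \<omega>) f = (\<integral>i. f (?p i) \<partial>count_space (epoch_indices N \<omega>))"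
    unfolding gap_process_def
    by (rule integral_distr) (auto simp: f space_restrict_space gap_point_in_plane)
  also have "\<dots> = (\<Sum>i | i \<in> epoch_indices N \<omega> \<and> f (?p i) \<noteq> 0. f (?p i))"
    using late by (intro lebesgue_integral_count_space_finite_support finite_subset[OF _ fin]) auto
  also have "\<dots> = (\<Sum>i | i \<in> epoch_indices N \<omega> \<and> epoch N i \<omega> \<le> c. f (?p i))"
    using late fin by (intro sum.mono_neutral_left) auto
  finally show ?thesis .
qed

lemma gap_process_radon:
  assumes path: "counting_path N \<omega>" and t: "1 < t"
  shows "gap_process \<alpha> lam1 N t \<omega> \<in> radon_measures plane"
  unfolding radon_measures_def
proof (intro CollectI conjI allI impI)
  show "sets (gap_process \<alpha> lam1 N t \<omega>) = sets (restrict_space borel plane)"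
    by (simp add: gap_process_def)
  fix K :: "(ereal \<times> ereal) set" assume K: "compact K \<and> K \<subseteq> plane"
  then obtain n where n: "K \<subseteq> quadrant (real n)" using compact_subset_quadrant by blast
  have nr: "quadrant (real n) \<subseteq> quadrant (real n + 1)" by (auto simp: quadrant_def)
  let ?p = "gap_point \<alpha> lam1 N t \<omega>"
  let ?c = "max 0 (t * (1 + ln (real n + 1) / ln t))"
  have "{i \<in> epoch_indices N \<omega>. ?p i \<in> K} \<subseteq> {i \<in> epoch_indices N \<omega>. epoch N i \<omega> \<le> ?c}"
  proof (intro subsetI CollectI conjI)
    fix i assume i: "i \<in> {i \<in> epoch_indices N \<omega>. ?p i \<in> K}"
    then show "i \<in> epoch_indices N \<omega>" by simp
    have "neg_exp (snd (?p i)) \<le> real n + 1" using i n nr by (auto simp: quadrant_def)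
    from gap_point_in_quadrantD[OF t _ this] show "epoch N i \<omega> \<le> ?c" by auto
  qed
  then have fin: "finite {i \<in> epoch_indices N \<omega>. ?p i \<in> K}"
    using early_epoch_indices[OF path, of ?c] by (auto intro: finite_subset)
  have "emeasure (gap_process \<alpha> lam1 N t \<omega>) K = emeasure (count_space (epoch_indices N \<omega>)) (?p -` K \<inter> epoch_indices N \<omega>)"
    unfolding gap_process_def using K
    by (subst emeasure_distr) (auto simp: space_restrict_space gap_point_in_plane sets_restrict_plane compact_imp_closed)
  also have "?p -` K \<inter> epoch_indices N \<omega> = {i \<in> epoch_indices N \<omega>. ?p i \<in> K}" by auto
  also have "emeasure (count_space (epoch_indices N \<omega>)) {i \<in> epoch_indices N \<omega>. ?p i \<in> K} < \<infinity>"
    using fin by (subst emeasure_count_space_finite) (auto simp: of_nat_less_top)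
  finally show "emeasure (gap_process \<alpha> lam1 N t \<omega>) K < \<infinity>" .
qed

text \<open>
  Where the infimum is over the empty set the epoch is constant, so measurability holds on the
  whole space.
\<close>

lemma epoch_measurable:
  assumes N: "inhomogeneous_poisson_process M r N"
  shows "epoch N i \<in> borel_measurable M"
  unfolding borel_measurable_iff_le
proof
  fix c :: real
  have Nm: "N t \<in> measurable M (count_space UNIV)" if "0 \<le> t" for t
    using N that by (auto simp: inhomogeneous_poisson_process_def)
  have path: "counting_path N \<omega>" if "\<omega> \<in> space M" for \<omega> using counting_pathI[OF N that] .
  have ev: "{\<omega> \<in> space M. i \<le> N t \<omega>} \<in> sets M" if "0 \<le> t" for t
    using Nm[OF that] by measurable
  have ex: "(\<exists>t\<ge>0. i \<le> N t \<omega>) \<longleftrightarrow> (\<exists>n::nat. i \<le> N (real n) \<omega>)" if "\<omega> \<in> space M" for \<omega>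
  proof
    assume "\<exists>t\<ge>0. i \<le> N t \<omega>"
    then obtain t where t: "0 \<le> t" "i \<le> N t \<omega>" by blast
    obtain n where "t \<le> real n" using real_arch_simple by blast
    then show "\<exists>n::nat. i \<le> N (real n) \<omega>"
      using counting_path_mono[OF path[OF that] t(1)] t(2) order_trans by blast
  qed (metis of_nat_0_le_iff)
  define e where "e = Inf ({} :: real set)"
  have none: "epoch N i \<omega> = e" if "\<not> (\<exists>t\<ge>0. i \<le> N t \<omega>)" for \<omega>
  proof -
    show ?thesis unfolding epoch_def e_def using that by (intro arg_cong[where f=Inf]) auto
  qed
  have "{\<omega> \<in> space M. epoch N i \<omega> \<le> c} =
      (if 0 \<le> c then {\<omega> \<in> space M. i \<le> N c \<omega>} else {}) \<union> 
      (if e \<le> c then space M - (\<Union>n. {\<omega> \<in> space M. i \<le> N (real n) \<omega>}) else {})"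
    (is "?A = ?B \<union> ?C")
  proof (intro set_eqI)
    fix \<omega>
    show "\<omega> \<in> ?A \<longleftrightarrow> \<omega> \<in> ?B \<union> ?C"
    proof (cases "\<omega> \<in> space M")
      case w: True
      show ?thesis
      proof (cases "\<exists>t\<ge>0. i \<le> N t \<omega>")
        case True
        then have "epoch N i \<omega> \<le> c \<longleftrightarrow> 0 \<le> c \<and> i \<le> N c \<omega>"
          using epoch_le_iff[OF path[OF w] True, of c] epoch_nonneg[of i N \<omega>] by force
        then show ?thesis using True w ex[OF w] by auto
      next
        case False
        then show ?thesis using w ex[OF w] none[OF False] by auto
      qed
    qed auto
  qed
  then show "{\<omega> \<in> space M. epoch N i \<omega> \<le> c} \<in> sets M"
    using ev by auto
qed

lemma gap_process_measurable:
  assumes N: "inhomogeneous_poisson_process M r N" and t: "1 < t"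
  shows "gap_process \<alpha> lam1 N t \<in> measurable M (borel_of_topology (vague_topology plane))"
proof (rule measurable_into_vague_topology)
  have path: "counting_path N \<omega>" if "\<omega> \<in> space M" for \<omega> using counting_pathI[OF N that] .
  show "gap_process \<alpha> lam1 N t \<omega> \<in> radon_measures plane" if "\<omega> \<in> space M" for \<omega>
    using gap_process_radon[OF path[OF that] t] .
  fix f :: "ereal \<times> ereal \<Rightarrow> real" assume f: "f \<in> test_functions plane"
  then obtain K where K: "compact K" "K \<subseteq> plane" "\<And>p. p \<in> plane - K \<Longrightarrow> f p = 0"
      and cf: "continuous_on plane f"
    by (auto simp: test_functions_def)
  have fm: "f \<in> borel_measurable (restrict_space borel plane)"
    by (rule borel_measurable_continuous_on_restrict[OF cf])
  obtain n where n: "K \<subseteq> quadrant (real n)" using compact_subset_quadrant[OF K(1,2)] .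
  define c where "c = max 0 (t * (1 + ln (real n + 1) / ln t))"
  have Nc: "N c \<in> measurable M (count_space UNIV)"
    using N by (auto simp: inhomogeneous_poisson_process_def c_def)
  have em [measurable]: "epoch N i \<in> borel_measurable M" for i by (rule epoch_measurable[OF N])
  have gm: "(\<lambda>\<omega>. f (gap_point \<alpha> lam1 N t \<omega> i)) \<in> borel_measurable M" for i
  proof (rule measurable_compose[OF _ fm])
    show "(\<lambda>\<omega>. gap_point \<alpha> lam1 N t \<omega> i) \<in> measurable M (restrict_space borel plane)"
    proof (rule measurable_restrict_space2)
      show "(\<lambda>\<omega>. gap_point \<alpha> lam1 N t \<omega> i) \<in> borel_measurable M"
        unfolding gap_point_def gap_def by measurable
    qed (simp add: gap_point_in_plane)
  qed
  have "(\<lambda>\<omega>. \<Sum>i\<in>{1..N c \<omega>}. f (gap_point \<alpha> lam1 N t \<omega> i)) \<in> borel_measurable M"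
    by (rule measurable_compose_countable[OF _ Nc]) (use gm in measurable)
  also have "?this \<longleftrightarrow> (\<lambda>\<omega>. integral\<^sup>L (gap_process \<alpha> lam1 N t \<omega>) f) \<in> borel_measurable M"
  proof (rule measurable_cong)
    fix \<omega> assume w: "\<omega> \<in> space M"
    have "integral\<^sup>L (gap_process \<alpha> lam1 N t \<omega>) f =
      (\<Sum>i | i \<in> epoch_indices N \<omega> \<and> epoch N i \<omega> \<le> c. f (gap_point \<alpha> lam1 N t \<omega> i))"
    proof (rule integral_gap_process[OF path[OF w] t _ fm, of "real n + 1"])
      fix p assume "p \<in> plane" "f p \<noteq> 0"
      then have "p \<in> quadrant (real n)" using K(3) n by blast
      then show "p \<in> quadrant (real n + 1)" by (auto simp: quadrant_def)
    qed (auto simp: c_def)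
    also have "{i. i \<in> epoch_indices N \<omega> \<and> epoch N i \<omega> \<le> c} = {1..N c \<omega>}"
      using early_epoch_indices[OF path[OF w], of c] by (simp add: c_def)
    finally show "(\<Sum>i\<in>{1..N c \<omega>}. f (gap_point \<alpha> lam1 N t \<omega> i)) = integral\<^sup>L (gap_process \<alpha> lam1 N t \<omega>) f" by simp
  qed
  finally show "(\<lambda>\<omega>. integral\<^sup>L (gap_process \<alpha> lam1 N t \<omega>) f) \<in> borel_measurable M" .
qed

section \<open>The mean number of long gaps\<close>

text \<open>The integral of the rate over \<open>[0, t]\<close>.\<close>

definition cumulative_rate :: "real \<Rightarrow> real \<Rightarrow> real \<Rightarrow> real" where
  "cumulative_rate \<alpha> lam1 t = lam1 / \<alpha> * t powr \<alpha>"

text \<open>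
  The probability that slot \<open>k\<close> is occupied and the \<open>m\<close> slots before
  it are empty.
\<close>

definition run_prob :: "real \<Rightarrow> real \<Rightarrow> real \<Rightarrow> nat \<Rightarrow> nat \<Rightarrow> real" where
  "run_prob \<alpha> lam1 h m k = (if m \<le> k then
     (1 - exp (- (cumulative_rate \<alpha> lam1 (real (Suc k) * h) - cumulative_rate \<alpha> lam1 (real k * h)))) *
     exp (- (cumulative_rate \<alpha> lam1 (real k * h) - cumulative_rate \<alpha> lam1 (real (k - m) * h))) else 0)"

locale decreasing_rate =
  fixes \<alpha> lam1 :: real
  assumes \<alpha>: "0 < \<alpha>" "\<alpha> < 1" and lam1: "0 < lam1"
begin

abbreviation "rt \<equiv> rate \<alpha> lam1"
abbreviation "cm \<equiv> cumulative_rate \<alpha> lam1"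

lemma rate_pos: "0 < t \<Longrightarrow> 0 < rt t"
  using lam1 by (simp add: rate_def)

lemma rate_antimono: "0 < s \<Longrightarrow> s \<le> t \<Longrightarrow> rt t \<le> rt s"
  using \<alpha> lam1 by (simp add: rate_def powr_mono2')

lemma rate_quotient_le: "0 < s \<Longrightarrow> s \<le> t \<Longrightarrow> rt s \<le> t / s * rt t"
proof -
  assume st: "0 < s" "s \<le> t"
  have "s powr \<alpha> \<le> t powr \<alpha>" using st \<alpha> by (intro powr_mono2) auto
  then have "s * s powr (\<alpha> - 1) \<le> t * t powr (\<alpha> - 1)"
    using st by (simp add: powr_mult_base)
  then show ?thesis using st lam1 by (simp add: rate_def field_simps)
qed

lemma DERIV_cum: "0 < t \<Longrightarrow> (cm has_real_derivative rt t) (at t)"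
proof -
  assume t: "0 < t"
  have "(cm has_real_derivative lam1 / \<alpha> * (\<alpha> * t powr (\<alpha> - 1))) (at t)"
    unfolding cumulative_rate_def[abs_def] using t by (auto intro!: derivative_eq_intros)
  then show ?thesis using \<alpha> by (simp add: rate_def)
qed

lemma cum_increment_upper:
  assumes "0 < a" "a \<le> b" shows "cm b - cm a \<le> (b - a) * rt a"
proof (cases "a = b")
  case False
  then obtain z where z: "a < z" "z < b" "cm b - cm a = (b - a) * rt z"
    using MVT2[of a b cm rt] DERIV_cum assms by force
  then show ?thesis using rate_antimono[of a z] assms by (auto intro!: mult_left_mono)
qed simp

lemma cum_increment_lower:
  assumes "0 \<le> a" "a \<le> b" "0 < b" shows "(b - a) * rt b \<le> cm b - cm a"
proof (cases "a = 0")
  case True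
  have "b * rt b = lam1 * b powr \<alpha>" using assms by (simp add: rate_def powr_mult_base mult.left_commute)
  also have "\<dots> \<le> lam1 / \<alpha> * b powr \<alpha>" using \<alpha> lam1 by (intro mult_right_mono) (auto simp: field_simps)
  finally show ?thesis using True by (simp add: cumulative_rate_def)
next
  case False
  show ?thesis
  proof (cases "a = b")
    case False
    then obtain z where z: "a < z" "z < b" "cm b - cm a = (b - a) * rt z"
      using MVT2[of a b cm rt] DERIV_cum assms \<open>a \<noteq> 0\<close> by force
    then show ?thesis using rate_antimono[of z b] assms by (auto intro!: mult_left_mono)
  qed simp
qed

lemma cumulative_rate_mono: "0 \<le> a \<Longrightarrow> a \<le> b \<Longrightarrow> cm a \<le> cm b"
  unfolding cumulative_rate_def using \<alpha> lam1 by (intro mult_left_mono powr_mono2) auto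

lemma cum_subadditive:
  assumes "0 \<le> a" "0 \<le> b" shows "cm (a + b) \<le> cm a + cm b"
proof (cases "a + b = 0")
  case True
  then have "a = 0" "b = 0" using assms by auto
  then show ?thesis by (simp add: cumulative_rate_def)
next
  case False
  then have ab: "0 < a + b" using assms by simp
  have *: "x * (a + b) powr (\<alpha> - 1) \<le> x powr \<alpha>" if "0 \<le> x" "x \<le> a + b" for x
  proof (cases "x = 0")
    case False
    then have "x * (a + b) powr (\<alpha> - 1) \<le> x * x powr (\<alpha> - 1)"
      using that \<alpha> by (intro mult_left_mono powr_mono2') auto
    then show ?thesis using that False by (simp add: powr_mult_base)
  qed simp
  have "(a + b) powr \<alpha> = (a + b) * (a + b) powr (\<alpha> - 1)" using ab by (simp add: powr_mult_base)
  also have "\<dots> \<le> a powr \<alpha> + b powr \<alpha>" using *[of a] *[of b] assms by (simp add: distrib_right)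
  finally have "lam1 / \<alpha> * (a + b) powr \<alpha> \<le> lam1 / \<alpha> * (a powr \<alpha> + b powr \<alpha>)"
    using \<alpha> lam1 by (intro mult_left_mono) auto
  then show ?thesis by (simp add: cumulative_rate_def distrib_left)
qed

text \<open>
  Approximately the probability of no epoch in the stretch of length \<open>r\<close> before
  time \<open>v\<close>.
\<close>

definition phi :: "real \<Rightarrow> real \<Rightarrow> real" where
  "phi r v = exp (- (r * rt v))"

lemma DERIV_phi:
  assumes "0 < v"
  shows "(phi r has_real_derivative r * (1 - \<alpha>) * rt v / v * phi r v) (at v)"
proof -
  have eq: "v powr (\<alpha> - 1 - 1) = v powr (\<alpha> - 1) / v"
    using assms powr_diff[of v "\<alpha> - 1" 1] by simp
  have "(phi r has_real_derivative exp (- (r * rt v)) * (- (r * (lam1 * ((\<alpha> - 1) * v powr (\<alpha> - 1 - 1)))))) (at v)"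
    unfolding phi_def rate_def using assms by (auto intro!: derivative_eq_intros)
  then show ?thesis
    unfolding eq using assms by (elim DERIV_cong) (simp add: phi_def rate_def field_simps)
qed

lemma phi_pos: "0 < phi r v" by (simp add: phi_def)

lemma phi_mono: "0 \<le> r \<Longrightarrow> 0 < v \<Longrightarrow> v \<le> w \<Longrightarrow> phi r v \<le> phi r w"
  using rate_antimono[of v w] by (auto simp: phi_def intro: mult_left_mono)

text \<open>
  These are mean value bounds for the derivative of \<open>phi\<close>. They allow sums over
  slots to be compared with telescoping sums.
\<close>

lemma phi_increment:
  assumes "0 < v" "v \<le> w" "0 < r"
  shows "(w - v) * (r * (1 - \<alpha>) * rt w / w * phi r v) \<le> phi r w - phi r v"
    and "phi r w - phi r v \<le> (w - v) * (r * (1 - \<alpha>) * rt v / v * phi r w)"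
proof -
  have "(w - v) * (r * (1 - \<alpha>) * rt w / w * phi r v) \<le> phi r w - phi r v \<and>
    phi r w - phi r v \<le> (w - v) * (r * (1 - \<alpha>) * rt v / v * phi r w)"
  proof (cases "v = w")
    case False
    then obtain z where z: "v < z" "z < w" 
        "phi r w - phi r v = (w - v) * (r * (1 - \<alpha>) * rt z / z * phi r z)"
      using MVT2[of v w "phi r" "\<lambda>v. r * (1 - \<alpha>) * rt v / v * phi r v"] DERIV_phi assms by force
    have z0: "0 < z" using z assms by simp
    have q1: "rt w / w \<le> rt z / z" using rate_antimono[OF z0, of w] z rate_pos[OF z0] z0
      by (intro frac_le) auto
    have q2: "rt z / z \<le> rt v / v" using rate_antimono[OF assms(1), of z] z rate_pos[OF assms(1)] assms
      by (intro frac_le) auto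
    have p1: "phi r v \<le> phi r z" "phi r z \<le> phi r w" using phi_mono assms z z0 by auto
    have "rt w / w * phi r v \<le> rt z / z * phi r z"
      using q1 p1 rate_pos[OF z0] z0 phi_pos[of r v] by (intro mult_mono) auto
    moreover have "rt z / z * phi r z \<le> rt v / v * phi r w"
      using q2 p1 rate_pos[OF assms(1)] assms phi_pos[of r z] by (intro mult_mono) auto
    moreover have "0 \<le> (w - v) * (r * (1 - \<alpha>))" using assms \<alpha> by auto
    ultimately have "(w - v) * (r * (1 - \<alpha>)) * (rt w / w * phi r v) \<le> (w - v) * (r * (1 - \<alpha>)) * (rt z / z * phi r z)"
       "(w - v) * (r * (1 - \<alpha>)) * (rt z / z * phi r z) \<le> (w - v) * (r * (1 - \<alpha>)) * (rt v / v * phi r w)"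
      by - (rule mult_left_mono, assumption, assumption)+
    then show ?thesis unfolding z(3) by (simp add: mult.assoc)
  qed simp
  then show "(w - v) * (r * (1 - \<alpha>) * rt w / w * phi r v) \<le> phi r w - phi r v"
    "phi r w - phi r v \<le> (w - v) * (r * (1 - \<alpha>) * rt v / v * phi r w)" by auto
qed

lemma run_prob_nonneg: "0 < h \<Longrightarrow> 0 \<le> run_prob \<alpha> lam1 h m k"
  using cumulative_rate_mono[of "real k * h" "real (Suc k) * h"] by (auto simp: run_prob_def mult_right_mono)

lemma run_prob_le:
  assumes h: "0 < h" and m: "0 < m" "m \<le> k"
  shows "run_prob \<alpha> lam1 h m k \<le> (cm (real (Suc k) * h) - cm (real k * h)) * phi (real m * h) (real k * h)"
proof -
  let ?D = "cm (real (Suc k) * h) - cm (real k * h)"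
  have "real m * h * rt (real k * h) \<le> cm (real k * h) - cm (real (k - m) * h)"
    using cum_increment_lower[of "real (k - m) * h" "real k * h"] h m
    by (auto simp: of_nat_diff left_diff_distrib mult_right_mono)
  then have "exp (- (cm (real k * h) - cm (real (k - m) * h))) \<le> phi (real m * h) (real k * h)"
    by (simp add: phi_def)
  moreover have "1 - exp (- ?D) \<le> ?D" using exp_ge_add_one_self[of "- ?D"] by linarith
  moreover have "0 \<le> ?D" using cumulative_rate_mono[of "real k * h" "real (Suc k) * h"] h by (auto simp: mult_right_mono)
  ultimately show ?thesis using m(2) unfolding run_prob_def by (auto intro!: mult_mono)
qed

text \<open>
  The rate decreases, so replacing the integrated rate over the run by its length times the rate
  at its end only increases the probability of the run. What remains is dominated by a
  telescoping sum of increments of \<open>phi\<close>, whose prefactor \<open>s / (r (1 -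
  \<alpha>))\<close> is largest at the end.
\<close>

lemma sum_run_prob_upper:
  assumes h: "0 < h" and m: "0 < m"
  shows "(\<Sum>k<n. run_prob \<alpha> lam1 h m k) \<le>
    (1 + 1 / real m) * (real n * h / (real m * h * (1 - \<alpha>)) * phi (real m * h) (real n * h))"
proof -
  let ?r = "real m * h"
  let ?C = "(1 + 1 / real m) * (real n * h / (?r * (1 - \<alpha>)))"
  have r: "0 < ?r" using h m by simp
  have C0: "0 \<le> ?C" using h \<alpha> by simp
  have bound: "run_prob \<alpha> lam1 h m k \<le> ?C * (phi ?r (real (Suc k) * h) - phi ?r (real k * h))" 
    if k: "m \<le> k" "k < n" for k
  proof -
    let ?v = "real k * h" and ?w = "real (Suc k) * h"
    have v: "0 < ?v" using k m h by simp
    have vw: "?v \<le> ?w" "?w - ?v = h" using h by (auto simp: algebra_simps)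
    have w: "0 < ?w" "?w \<le> real n * h" using h k by (auto intro: mult_right_mono)
    have d: "h * (?r * (1 - \<alpha>) * rt ?w / ?w * phi ?r ?v) \<le> phi ?r ?w - phi ?r ?v"
      using phi_increment(1)[OF v vw(1) r] vw(2) by simp
    have "run_prob \<alpha> lam1 h m k \<le> (cm ?w - cm ?v) * phi ?r ?v"
      using run_prob_le[OF h m k(1)] .
    also have "\<dots> \<le> (h * rt ?v) * phi ?r ?v"
      using cum_increment_upper[OF v vw(1)] vw(2) phi_pos[of ?r ?v] by (intro mult_right_mono) auto
    also have "\<dots> \<le> (h * (?w / ?v * rt ?w)) * phi ?r ?v"
      using rate_quotient_le[OF v vw(1)] h phi_pos[of ?r ?v] by (intro mult_right_mono mult_left_mono) auto
    also have "\<dots> = ?w / ?v * (?w / (?r * (1 - \<alpha>))) * (h * (?r * (1 - \<alpha>) * rt ?w / ?w * phi ?r ?v))"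
    proof -
      have gen: "(h * (W / V * RW)) * P = W / V * (W / R1) * (h * (R1 * RW / W * P))" 
        if "0 < W" "0 < V" "0 < R1" for W V R1 RW P :: real using that by (simp add: field_simps)
      show ?thesis using w(1) v r \<alpha> by (intro gen) auto
    qed
    also have "\<dots> \<le> ?w / ?v * (?w / (?r * (1 - \<alpha>))) * (phi ?r ?w - phi ?r ?v)"
      using d w v r \<alpha> by (intro mult_left_mono) auto
    also have "\<dots> \<le> ?C * (phi ?r ?w - phi ?r ?v)"
    proof (intro mult_right_mono mult_mono divide_right_mono)
      have "?w / ?v = 1 + 1 / real k" using k m h by (simp add: field_simps)
      also have "\<dots> \<le> 1 + 1 / real m" using k m by (auto simp: frac_le)
      finally show "?w / ?v \<le> 1 + 1 / real m" .
      show "0 \<le> phi ?r ?w - phi ?r ?v" using phi_mono[of ?r ?v ?w] r v vw by simp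
    qed (use w r \<alpha> h k in auto)
    finally show ?thesis .
  qed
  show ?thesis
  proof (cases "m \<le> n")
    case True
    have "(\<Sum>k<n. run_prob \<alpha> lam1 h m k) = (\<Sum>k=m..<n. run_prob \<alpha> lam1 h m k)"
      by (rule sum.mono_neutral_right) (auto simp: run_prob_def)
    also have "\<dots> \<le> (\<Sum>k=m..<n. ?C * (phi ?r (real (Suc k) * h) - phi ?r (real k * h)))"
      by (intro sum_mono bound) auto
    also have "\<dots> = ?C * (phi ?r (real n * h) - phi ?r (real m * h))"
      unfolding sum_distrib_left[symmetric] using sum_Suc_diff'[OF True, of "\<lambda>k. phi ?r (real k * h)"] by simp
    also have "\<dots> \<le> ?C * phi ?r (real n * h)"
      using C0 phi_pos[of ?r "real m * h"] by (intro mult_left_mono) auto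
    finally show ?thesis by (simp add: mult.assoc)
  next
    case False
    then have "(\<Sum>k<n. run_prob \<alpha> lam1 h m k) = 0" by (intro sum.neutral) (auto simp: run_prob_def)
    also have "\<dots> \<le> ?C * phi ?r (real n * h)" using C0 phi_pos[of ?r "real n * h"] by simp
    finally show ?thesis by (simp add: mult.assoc)
  qed
qed

text \<open>
  The converse estimate uses the rate at the start of the run instead, which shifts the argument
  of \<open>phi\<close> by the length of the run; the slots before \<open>n0\<close> are dropped
  so that all slowly varying factors are comparable.
\<close>

lemma sum_run_prob_lower:
  assumes h: "0 < h" and m: "0 < m" and n0: "m + 2 \<le> n0" "n0 \<le> n"
  defines "w0 \<equiv> real (n0 - m - 1) * h"
  assumes small: "h * rt w0 \<le> 1"
  shows "rt (real n * h) / rt w0 * (1 - h * rt w0) * (w0 / (real m * h * (1 - \<alpha>)) * 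
      (phi (real m * h) (real (n - m - 1) * h) - phi (real m * h) w0)) \<le> (\<Sum>k<n. run_prob \<alpha> lam1 h m k)"
proof -
  let ?r = "real m * h" and ?f = "\<lambda>k. phi (real m * h) (real (k - m - 1) * h)"
  have r: "0 < ?r" using h m by simp
  have w0: "0 < w0" using n0 h unfolding w0_def by simp
  let ?C = "rt (real n * h) / rt w0 * (1 - h * rt w0) * (w0 / (?r * (1 - \<alpha>)))"
  have bound: "?C * (?f (Suc k) - ?f k) \<le> run_prob \<alpha> lam1 h m k" if k: "n0 \<le> k" "k < n" for k
  proof -
    let ?u = "real (k - m - 1) * h" and ?w = "real (k - m) * h"
    let ?v1 = "real (Suc k) * h" and ?v = "real k * h"
    have u: "w0 \<le> ?u" "0 < ?u" using k n0 h w0 unfolding w0_def by (auto intro!: mult_right_mono)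
    have "k - m = Suc (k - m - 1)" using k n0 by simp
    then have "real (k - m) = real (k - m - 1) + 1" by linarith
    then have uw: "?w = ?u + h" by (simp only: distrib_right mult_1)
    have w: "0 < ?w" using uw u(2) h by linarith
    have wv: "?w \<le> ?v" using h by (intro mult_right_mono) auto
    have v1: "?v1 \<le> real n * h" using k h by (intro mult_right_mono) auto
    have v1v: "?v1 = ?v + h" by (simp add: algebra_simps)
    have nh: "0 < real n * h" using k h by simp
    define y where "y = h * rt ?v1"
    have y0: "0 \<le> y" using h rate_pos[of ?v1] unfolding y_def by simp
    have y1: "h * rt (real n * h) \<le> y" unfolding y_def using v1 h by (intro mult_left_mono rate_antimono) auto
    have y2: "y \<le> h * rt w0" unfolding y_def using h w0 u uw w wv v1v by (intro mult_left_mono rate_antimono) linarith+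
    have ey: "y * (1 - y) \<le> 1 - exp (- y)"
    proof -
      have "exp (- y) \<le> 1 / (1 + y)"
        using exp_ge_add_one_self[of y] y0 by (simp add: exp_minus field_simps)
      also have "\<dots> \<le> 1 - y + y * y" using y0 by (simp add: field_simps)
      finally show ?thesis by (simp add: algebra_simps)
    qed
    have D: "y \<le> cm ?v1 - cm ?v" using cum_increment_lower[of ?v ?v1] v1v h unfolding y_def by simp
    have E: "phi ?r ?w \<le> exp (- (cm ?v - cm ?w))"
    proof -
      have "cm ?v - cm ?w \<le> (?v - ?w) * rt ?w" by (rule cum_increment_upper[OF w wv])
      also have "?v - ?w = ?r" using k n0 by (simp add: of_nat_diff algebra_simps)
      finally show ?thesis by (simp add: phi_def)
    qed
    have A: "h * rt (real n * h) * (1 - h * rt w0) \<le> 1 - exp (- (cm ?v1 - cm ?v))"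
    proof -
      have "h * rt (real n * h) * (1 - h * rt w0) \<le> y * (1 - y)"
        using y1 y2 y0 small h rate_pos[OF nh] by (intro mult_mono) auto
      also have "\<dots> \<le> 1 - exp (- y)" by (rule ey)
      also have "\<dots> \<le> 1 - exp (- (cm ?v1 - cm ?v))" using D by simp
      finally show ?thesis .
    qed
    have d: "phi ?r ?w - phi ?r ?u \<le> h * (?r * (1 - \<alpha>) * rt ?u / ?u * phi ?r ?w)"
    proof -
      have 1: "?u \<le> ?w" and 2: "?w - ?u = h" using uw h by linarith+
      show ?thesis using phi_increment(2)[OF u(2) 1 r] unfolding 2 .
    qed
    also have "\<dots> \<le> h * (?r * (1 - \<alpha>) * (rt w0 / w0) * phi ?r ?w)"
    proof -
      have "rt ?u / ?u \<le> rt w0 / w0" using rate_antimono[OF w0 u(1)] u w0 rate_pos[OF w0] by (intro frac_le) auto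
      then have "?r * (1 - \<alpha>) * (rt ?u / ?u) * phi ?r ?w \<le> ?r * (1 - \<alpha>) * (rt w0 / w0) * phi ?r ?w"
        using r \<alpha> phi_pos[of ?r ?w] by (intro mult_right_mono mult_left_mono) auto
      from mult_left_mono[OF this, of h] h show ?thesis
        by (simp only: times_divide_eq_right times_divide_eq_left less_imp_le)
    qed
    finally have d': "phi ?r ?w - phi ?r ?u \<le> h * (?r * (1 - \<alpha>) * (rt w0 / w0) * phi ?r ?w)" .
    have C0: "0 \<le> ?C" using small w0 r \<alpha> rate_pos[OF w0] rate_pos[OF nh] by simp
    have "?C * (phi ?r ?w - phi ?r ?u) \<le> ?C * (h * (?r * (1 - \<alpha>) * (rt w0 / w0) * phi ?r ?w))"
      using d' C0 by (rule mult_left_mono)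
    also have "\<dots> = h * rt (real n * h) * (1 - h * rt w0) * phi ?r ?w"
    proof -
      have gen: "RN / R0 * S * (W / Q) * (h * (Q * (R0 / W) * P)) = h * RN * S * P"
        if "0 < R0" "0 < W" "0 < Q" for RN R0 S W Q P :: real using that by (simp add: field_simps)
      show ?thesis using r \<alpha> w0 rate_pos[OF w0] by (intro gen) auto
    qed
    also have "\<dots> \<le> (1 - exp (- (cm ?v1 - cm ?v))) * exp (- (cm ?v - cm ?w))"
    proof (intro mult_mono A E)
      show "0 \<le> 1 - exp (- (cm ?v1 - cm ?v))" using D y0 by simp
    qed (simp add: phi_def)
    also have "\<dots> = run_prob \<alpha> lam1 h m k" using k n0 by (simp add: run_prob_def)
    finally show ?thesis using k n0 by (simp add: Suc_diff_le)
  qed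
  have "?C * (?f n - ?f n0) = (\<Sum>k=n0..<n. ?C * (?f (Suc k) - ?f k))"
    unfolding sum_distrib_left[symmetric] using sum_Suc_diff'[OF n0(2), of ?f] by simp
  also have "\<dots> \<le> (\<Sum>k=n0..<n. run_prob \<alpha> lam1 h m k)" by (intro sum_mono bound) auto
  also have "\<dots> \<le> (\<Sum>k<n. run_prob \<alpha> lam1 h m k)"
    using run_prob_nonneg[OF h] by (intro sum_mono2) auto
  finally show ?thesis unfolding w0_def by (simp add: mult.assoc)
qed

text \<open>
  Within a window the run probabilities are bounded by the largest value of \<open>phi\<close>
  times the mean number of epochs in the window, and the latter is at most that of the initial
  stretch of the same length, since the integrated rate is subadditive.
\<close>

lemma window_run_prob:
  assumes h: "0 < h" and m: "0 < m" and j: "j < n"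
  shows "(\<Sum>k\<in>{j-l..j}. run_prob \<alpha> lam1 h m k) \<le> cm (real (Suc l) * h) * phi (real m * h) (real n * h)"
proof -
  let ?P = "phi (real m * h) (real n * h)"
  have inc: "0 \<le> cm (real (Suc k) * h) - cm (real k * h)" for k
    using cumulative_rate_mono[of "real k * h" "real (Suc k) * h"] h by (auto simp: mult_right_mono)
  have "(\<Sum>k\<in>{j-l..j}. run_prob \<alpha> lam1 h m k) \<le> (\<Sum>k\<in>{j-l..j}. (cm (real (Suc k) * h) - cm (real k * h)) * ?P)"
  proof (intro sum_mono)
    fix k assume k: "k \<in> {j-l..j}"
    show "run_prob \<alpha> lam1 h m k \<le> (cm (real (Suc k) * h) - cm (real k * h)) * ?P"
    proof (cases "m \<le> k")
      case True
      have "phi (real m * h) (real k * h) \<le> ?P"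
        using h m True k j by (intro phi_mono mult_right_mono) auto
      with run_prob_le[OF h m True] inc[of k] show ?thesis
        by (meson mult_left_mono order_trans)
    next
      case False
      then show ?thesis using inc[of k] phi_pos[of "real m * h" "real n * h"] by (simp add: run_prob_def)
    qed
  qed
  also have "\<dots> = (cm (real (Suc j) * h) - cm (real (j - l) * h)) * ?P"
  proof -
    have "(\<Sum>k=j-l..<Suc j. cm (real (Suc k) * h) - cm (real k * h)) = cm (real (Suc j) * h) - cm (real (j - l) * h)"
      by (subst sum_Suc_diff') auto
    moreover have "{j-l..<Suc j} = {j-l..j}" by auto
    ultimately show ?thesis unfolding sum_distrib_right[symmetric] by simp
  qed
  also have "\<dots> \<le> cm (real (Suc l) * h) * ?P"
  proof (intro mult_right_mono)
    have "real (Suc j) * h = real (j - l) * h + real (Suc j - (j - l)) * h"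
      by (simp add: of_nat_diff algebra_simps)
    then have "cm (real (Suc j) * h) \<le> cm (real (j - l) * h) + cm (real (Suc j - (j - l)) * h)"
      using cum_subadditive[of "real (j - l) * h" "real (Suc j - (j - l)) * h"] h by simp
    also have "cm (real (Suc j - (j - l)) * h) \<le> cm (real (Suc l) * h)"
      using h by (intro cumulative_rate_mono mult_right_mono) auto
    finally show "cm (real (Suc j) * h) - cm (real (j - l) * h) \<le> cm (real (Suc l) * h)" by simp
  qed (simp add: phi_def)
  finally show ?thesis .
qed


lemma centering_over_ln: "((\<lambda>t. centering \<alpha> lam1 t / ln t) \<longlongrightarrow> \<alpha>) at_top"
proof -
  have A: "((\<lambda>t::real. \<alpha> - ln (ln t) / ln t - ln (\<alpha> * (1 - \<alpha>) / lam1) / ln t) \<longlongrightarrow> \<alpha> - 0 - 0) at_top"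
    by (intro tendsto_diff tendsto_const) real_asymp+
  have ev: "\<forall>\<^sub>F t::real in at_top. 1 < t" by (rule eventually_gt_at_top)
  then have B: "\<forall>\<^sub>F t in at_top. \<alpha> - ln (ln t) / ln t - ln (\<alpha> * (1 - \<alpha>) / lam1) / ln t = centering \<alpha> lam1 t / ln t"
    by eventually_elim (simp add: centering_def diff_divide_distrib)
  from Lim_transform_eventually[OF A B] show ?thesis by (simp add: mult.assoc)
qed

text \<open>
  This is what the centering is chosen for: \<open>t * rt t\<close> is \<open>\<alpha>\<close>
  times the mean number of epochs up to \<open>t\<close>.
\<close>

lemma exp_minus_centering:
  assumes "1 < t"
  shows "exp (- centering \<alpha> lam1 t) = \<alpha> * (1 - \<alpha>) * ln t / (t * rt t)"
proof -
  have "exp (- centering \<alpha> lam1 t) = exp (ln (ln t)) * exp (ln (\<alpha> * (1 - \<alpha>) / lam1)) * exp (- (\<alpha> * ln t))"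
    by (simp add: centering_def algebra_simps flip: exp_add)
  also have "\<dots> = ln t * (\<alpha> * (1 - \<alpha>) / lam1) * exp (- (\<alpha> * ln t))"
    using assms \<alpha> lam1 by simp
  also have "exp (- (\<alpha> * ln t)) = 1 / t powr \<alpha>"
    using assms by (simp add: powr_def exp_minus inverse_eq_divide)
  finally have *: "exp (- centering \<alpha> lam1 t) = ln t * (\<alpha> * (1 - \<alpha>) / lam1) * (1 / t powr \<alpha>)" .
  have e: "t * rt t = lam1 * t powr \<alpha>" using assms by (simp add: rate_def powr_mult_base mult.left_commute)
  show ?thesis unfolding * e by (simp add: mult_ac)
qed

lemma scaled_threshold_over_ln:
  fixes r :: "real \<Rightarrow> real"
  assumes X: "((\<lambda>t. rt t * r t - centering \<alpha> lam1 t) \<longlongrightarrow> x) at_top"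
  shows "((\<lambda>t. rt t * r t / ln t) \<longlongrightarrow> \<alpha>) at_top"
proof -
  have "((\<lambda>t. (rt t * r t - centering \<alpha> lam1 t) / ln t) \<longlongrightarrow> 0) at_top"
    by (rule tendsto_divide_0[OF X]) real_asymp
  from tendsto_add[OF this centering_over_ln] show ?thesis
    by (simp add: diff_divide_distrib)
qed

lemma epoch_ratio:
  fixes s :: "real \<Rightarrow> real"
  assumes Z: "((\<lambda>t. (t - s t) / t * ln t) \<longlongrightarrow> z) at_top"
  shows "((\<lambda>t. s t / t) \<longlongrightarrow> 1) at_top"
proof -
  have A: "((\<lambda>t. 1 - ((t - s t) / t * ln t) / ln t) \<longlongrightarrow> 1 - 0) at_top"
    by (intro tendsto_diff tendsto_const tendsto_divide_0[OF Z]) real_asymp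
  have ev: "\<forall>\<^sub>F t::real in at_top. 1 < t" by (rule eventually_gt_at_top)
  then have B: "\<forall>\<^sub>F t in at_top. 1 - ((t - s t) / t * ln t) / ln t = s t / t"
    by eventually_elim (simp add: field_simps)
  from Lim_transform_eventually[OF A B] show ?thesis by (simp add: mult.assoc)
qed

lemma eventually_epoch_pos:
  fixes s :: "real \<Rightarrow> real"
  assumes Z: "((\<lambda>t. (t - s t) / t * ln t) \<longlongrightarrow> z) at_top"
  shows "\<forall>\<^sub>F t in at_top. 0 < s t"
proof -
  have "\<forall>\<^sub>F t in at_top. 1/2 < s t / t" using epoch_ratio[OF Z] by (rule order_tendstoD) simp
  then show ?thesis using eventually_gt_at_top[of 0]
  proof eventually_elim
    case (elim t)
    then have "0 < s t / t" by linarith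
    with elim show ?case by (simp add: zero_less_divide_iff)
  qed
qed

lemma rate_ratio_eq:
  fixes s :: "real \<Rightarrow> real"
  assumes Z: "((\<lambda>t. (t - s t) / t * ln t) \<longlongrightarrow> z) at_top"
  shows "\<forall>\<^sub>F t in at_top. rt (s t) / rt t = (s t / t) powr (\<alpha> - 1)"
  using eventually_epoch_pos[OF Z] eventually_gt_at_top[of 0]
  by eventually_elim (use lam1 in \<open>simp add: rate_def powr_divide\<close>)

lemma rate_ratio:
  fixes s :: "real \<Rightarrow> real"
  assumes Z: "((\<lambda>t. (t - s t) / t * ln t) \<longlongrightarrow> z) at_top"
  shows "((\<lambda>t. rt (s t) / rt t) \<longlongrightarrow> 1) at_top"
proof -
  have "((\<lambda>t. (s t / t) powr (\<alpha> - 1)) \<longlongrightarrow> 1 powr (\<alpha> - 1)) at_top"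
    by (intro tendsto_powr epoch_ratio[OF Z] tendsto_const) simp
  then show ?thesis by (simp add: tendsto_cong[OF rate_ratio_eq[OF Z]])
qed

text \<open>
  The factor \<open>\<alpha> * (1 - \<alpha>)\<close> of the limiting intensity arises here:
  going back from \<open>t\<close> by a fraction \<open>z / ln t\<close> raises the rate by the
  factor \<open>1 + (1 - \<alpha>) * z / ln t\<close>, and the threshold times the rate is about
  \<open>\<alpha> * ln t\<close>.
\<close>

lemma exponent_limit:
  fixes r s :: "real \<Rightarrow> real"
  assumes X: "((\<lambda>t. rt t * r t - centering \<alpha> lam1 t) \<longlongrightarrow> x) at_top"
    and Z: "((\<lambda>t. (t - s t) / t * ln t) \<longlongrightarrow> z) at_top"
  shows "((\<lambda>t. r t * rt (s t) - centering \<alpha> lam1 t) \<longlongrightarrow> x + \<alpha> * (1 - \<alpha>) * z) at_top"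
proof -
  let ?Z = "\<lambda>t. (t - s t) / t * ln t"
  have "((\<lambda>y. (1 - y) powr (\<alpha> - 1)) has_real_derivative (1 - \<alpha>)) (at 0)"
  proof -
    have "((\<lambda>y. (1 - y) powr (\<alpha> - 1)) has_real_derivative (\<alpha> - 1) * (1 - 0) powr (\<alpha> - 1 - 1) * (0 - 1)) (at 0)"
      by (rule DERIV_chain2[of "\<lambda>y. y powr (\<alpha> - 1)"]) (auto intro!: derivative_eq_intros)
    then show ?thesis by simp
  qed
  then obtain g where g: "\<And>y. (1 - y) powr (\<alpha> - 1) - 1 = g y * y" "isCont g 0" "g 0 = 1 - \<alpha>"
    unfolding CARAT_DERIV by auto
  have Y: "((\<lambda>t. ?Z t / ln t) \<longlongrightarrow> 0) at_top"
    by (rule tendsto_divide_0[OF Z]) real_asymp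
  have "((\<lambda>t. g (?Z t / ln t)) \<longlongrightarrow> 1 - \<alpha>) at_top"
    using isCont_tendsto_compose[OF g(2) Y] g(3) by simp
  then have A: "((\<lambda>t. (rt t * r t - centering \<alpha> lam1 t) + rt t * r t / ln t * (g (?Z t / ln t) * ?Z t)) \<longlongrightarrow> x + \<alpha> * ((1 - \<alpha>) * z)) at_top"
    by (intro tendsto_add X tendsto_mult scaled_threshold_over_ln[OF X] Z)
  have B: "\<forall>\<^sub>F t in at_top. (rt t * r t - centering \<alpha> lam1 t) + rt t * r t / ln t * (g (?Z t / ln t) * ?Z t) = 
      r t * rt (s t) - centering \<alpha> lam1 t"
    using rate_ratio_eq[OF Z] eventually_gt_at_top[of 1]
  proof eventually_elim
    case (elim t)
    have l: "0 < ln t" using elim by simp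
    have "s t / t = 1 - ?Z t / ln t" using elim l by (simp add: field_simps)
    then have "rt (s t) / rt t - 1 = g (?Z t / ln t) * (?Z t / ln t)" using elim g(1)[of "?Z t / ln t"] by simp
    then have "rt t * r t * (rt (s t) / rt t - 1) = rt t * r t / ln t * (g (?Z t / ln t) * ?Z t)" by simp
    moreover have "rt t * r t * (rt (s t) / rt t - 1) = r t * rt (s t) - rt t * r t"
      using rate_pos[of t] elim by (simp add: field_simps)
    ultimately show ?case by simp
  qed
  from Lim_transform_eventually[OF A B] show ?thesis by (simp add: mult.assoc)
qed

lemma phi_centered_limit:
  fixes r s :: "real \<Rightarrow> real"
  assumes X: "((\<lambda>t. rt t * r t - centering \<alpha> lam1 t) \<longlongrightarrow> x) at_top"
    and Z: "((\<lambda>t. (t - s t) / t * ln t) \<longlongrightarrow> z) at_top"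
  shows "((\<lambda>t. phi (r t) (s t) / exp (- centering \<alpha> lam1 t)) \<longlongrightarrow> exp (- (x + \<alpha> * (1 - \<alpha>) * z))) at_top"
proof -
  have "((\<lambda>t. exp (- (r t * rt (s t) - centering \<alpha> lam1 t))) \<longlongrightarrow> exp (- (x + \<alpha> * (1 - \<alpha>) * z))) at_top"
    by (intro tendsto_exp tendsto_minus exponent_limit[OF X Z])
  then show ?thesis by (simp add: phi_def exp_diff exp_minus field_simps)
qed

lemma eventually_threshold_pos:
  fixes r :: "real \<Rightarrow> real"
  assumes X: "((\<lambda>t. rt t * r t - centering \<alpha> lam1 t) \<longlongrightarrow> x) at_top"
  shows "\<forall>\<^sub>F t in at_top. 0 < r t"
proof -
  have "\<forall>\<^sub>F t in at_top. 0 < rt t * r t / ln t"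
    using scaled_threshold_over_ln[OF X] \<alpha>(1) by (rule order_tendstoD)
  then show ?thesis using eventually_gt_at_top[of 1]
  proof eventually_elim
    case (elim t)
    then have "0 < rt t * r t" by (simp add: zero_less_divide_iff)
    with rate_pos[of t] elim show ?case by (simp add: zero_less_mult_iff)
  qed
qed

lemma prefactor_limit:
  fixes r s :: "real \<Rightarrow> real"
  assumes X: "((\<lambda>t. rt t * r t - centering \<alpha> lam1 t) \<longlongrightarrow> x) at_top"
    and Z: "((\<lambda>t. (t - s t) / t * ln t) \<longlongrightarrow> z) at_top"
  shows "((\<lambda>t. s t / (r t * (1 - \<alpha>)) * exp (- centering \<alpha> lam1 t)) \<longlongrightarrow> 1) at_top"
proof -
  have A: "((\<lambda>t. s t / t * (\<alpha> / (rt t * r t / ln t))) \<longlongrightarrow> 1 * (\<alpha> / \<alpha>)) at_top"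
    using \<alpha> by (intro tendsto_mult tendsto_divide tendsto_const epoch_ratio[OF Z] scaled_threshold_over_ln[OF X]) auto
  have B: "\<forall>\<^sub>F t in at_top. s t / t * (\<alpha> / (rt t * r t / ln t)) = s t / (r t * (1 - \<alpha>)) * exp (- centering \<alpha> lam1 t)"
    using eventually_threshold_pos[OF X] eventually_gt_at_top[of 1]
    by eventually_elim (use \<alpha> in \<open>simp add: exp_minus_centering divide_simps\<close>)
  from Lim_transform_eventually[OF A B] show ?thesis using \<alpha> by simp
qed

lemma mean_limit:
  fixes r s :: "real \<Rightarrow> real"
  assumes X: "((\<lambda>t. rt t * r t - centering \<alpha> lam1 t) \<longlongrightarrow> x) at_top"
    and Z: "((\<lambda>t. (t - s t) / t * ln t) \<longlongrightarrow> z) at_top"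
  shows "((\<lambda>t. s t / (r t * (1 - \<alpha>)) * phi (r t) (s t)) \<longlongrightarrow> exp (- (x + \<alpha> * (1 - \<alpha>) * z))) at_top"
  using tendsto_mult[OF prefactor_limit[OF X Z] phi_centered_limit[OF X Z]] by simp

text \<open>
  On the time scale \<open>t / ln t\<close> of the second coordinate a long gap has no
  extension.
\<close>

lemma threshold_negligible:
  fixes r :: "real \<Rightarrow> real"
  assumes X: "((\<lambda>t. rt t * r t - centering \<alpha> lam1 t) \<longlongrightarrow> x) at_top"
  shows "((\<lambda>t. r t * ln t / t) \<longlongrightarrow> 0) at_top"
proof -
  have "((\<lambda>t. (ln t)\<^sup>2 / (lam1 * t powr \<alpha>)) \<longlongrightarrow> 0) at_top"
    using \<alpha> lam1 by real_asymp
  from tendsto_mult[OF scaled_threshold_over_ln[OF X] this]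
  have A: "((\<lambda>t. rt t * r t / ln t * ((ln t)\<^sup>2 / (lam1 * t powr \<alpha>))) \<longlongrightarrow> 0) at_top" by simp
  have B: "\<forall>\<^sub>F t in at_top. rt t * r t / ln t * ((ln t)\<^sup>2 / (lam1 * t powr \<alpha>)) = r t * ln t / t"
    using eventually_gt_at_top[of 1]
  proof eventually_elim
    case (elim t)
    have "t * rt t = lam1 * t powr \<alpha>" using elim by (simp add: rate_def powr_mult_base mult.left_commute)
    then show ?case using elim rate_pos[of t] unfolding \<open>t * rt t = _\<close>[symmetric]
      by (simp add: divide_simps power2_eq_square)
  qed
  from Lim_transform_eventually[OF A B] show ?thesis by (simp add: mult.assoc)
qed

text \<open>
  The mean number of long gaps in a window of the length of a long gap vanishes: it has order
  \<open>t powr (- \<alpha>\<^sup>2)\<close> up to powers of the logarithm.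
\<close>

lemma cum_threshold_limit:
  assumes X: "((\<lambda>t. rt t * r t - centering \<alpha> lam1 t) \<longlongrightarrow> x) at_top"
    and X': "((\<lambda>t. rt t * r' t - centering \<alpha> lam1 t) \<longlongrightarrow> x') at_top"
    and Z: "((\<lambda>t. (t - s t) / t * ln t) \<longlongrightarrow> z) at_top"
  shows "((\<lambda>t. cm (r t) * phi (r' t) (s t)) \<longlongrightarrow> 0) at_top"
proof -
  have small: "((\<lambda>t. (ln t / (lam1 * t powr (\<alpha> - 1))) powr \<alpha> * (\<alpha> * (1 - \<alpha>) * ln t / (lam1 * t powr \<alpha>))) \<longlongrightarrow> 0) at_top"
    using \<alpha> lam1 by real_asymp
  have "((\<lambda>t. (rt t * r t / ln t) powr \<alpha>) \<longlongrightarrow> \<alpha> powr \<alpha>) at_top"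
    using \<alpha> by (intro tendsto_powr scaled_threshold_over_ln[OF X] tendsto_const) auto
  from tendsto_mult[OF tendsto_mult[OF this small] phi_centered_limit[OF X' Z]]
  have A: "((\<lambda>t. lam1 / \<alpha> * ((rt t * r t / ln t) powr \<alpha> * ((ln t / (lam1 * t powr (\<alpha> - 1))) powr \<alpha> * 
      (\<alpha> * (1 - \<alpha>) * ln t / (lam1 * t powr \<alpha>))) * (phi (r' t) (s t) / exp (- centering \<alpha> lam1 t)))) \<longlongrightarrow> lam1 / \<alpha> * 0) at_top"
    by (intro tendsto_mult_left) simp
  have B: "\<forall>\<^sub>F t in at_top. lam1 / \<alpha> * ((rt t * r t / ln t) powr \<alpha> * ((ln t / (lam1 * t powr (\<alpha> - 1))) powr \<alpha> * 
      (\<alpha> * (1 - \<alpha>) * ln t / (lam1 * t powr \<alpha>))) * (phi (r' t) (s t) / exp (- centering \<alpha> lam1 t))) = cm (r t) * phi (r' t) (s t)"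
    using eventually_gt_at_top[of 1] eventually_threshold_pos[OF X]
  proof eventually_elim
    case (elim t)
    have l: "0 < ln t" using elim by simp
    have R: "0 < rt t" using rate_pos elim by simp
    have "t * rt t = lam1 * t powr \<alpha>" using elim by (simp add: rate_def powr_mult_base mult.left_commute)
    then have e: "\<alpha> * (1 - \<alpha>) * ln t / (lam1 * t powr \<alpha>) = exp (- centering \<alpha> lam1 t)"
      using exp_minus_centering[OF elim(1)] by simp
    have "(rt t * r t / ln t) powr \<alpha> * (ln t / (lam1 * t powr (\<alpha> - 1))) powr \<alpha> = 
        ((rt t * r t / ln t) * (ln t / rt t)) powr \<alpha>"
      unfolding rate_def[symmetric] by (rule powr_mult[symmetric])
    also have "(rt t * r t / ln t) * (ln t / rt t) = r t" using l R by simp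
    finally have p: "(rt t * r t / ln t) powr \<alpha> * (ln t / (lam1 * t powr (\<alpha> - 1))) powr \<alpha> = r t powr \<alpha>" .
    have "lam1 / \<alpha> * ((rt t * r t / ln t) powr \<alpha> * ((ln t / (lam1 * t powr (\<alpha> - 1))) powr \<alpha> * E) * (P / E)) =
        lam1 / \<alpha> * ((rt t * r t / ln t) powr \<alpha> * (ln t / (lam1 * t powr (\<alpha> - 1))) powr \<alpha>) * P" if "E \<noteq> 0" for E P :: real
      using that by simp
    then show ?case unfolding e p cumulative_rate_def by (simp only: exp_not_eq_zero not_False_eq_True)
  qed
  show ?thesis using Lim_transform_eventually[OF A B] by simp
qed

context
  fixes h :: "real \<Rightarrow> real" and m n :: "real \<Rightarrow> nat" and x z :: real
  assumes h: "\<And>t. 0 < h t"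
    and hr: "((\<lambda>t. rt t * h t) \<longlongrightarrow> 0) at_top"
    and hz: "((\<lambda>t. h t * ln t / t) \<longlongrightarrow> 0) at_top"
    and X: "((\<lambda>t. rt t * (real (m t) * h t) - centering \<alpha> lam1 t) \<longlongrightarrow> x) at_top"
    and Z: "((\<lambda>t. (t - real (n t) * h t) / t * ln t) \<longlongrightarrow> z) at_top"
begin

lemma eventually_run_pos: "\<forall>\<^sub>F t in at_top. 0 < m t"
  using eventually_threshold_pos[OF X] by eventually_elim (use h in \<open>auto simp: zero_less_mult_iff\<close>)

lemma inverse_run_limit: "((\<lambda>t. 1 / real (m t)) \<longlongrightarrow> 0) at_top"
proof -
  have "((\<lambda>t. rt t * h t * (1 / ln t) / (rt t * (real (m t) * h t) / ln t)) \<longlongrightarrow> 0 * 0 / \<alpha>) at_top"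
    using \<alpha> by (intro tendsto_divide tendsto_mult hr scaled_threshold_over_ln[OF X]) (real_asymp | simp)+
  then have A: "((\<lambda>t. rt t * h t * (1 / ln t) / (rt t * (real (m t) * h t) / ln t)) \<longlongrightarrow> 0) at_top" by simp
  have B: "\<forall>\<^sub>F t in at_top. rt t * h t * (1 / ln t) / (rt t * (real (m t) * h t) / ln t) = 1 / real (m t)"
    using eventually_gt_at_top[of 1]
  proof eventually_elim
    case (elim t)
    have "rt t \<noteq> 0" "ln t \<noteq> 0" "h t \<noteq> 0" using elim h[of t] rate_pos[of t] by auto
    then show ?case by simp
  qed
  show ?thesis by (rule Lim_transform_eventually[OF A B])
qed

lemma shifted_limit:
  fixes a :: "real \<Rightarrow> real"
  assumes a: "((\<lambda>t. (t - a t) / t * ln t) \<longlongrightarrow> y) at_top"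
  shows "((\<lambda>t. (t - (a t - (real (m t) + 1) * h t)) / t * ln t) \<longlongrightarrow> y) at_top"
proof -
  have "((\<lambda>t. (t - a t) / t * ln t + real (m t) * h t * ln t / t + h t * ln t / t) \<longlongrightarrow> y + 0 + 0) at_top"
    by (intro tendsto_add a threshold_negligible[OF X] hz)
  moreover have "(t - (a t - (real (m t) + 1) * h t)) / t * ln t =
      (t - a t) / t * ln t + real (m t) * h t * ln t / t + h t * ln t / t" for t
    by (cases "t = 0") (auto simp: field_simps)
  ultimately show ?thesis by (simp only: add_0_right)
qed

text \<open>
  The upper bound converges to the claimed limit at once. The lower bound starts at a time given
  by some \<open>y > z\<close> and loses \<open>exp (- (x + \<alpha> * (1 - \<alpha>) *
  y))\<close>, which is small for large \<open>y\<close>.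
\<close>

lemma sum_run_prob_limit:
  "((\<lambda>t. \<Sum>k<n t. run_prob \<alpha> lam1 (h t) (m t) k) \<longlongrightarrow> exp (- (x + \<alpha> * (1 - \<alpha>) * z))) at_top"
proof (rule tendstoI)
  fix e :: real assume e: "0 < e"
  let ?S = "\<lambda>t. \<Sum>k<n t. run_prob \<alpha> lam1 (h t) (m t) k"
  let ?r = "\<lambda>t. real (m t) * h t" and ?s = "\<lambda>t. real (n t) * h t"
  let ?l = "exp (- (x + \<alpha> * (1 - \<alpha>) * z))"
  have "((\<lambda>t. (1 + 1 / real (m t)) * (?s t / (?r t * (1 - \<alpha>)) * phi (?r t) (?s t))) \<longlongrightarrow> (1 + 0) * ?l) at_top"
    by (intro tendsto_mult[OF _ mean_limit[OF X Z]] tendsto_add tendsto_const inverse_run_limit)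
  then have "\<forall>\<^sub>F t in at_top. (1 + 1 / real (m t)) * (?s t / (?r t * (1 - \<alpha>)) * phi (?r t) (?s t)) < ?l + e"
    using e by (intro order_tendstoD(2)) auto
  then have upper: "\<forall>\<^sub>F t in at_top. ?S t < ?l + e"
    using eventually_run_pos
    by eventually_elim (use sum_run_prob_upper[OF h] in \<open>auto intro: le_less_trans\<close>)
  have "((\<lambda>y. exp (- (x + \<alpha> * (1 - \<alpha>) * y))) \<longlongrightarrow> 0) at_top"
    using \<alpha> by real_asymp
  then have "\<forall>\<^sub>F y in at_top. exp (- (x + \<alpha> * (1 - \<alpha>) * y)) < e / 2"
    using e by (intro order_tendstoD(2)) auto
  from eventually_conj[OF this eventually_gt_at_top[of z]]
  obtain y where y: "exp (- (x + \<alpha> * (1 - \<alpha>) * y)) < e / 2" "z < y"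
    by (auto simp: eventually_at_top_linorder)
  \<comment> \<open>the first slot kept in the lower bound, at the time that corresponds to \<open>y\<close>\<close>
  define n0 where "n0 t = nat \<lfloor>t * (1 - y / ln t) / h t\<rfloor>" for t
  have Z0: "((\<lambda>t. (t - real (n0 t) * h t) / t * ln t) \<longlongrightarrow> y) at_top"
  proof (rule tendsto_sandwich)
    have pos: "\<forall>\<^sub>F t in at_top. 0 \<le> t * (1 - y / ln t)" by real_asymp
    have b: "\<forall>\<^sub>F t in at_top. real (n0 t) * h t \<le> t * (1 - y / ln t) \<and> t * (1 - y / ln t) \<le> real (n0 t) * h t + h t"
      using pos
    proof eventually_elim
      case (elim t)
      have "0 \<le> t * (1 - y / ln t) / h t" using elim h[of t] by simp
      then have "real (n0 t) \<le> t * (1 - y / ln t) / h t" "t * (1 - y / ln t) / h t \<le> real (n0 t) + 1"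
        unfolding n0_def by linarith+
      then show ?case using h[of t] by (simp add: field_simps)
    qed
    show "\<forall>\<^sub>F t in at_top. y \<le> (t - real (n0 t) * h t) / t * ln t"
      using b eventually_gt_at_top[of 1]
    proof eventually_elim
      case (elim t)
      have l: "0 < ln t" using elim by simp
      have "y = (t - t * (1 - y / ln t)) / t * ln t" using l elim by (simp add: field_simps)
      also have "\<dots> \<le> (t - real (n0 t) * h t) / t * ln t"
        using elim l by (intro mult_right_mono divide_right_mono) auto
      finally show ?case .
    qed
    show "\<forall>\<^sub>F t in at_top. (t - real (n0 t) * h t) / t * ln t \<le> y + h t * ln t / t"
      using b eventually_gt_at_top[of 1]
    proof eventually_elim
      case (elim t)
      have l: "0 < ln t" using elim by simp
      have "(t - real (n0 t) * h t) / t * ln t \<le> (t - (t * (1 - y / ln t) - h t)) / t * ln t"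
        using elim l by (intro mult_right_mono divide_right_mono) auto
      also have "\<dots> = y + h t * ln t / t" using l elim by (simp add: field_simps)
      finally show ?case .
    qed
    show "((\<lambda>t. y + h t * ln t / t) \<longlongrightarrow> y) at_top"
      using tendsto_add[OF tendsto_const hz, of y] by simp
  qed simp
  let ?w = "\<lambda>t. real (n0 t) * h t - (real (m t) + 1) * h t"
  let ?u = "\<lambda>t. real (n t) * h t - (real (m t) + 1) * h t"
  note ZW = shifted_limit[OF Z0] and ZU = shifted_limit[OF Z]
  have "((\<lambda>t. ?w t / (?r t * (1 - \<alpha>)) * exp (- centering \<alpha> lam1 t) *
      (phi (?r t) (?u t) / exp (- centering \<alpha> lam1 t) - phi (?r t) (?w t) / exp (- centering \<alpha> lam1 t)))
      \<longlongrightarrow> 1 * (?l - exp (- (x + \<alpha> * (1 - \<alpha>) * y)))) at_top"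
    by (rule tendsto_mult[OF prefactor_limit[OF X ZW] tendsto_diff[OF phi_centered_limit[OF X ZU] phi_centered_limit[OF X ZW]]])
  moreover have "A * exp c * (P / exp c - Q / exp c) = A * (P - Q)" for A P Q c :: real
    by (simp flip: diff_divide_distrib)
  ultimately have L1: "((\<lambda>t. ?w t / (?r t * (1 - \<alpha>)) * (phi (?r t) (?u t) - phi (?r t) (?w t)))
      \<longlongrightarrow> ?l - exp (- (x + \<alpha> * (1 - \<alpha>) * y))) at_top"
    by (simp only: mult_1)
  have "((\<lambda>t. rt t * h t * (rt (?w t) / rt t)) \<longlongrightarrow> 0 * 1) at_top"
    by (intro tendsto_mult[OF hr] rate_ratio[OF ZW])
  moreover have "\<forall>\<^sub>F t in at_top. rt t * h t * (rt (?w t) / rt t) = h t * rt (?w t)"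
    using eventually_gt_at_top[of 0] by eventually_elim (use rate_pos in \<open>auto simp: less_le\<close>)
  ultimately have L2: "((\<lambda>t. h t * rt (?w t)) \<longlongrightarrow> 0) at_top"
    using Lim_transform_eventually by fastforce
  have "((\<lambda>t. (rt (?s t) / rt t) / (rt (?w t) / rt t)) \<longlongrightarrow> 1 / 1) at_top"
    by (intro tendsto_divide rate_ratio[OF Z] rate_ratio[OF ZW]) simp
  moreover have "\<forall>\<^sub>F t in at_top. (rt (?s t) / rt t) / (rt (?w t) / rt t) = rt (?s t) / rt (?w t)"
    using eventually_gt_at_top[of 0] by eventually_elim (use rate_pos in \<open>auto simp: less_le\<close>)
  ultimately have L3: "((\<lambda>t. rt (?s t) / rt (?w t)) \<longlongrightarrow> 1) at_top"
    using Lim_transform_eventually by fastforce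
  have "((\<lambda>t. rt (?s t) / rt (?w t) * (1 - h t * rt (?w t)) * (?w t / (?r t * (1 - \<alpha>)) * (phi (?r t) (?u t) - phi (?r t) (?w t))))
      \<longlongrightarrow> 1 * (1 - 0) * (?l - exp (- (x + \<alpha> * (1 - \<alpha>) * y)))) at_top"
    by (intro tendsto_mult[OF tendsto_mult[OF L3] L1] tendsto_diff tendsto_const L2)
  then have lower1: "\<forall>\<^sub>F t in at_top. ?l - e < rt (?s t) / rt (?w t) * (1 - h t * rt (?w t)) * (?w t / (?r t * (1 - \<alpha>)) * (phi (?r t) (?u t) - phi (?r t) (?w t)))"
    using e y(1) by (intro order_tendstoD(1)) auto
  have "\<forall>\<^sub>F t in at_top. (t - real (n t) * h t) / t * ln t < (z + y) / 2" using Z y(2) by (intro order_tendstoD(2)) auto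
  moreover have "\<forall>\<^sub>F t in at_top. (z + y) / 2 < (t - real (n0 t) * h t) / t * ln t" using Z0 y(2) by (intro order_tendstoD(1)) auto
  ultimately have n0n: "\<forall>\<^sub>F t in at_top. n0 t \<le> n t"
    using eventually_gt_at_top[of 1]
  proof eventually_elim
    case (elim t)
    have l: "0 < ln t" using elim by simp
    have "(t - real (n t) * h t) / t * ln t < (t - real (n0 t) * h t) / t * ln t" using elim by linarith
    then have "(t - real (n t) * h t) / t < (t - real (n0 t) * h t) / t" using l by (simp only: mult_less_cancel_right_pos)
    then have "t - real (n t) * h t < t - real (n0 t) * h t" using elim(3) by (simp add: divide_less_cancel)
    then have "real (n0 t) * h t < real (n t) * h t" by simp
    then show ?case using h[of t] by simp
  qed
  have small: "\<forall>\<^sub>F t in at_top. h t * rt (?w t) < 1" using L2 by (intro order_tendstoD(2)) auto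
  have lower: "\<forall>\<^sub>F t in at_top. ?l - e < ?S t"
    using lower1 n0n small eventually_run_pos eventually_epoch_pos[OF ZW]
  proof eventually_elim
    case (elim t)
    have "0 < (real (n0 t) - (real (m t) + 1)) * h t" using elim(5) by (simp only: left_diff_distrib)
    then have "real (n0 t) - (real (m t) + 1) > 0" using h[of t] by (simp only: zero_less_mult_pos2)
    then have n0: "m t + 2 \<le> n0 t" by linarith
    have w: "real (n0 t - m t - 1) * h t = ?w t" using n0 by (simp add: of_nat_diff algebra_simps)
    have u: "real (n t - m t - 1) * h t = ?u t" using n0 elim(2) by (simp add: of_nat_diff algebra_simps)
    show ?case
      using sum_run_prob_lower[OF h[of t] elim(4) n0 elim(2), unfolded w u] elim(1,3) by linarith
  qed
  from upper lower show "\<forall>\<^sub>F t in at_top. dist (?S t) ?l < e"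
    by eventually_elim (simp add: dist_real_def abs_less_iff)
qed

end

end

section \<open>Grid cells of the plane and the limiting Poisson process\<close>

text \<open>
  The half-open interval \<open>(i d, (i + 1) d]\<close> has level \<open>i\<close>, and
  \<open>0\<close> has level \<open>0\<close>: the lines at infinity belong to the cells along
  the axes.
\<close>

definition level :: "real \<Rightarrow> real \<Rightarrow> nat" where
  "level d u = nat (\<lceil>u / d\<rceil> - 1)"

lemma level_less_iff:
  assumes "0 < d" "0 \<le> u"
  shows "level d u < i \<longleftrightarrow> 0 < i \<and> u \<le> real i * d"
proof -
  have "0 \<le> u / d" using assms by simp
  then have "level d u < i \<longleftrightarrow> 0 < i \<and> u / d \<le> real i" unfolding level_def by linarith
  then show ?thesis using assms by (simp add: divide_le_eq)
qed

lemma level_close: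
  assumes "0 < d" "0 \<le> u" "0 \<le> v" "level d u = level d v"
  shows "\<bar>u - v\<bar> \<le> d"
proof -
  define i where "i = level d u"
  have "u \<le> real (Suc i) * d" "v \<le> real (Suc i) * d"
    using level_less_iff[OF assms(1,2), of "Suc i"] level_less_iff[OF assms(1,3), of "Suc i"] assms(4) by (auto simp: i_def)
  moreover have "real i * d \<le> u" "real i * d \<le> v"
    using level_less_iff[OF assms(1,2), of i] level_less_iff[OF assms(1,3), of i] assms by (cases "i = 0"; simp add: i_def; fail)+
  ultimately show ?thesis by (simp add: algebra_simps abs_le_iff)
qed

definition cell :: "real \<Rightarrow> nat \<times> nat \<Rightarrow> (ereal \<times> ereal) set" where
  "cell d c = {p \<in> plane. level d (neg_exp (fst p)) = fst c \<and> level d (neg_exp (snd p)) = snd c}"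

definition quadrant2 :: "real \<Rightarrow> real \<Rightarrow> (ereal \<times> ereal) set" where
  "quadrant2 a b = {p \<in> plane. neg_exp (fst p) \<le> a \<and> neg_exp (snd p) \<le> b}"

lemma quadrant_eq: "quadrant r = quadrant2 r r" by (auto simp: quadrant_def quadrant2_def)

lemma quadrant2_sets: "quadrant2 a b \<in> sets (restrict_space borel plane)"
proof -
  have 1: "(\<lambda>p. neg_exp (fst p)) \<in> borel_measurable (restrict_space borel plane)"
       "(\<lambda>p. neg_exp (snd p)) \<in> borel_measurable (restrict_space borel plane)"
    by (intro borel_measurable_continuous_on_restrict continuous_on_neg_exp_plane)+
  have "quadrant2 a b = {p \<in> space (restrict_space borel plane). neg_exp (fst p) \<le> a \<and> neg_exp (snd p) \<le> b}"
    by (auto simp: quadrant2_def space_restrict_space)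
  also have "\<dots> \<in> sets (restrict_space borel plane)" using 1 by measurable
  finally show ?thesis .
qed

text \<open>
  Cells are obtained from boxes at the origin by inclusion and exclusion, as are their masses.
\<close>

lemma cell_eq:
  assumes "0 < d"
  shows "cell d (i, j) = {p \<in> plane. level d (neg_exp (fst p)) < Suc i \<and> level d (neg_exp (snd p)) < Suc j}
     - ({p \<in> plane. level d (neg_exp (fst p)) < i \<and> level d (neg_exp (snd p)) < Suc j} \<union>
        {p \<in> plane. level d (neg_exp (fst p)) < Suc i \<and> level d (neg_exp (snd p)) < j})"
  by (auto simp: cell_def)

lemma lower_set_eq:
  assumes "0 < d"
  shows "{p \<in> plane. level d (neg_exp (fst p)) < i \<and> level d (neg_exp (snd p)) < j} =
     (if 0 < i \<and> 0 < j then quadrant2 (real i * d) (real j * d) else {})"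
  using assms by (auto simp: level_less_iff quadrant2_def)

lemma lower_set_sets:
  assumes "0 < d"
  shows "{p \<in> plane. level d (neg_exp (fst p)) < i \<and> level d (neg_exp (snd p)) < j} \<in> sets (restrict_space borel plane)"
  unfolding lower_set_eq[OF assms] by (auto simp: quadrant2_sets)

lemma cell_sets: "0 < d \<Longrightarrow> cell d c \<in> sets (restrict_space borel plane)"
  using cell_eq[of d "fst c" "snd c"] lower_set_sets[of d] by (auto intro!: sets.Diff sets.Un)

lemma disjoint_cells: "disjoint_family_on (cell d) U"
  by (auto simp: disjoint_family_on_def cell_def prod_eq_iff)

lemma Union_cells:
  assumes "0 < d" "0 < D"
  shows "(\<Union>c\<in>{..<D}\<times>{..<D}. cell d c) = quadrant (real D * d)"
  using assms by (auto simp: cell_def quadrant_def level_less_iff)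

lemma nn_integral_exp_tail:
  assumes "0 < c"
  shows "(\<integral>\<^sup>+x. ennreal (c * exp (- (c * x))) * indicator {a..} x \<partial>lborel) = ennreal (exp (- (c * a)))"
proof -
  have "(\<integral>\<^sup>+x. ennreal (c * exp (- (c * x))) * indicator {a..} x \<partial>lborel) = ennreal (0 - (- exp (- (c * a))))"
  proof (rule nn_integral_FTC_atLeast)
    show "((\<lambda>x. - exp (- (c * x))) has_real_derivative c * exp (- (c * x))) (at x)" for x
      by (auto intro!: derivative_eq_intros)
    have "((\<lambda>x. exp (- (c * x))) \<longlongrightarrow> 0) at_top"
      using assms by real_asymp
    from tendsto_minus[OF this] show "((\<lambda>x. - exp (- (c * x))) \<longlongrightarrow> 0) at_top" by simp
  qed (use assms in auto)
  then show ?thesis by simp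
qed

text \<open>
  Integrating the exponential density over \<open>[- ln a, \<infinity>) \<times> [- ln b,
  \<infinity>)\<close> gives a product of two tails.
\<close>

lemma emeasure_limit_intensity:
  assumes \<alpha>: "0 < \<alpha>" "\<alpha> < 1" and ab: "0 < a" "0 < b"
  shows "emeasure (limit_intensity \<alpha>) (quadrant2 a b) = ennreal (a * b powr (\<alpha> * (1 - \<alpha>)))"
proof -
  let ?b = "\<alpha> * (1 - \<alpha>)"
  have b: "0 < ?b" using \<alpha> by simp
  let ?f = "\<lambda>(x :: real, z :: real). ennreal (exp (- x) * (?b * exp (- (?b * z))))"
  let ?g = "\<lambda>(x, z). (ereal x, ereal z)"
  have gm: "?g \<in> measurable lborel (restrict_space borel plane)"
    by (rule measurable_restrict_space2) (auto simp: plane_def intro!: borel_measurable_continuous_onI continuous_intros simp: split_beta)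
  have fm: "?f \<in> borel_measurable borel"
    unfolding split_beta
    by (intro measurable_compose[OF _ measurable_ennreal] borel_measurable_continuous_onI continuous_intros)
  have le: "exp (- x) \<le> c \<longleftrightarrow> - ln c \<le> x" if "0 < c" for x c :: real
    using that by (metis exp_le_cancel_iff exp_ln minus_le_iff)
  have pre: "?g -` quadrant2 a b = {- ln a..} \<times> {- ln b..}"
    using ab by (auto simp: quadrant2_def plane_def le)
  have "emeasure (limit_intensity \<alpha>) (quadrant2 a b) = emeasure (density lborel ?f) (?g -` quadrant2 a b)"
    unfolding limit_intensity_def using gm quadrant2_sets by (subst emeasure_distr) auto
  also have "\<dots> = (\<integral>\<^sup>+p. ?f p * indicator ({- ln a..} \<times> {- ln b..}) p \<partial>lborel)"
    unfolding pre using fm by (subst emeasure_density) (auto simp: borel_closed closed_Times)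
  also have "\<dots> = (\<integral>\<^sup>+p. ?f p * indicator ({- ln a..} \<times> {- ln b..}) p \<partial>(lborel \<Otimes>\<^sub>M lborel))"
    by (simp add: lborel_prod)
  also have "\<dots> = (\<integral>\<^sup>+x. \<integral>\<^sup>+z. ?f (x, z) * indicator ({- ln a..} \<times> {- ln b..}) (x, z) \<partial>lborel \<partial>lborel)"
    using fm by (intro lborel.nn_integral_fst[symmetric]) (simp add: borel_prod)
  also have "\<dots> = (\<integral>\<^sup>+x. (\<integral>\<^sup>+z. (ennreal (1 * exp (- (1 * x))) * indicator {- ln a..} x) * (ennreal (?b * exp (- (?b * z))) * indicator {- ln b..} z) \<partial>lborel) \<partial>lborel)"
  proof (intro nn_integral_cong)
    fix x z :: real
    have "ennreal (exp (- x) * (?b * exp (- (?b * z)))) = ennreal (1 * exp (- (1 * x))) * ennreal (?b * exp (- (?b * z)))"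
      unfolding mult_1 using b by (intro ennreal_mult) auto
    then show "?f (x, z) * indicator ({- ln a..} \<times> {- ln b..}) (x, z) =
        (ennreal (1 * exp (- (1 * x))) * indicator {- ln a..} x) * (ennreal (?b * exp (- (?b * z))) * indicator {- ln b..} z)"
      by (simp only: prod.case indicator_times fst_conv snd_conv mult_ac)
  qed
  also have "\<dots> = (\<integral>\<^sup>+x. (ennreal (1 * exp (- (1 * x))) * indicator {- ln a..} x) * ennreal (exp (- (?b * (- ln b)))) \<partial>lborel)"
    using nn_integral_exp_tail[OF b, of "- ln b"] by (intro nn_integral_cong) (subst nn_integral_cmult, auto)
  also have "\<dots> = ennreal (exp (- (1 * (- ln a)))) * ennreal (exp (- (?b * (- ln b))))"
    using nn_integral_exp_tail[of 1 "- ln a"] by (subst nn_integral_multc) auto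
  also have "\<dots> = ennreal (a * b powr ?b)"
    using ab by (simp add: powr_def ennreal_mult)
  finally show ?thesis .
qed

text \<open>
  The mass of a cell under the limiting intensity, written as the alternating sum over its four
  corners in which it arises on both sides of the limit.
\<close>

definition cell_mass :: "real \<Rightarrow> real \<Rightarrow> nat \<times> nat \<Rightarrow> real" where
  "cell_mass \<alpha> d = (\<lambda>(i, j). let F = (\<lambda>i j. real i * d * (real j * d) powr (\<alpha> * (1 - \<alpha>))) in
     F (Suc i) (Suc j) - F i (Suc j) - F (Suc i) j + F i j)"

lemma cell_mass_eq: "cell_mass \<alpha> d (i, j) = d * ((real (Suc j) * d) powr (\<alpha> * (1 - \<alpha>)) - (real j * d) powr (\<alpha> * (1 - \<alpha>)))"
  by (simp add: cell_mass_def Let_def algebra_simps)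

lemma emeasure_cell:
  assumes \<alpha>: "0 < \<alpha>" "\<alpha> < 1" and d: "0 < d"
  shows "emeasure (limit_intensity \<alpha>) (cell d c) < \<infinity>" and "measure (limit_intensity \<alpha>) (cell d c) = cell_mass \<alpha> d c"
proof -
  obtain i j where c: "c = (i, j)" by (cases c)
  let ?\<mu> = "limit_intensity \<alpha>"
  let ?L = "\<lambda>i j. {p \<in> plane. level d (neg_exp (fst p)) < i \<and> level d (neg_exp (snd p)) < j}"
  have sets: "sets ?\<mu> = sets (restrict_space borel plane)" by (simp add: limit_intensity_def)
  have Ls: "?L i j \<in> sets ?\<mu>" for i j using lower_set_sets[OF d] sets by simp
  have eL: "emeasure ?\<mu> (?L i j) = ennreal (real i * d * (real j * d) powr (\<alpha> * (1 - \<alpha>)))" for i j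
    unfolding lower_set_eq[OF d] using emeasure_limit_intensity[OF \<alpha>, of "real i * d" "real j * d"] d by auto
  have fm: "?L i j \<in> fmeasurable ?\<mu>" for i j using Ls eL by (intro fmeasurableI) auto
  have mL: "measure ?\<mu> (?L i j) = real i * d * (real j * d) powr (\<alpha> * (1 - \<alpha>))" for i j
    unfolding measure_def eL using d by simp
  have Un: "?L i (Suc j) \<union> ?L (Suc i) j \<in> fmeasurable ?\<mu>" using fm by auto
  have eq: "cell d c = ?L (Suc i) (Suc j) - (?L i (Suc j) \<union> ?L (Suc i) j)" using cell_eq[OF d] c by simp
  have "emeasure ?\<mu> (cell d c) \<le> emeasure ?\<mu> (?L (Suc i) (Suc j))"
    unfolding eq using Ls by (intro emeasure_mono) auto
  also have "\<dots> < \<infinity>" using eL by simp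
  finally show "emeasure ?\<mu> (cell d c) < \<infinity>" .
  have "measure ?\<mu> (cell d c) = measure ?\<mu> (?L (Suc i) (Suc j)) - measure ?\<mu> (?L i (Suc j) \<union> ?L (Suc i) j)"
    unfolding eq using fm Un by (intro measure_Diff) (auto simp: fmeasurableD2 fmeasurableD)
  also have "measure ?\<mu> (?L i (Suc j) \<union> ?L (Suc i) j) = measure ?\<mu> (?L i (Suc j)) + measure ?\<mu> (?L (Suc i) j) - measure ?\<mu> (?L i j)"
  proof -
    have "?L i (Suc j) \<inter> ?L (Suc i) j = ?L i j" by auto
    then show ?thesis using measure_Un3[OF fm[of i "Suc j"] fm[of "Suc i" j]] by simp
  qed
  finally show "measure ?\<mu> (cell d c) = cell_mass \<alpha> d c"
    unfolding mL by (simp add: c cell_mass_def Let_def)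
qed

lemma cell_mass_nonneg: "0 < \<alpha> \<Longrightarrow> \<alpha> < 1 \<Longrightarrow> 0 < d \<Longrightarrow> 0 \<le> cell_mass \<alpha> d c"
  using emeasure_cell(2)[of \<alpha> d c] measure_nonneg by metis

lemma sum_cell_mass:
  assumes \<alpha>: "0 < \<alpha>" "\<alpha> < 1" and d: "0 < d"
  shows "(\<Sum>c\<in>{..<D}\<times>{..<D}. cell_mass \<alpha> d c) = real D * d * (real D * d) powr (\<alpha> * (1 - \<alpha>))"
proof -
  let ?b = "\<alpha> * (1 - \<alpha>)"
  have "(\<Sum>c\<in>{..<D}\<times>{..<D}. cell_mass \<alpha> d c) = (\<Sum>i<D. \<Sum>j<D. d * ((real (Suc j) * d) powr ?b - (real j * d) powr ?b))"
  proof -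
    have "(\<Sum>c\<in>{..<D}\<times>{..<D}. cell_mass \<alpha> d c) = (\<Sum>(i, j)\<in>{..<D}\<times>{..<D}. cell_mass \<alpha> d (i, j))"
      by (intro sum.cong) auto
    then show ?thesis unfolding sum.cartesian_product[symmetric] cell_mass_eq .
  qed
  also have "\<dots> = (\<Sum>i<D. d * ((real D * d) powr ?b - (real 0 * d) powr ?b))"
    unfolding sum_distrib_left[symmetric] sum_lessThan_telescope[of "\<lambda>j. (real j * d) powr ?b" D] ..
  finally show ?thesis by simp
qed

lemma cell_mass_le:
  assumes \<alpha>: "0 < \<alpha>" "\<alpha> < 1" and d: "0 < d" and c: "c \<in> {..<D}\<times>{..<D}"
  shows "cell_mass \<alpha> d c \<le> d * (real D * d) powr (\<alpha> * (1 - \<alpha>))"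
proof -
  obtain i j where ij: "c = (i, j)" by (cases c)
  have "(real (Suc j) * d) powr (\<alpha> * (1 - \<alpha>)) - (real j * d) powr (\<alpha> * (1 - \<alpha>)) \<le> (real D * d) powr (\<alpha> * (1 - \<alpha>)) - 0"
    using c ij d \<alpha> by (intro diff_mono powr_mono2) (auto intro!: mult_right_mono)
  then show ?thesis using d by (simp add: ij cell_mass_eq)
qed

text \<open>
  The bound tends to \<open>0\<close> with \<open>d\<close> when the side \<open>real D *
  d\<close> of the box is kept fixed.
\<close>

lemma sum_cell_mass_square:
  assumes \<alpha>: "0 < \<alpha>" "\<alpha> < 1" and d: "0 < d"
  shows "(\<Sum>c\<in>{..<D}\<times>{..<D}. (cell_mass \<alpha> d c)\<^sup>2) \<le> d * (real D * d * ((real D * d) powr (\<alpha> * (1 - \<alpha>)))\<^sup>2)"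
proof -
  let ?P = "(real D * d) powr (\<alpha> * (1 - \<alpha>))"
  have "(\<Sum>c\<in>{..<D}\<times>{..<D}. (cell_mass \<alpha> d c)\<^sup>2) \<le> (\<Sum>c\<in>{..<D}\<times>{..<D}. (d * ?P) * cell_mass \<alpha> d c)"
    unfolding power2_eq_square using cell_mass_le[OF \<alpha> d] cell_mass_nonneg[OF \<alpha> d] by (intro sum_mono mult_right_mono) auto
  also have "\<dots> = d * ?P * (real D * d * ?P)"
    unfolding sum_distrib_left[symmetric] sum_cell_mass[OF \<alpha> d] ..
  finally show ?thesis by (simp add: power2_eq_square mult_ac)
qed

lemma pmf_poisson_law_0: "0 \<le> m \<Longrightarrow> pmf (poisson_law m) 0 = exp (- m)"
  by (simp add: poisson_law_def)

lemma pmf_poisson_law_1: "0 \<le> m \<Longrightarrow> pmf (poisson_law m) 1 = m * exp (- m)"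
  by (simp add: poisson_law_def)

context
  fixes M' :: "'b measure" and \<xi> :: "'b \<Rightarrow> (ereal \<times> ereal) measure" and \<alpha> d :: real
  assumes ppp: "poisson_point_process M' plane (limit_intensity \<alpha>) \<xi>"
    and \<alpha>: "0 < \<alpha>" "\<alpha> < 1" and d: "0 < d"
begin

interpretation prob_space M' using ppp by (simp add: poisson_point_process_def)

lemma ppp_radon: "\<omega> \<in> space M' \<Longrightarrow> \<xi> \<omega> \<in> radon_measures plane"
  using measurable_space[of \<xi> M' "borel_of_topology (vague_topology plane)" \<omega>] ppp
  by (auto simp: poisson_point_process_def topspace_vague_topology)

lemma ppp_sets: "\<omega> \<in> space M' \<Longrightarrow> sets (\<xi> \<omega>) = sets (restrict_space borel plane)"
  using ppp_radon by (auto simp: radon_measures_def)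

lemma ppp_emeasure_measurable:
  assumes B: "B \<in> sets (restrict_space borel plane)"
  shows "(\<lambda>\<omega>. emeasure (\<xi> \<omega>) B) \<in> borel_measurable M'"
proof -
  have "(\<forall>i<1::nat. (\<lambda>_. B) i \<in> sets (restrict_space borel plane)) \<and> disjoint_family_on (\<lambda>_::nat. B) {..<1}"
    using B by (auto simp: disjoint_family_on_def)
  moreover have "\<forall>(B :: nat \<Rightarrow> (ereal \<times> ereal) set) n.
        (\<forall>i<n. B i \<in> sets (restrict_space borel plane)) \<and> disjoint_family_on B {..<n} \<longrightarrow>
        indep_vars (\<lambda>_. borel) (\<lambda>i \<omega>. emeasure (\<xi> \<omega>) (B i)) {..<n}"
    using ppp unfolding poisson_point_process_def by (elim conjE)
  ultimately have "indep_vars (\<lambda>_. borel) (\<lambda>i \<omega>. emeasure (\<xi> \<omega>) B) {..<1::nat}"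
    by (elim allE[of _ "\<lambda>_. B"] allE[of _ 1]) simp
  then show ?thesis by (auto simp: indep_vars_def)
qed

lemma ppp_void:
  assumes U: "finite U"
  shows "prob {\<omega> \<in> space M'. \<forall>c\<in>U. emeasure (\<xi> \<omega>) (cell d c) = 0} = exp (- (\<Sum>c\<in>U. cell_mass \<alpha> d c))"
proof -
  let ?B = "\<Union>c\<in>U. cell d c" and ?\<mu> = "limit_intensity \<alpha>"
  have s\<mu>: "sets ?\<mu> = sets (restrict_space borel plane)" by (simp add: limit_intensity_def)
  have cs: "cell d c \<in> sets (restrict_space borel plane)" for c using cell_sets[OF d] .
  have B: "?B \<in> sets (restrict_space borel plane)" using U cs by auto
  have "?B \<in> fmeasurable ?\<mu>"
  proof (rule fmeasurable.finite_UN[OF U])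
    fix c show "cell d c \<in> fmeasurable ?\<mu>"
      using cs[of c] s\<mu> emeasure_cell(1)[OF \<alpha> d, of c] by (intro fmeasurableI) auto
  qed
  then have fin: "emeasure ?\<mu> ?B < \<infinity>" by (auto simp: fmeasurable_def)
  have m: "measure ?\<mu> ?B = (\<Sum>c\<in>U. cell_mass \<alpha> d c)"
    using U cs s\<mu> emeasure_cell[OF \<alpha> d] disjoint_cells by (subst measure_finite_Union) (auto simp: less_top)
  have "{\<omega> \<in> space M'. \<forall>c\<in>U. emeasure (\<xi> \<omega>) (cell d c) = 0} = {\<omega> \<in> space M'. emeasure (\<xi> \<omega>) ?B = of_nat 0}"
  proof (intro Collect_cong conj_cong refl)
    fix \<omega> assume w: "\<omega> \<in> space M'"
    have "emeasure (\<xi> \<omega>) ?B = (\<Sum>c\<in>U. emeasure (\<xi> \<omega>) (cell d c))"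
      using U cs disjoint_cells ppp_sets[OF w] by (intro sum_emeasure[symmetric]) auto
    then show "(\<forall>c\<in>U. emeasure (\<xi> \<omega>) (cell d c) = 0) = (emeasure (\<xi> \<omega>) ?B = of_nat 0)"
      using U by (simp add: sum_eq_0_iff)
  qed
  also have "prob \<dots> = pmf (poisson_law (measure ?\<mu> ?B)) 0"
    using ppp B fin unfolding poisson_point_process_def by blast
  finally show ?thesis
    using pmf_poisson_law_0[OF sum_nonneg[of U "cell_mass \<alpha> d"]] cell_mass_nonneg[OF \<alpha> d] by (simp add: m)
qed

text \<open>
  A Poisson variable of mean \<open>m\<close> exceeds \<open>1\<close> with probability at most
  \<open>m\<^sup>2\<close>.
\<close>

lemma ppp_not_simple:
  assumes U: "finite U"
  shows "prob {\<omega> \<in> space M'. \<exists>c\<in>U. emeasure (\<xi> \<omega>) (cell d c) \<notin> {0, 1}} \<le> (\<Sum>c\<in>U. (cell_mass \<alpha> d c)\<^sup>2)"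
proof -
  let ?E = "\<lambda>c k. {\<omega> \<in> space M'. emeasure (\<xi> \<omega>) (cell d c) = of_nat k}"
  let ?N = "\<lambda>c. {\<omega> \<in> space M'. emeasure (\<xi> \<omega>) (cell d c) \<notin> {0, 1}}"
  have ev: "?E c k \<in> events" for c k
    using ppp_emeasure_measurable[OF cell_sets[OF d]] by measurable
  have N: "?N c = space M' - (?E c 0 \<union> ?E c 1)" for c by auto
  have one: "prob (?N c) \<le> (cell_mass \<alpha> d c)\<^sup>2" for c
  proof -
    let ?m = "cell_mass \<alpha> d c"
    have m0: "0 \<le> ?m" using cell_mass_nonneg[OF \<alpha> d] .
    have P: "prob (?E c k) = pmf (poisson_law ?m) k" for k
      using ppp cell_sets[OF d, of c] emeasure_cell[OF \<alpha> d, of c] unfolding poisson_point_process_def by auto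
    have "prob (?E c 0 \<union> ?E c 1) = prob (?E c 0) + prob (?E c 1)"
      using ev[of c 0] ev[of c 1] by (intro finite_measure_Union) auto
    also have "\<dots> = exp (- ?m) * (1 + ?m)"
      using P[of 0] P[of 1] m0 pmf_poisson_law_0[OF m0] pmf_poisson_law_1[OF m0] by (simp add: algebra_simps)
    finally have "prob (?N c) = 1 - exp (- ?m) * (1 + ?m)"
      unfolding N using ev[of c 0] ev[of c 1] by (subst prob_compl) auto
    also have "\<dots> \<le> 1 - (1 - ?m) * (1 + ?m)"
      using exp_ge_add_one_self[of "- ?m"] m0 by (intro diff_left_mono mult_right_mono) auto
    finally show ?thesis by (simp add: power2_eq_square algebra_simps)
  qed
  have Nev: "?N c \<in> events" for c unfolding N using ev[of c 0] ev[of c 1] by auto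
  have "{\<omega> \<in> space M'. \<exists>c\<in>U. emeasure (\<xi> \<omega>) (cell d c) \<notin> {0, 1}} = (\<Union>c\<in>U. ?N c)" by auto
  also have "prob \<dots> \<le> (\<Sum>c\<in>U. prob (?N c))"
    using U Nev by (intro finite_measure_subadditive_finite) auto
  also have "\<dots> \<le> (\<Sum>c\<in>U. (cell_mass \<alpha> d c)\<^sup>2)" by (intro sum_mono one)
  finally show ?thesis .
qed

end

text \<open>
  The number of points in a compact set is finite, hence bounded with high probability.
\<close>

lemma ppp_tight:
  assumes ppp: "poisson_point_process M' plane \<mu> \<xi>" and r: "0 < r" and e: "0 < e"
    and m: "(\<lambda>\<omega>. emeasure (\<xi> \<omega>) (quadrant r)) \<in> borel_measurable M'"
  obtains C :: nat where "measure M' {\<omega> \<in> space M'. \<not> emeasure (\<xi> \<omega>) (quadrant r) \<le> of_nat C} < e"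
proof -
  interpret prob_space M' using ppp by (simp add: poisson_point_process_def)
  let ?E = "\<lambda>C::nat. {\<omega> \<in> space M'. \<not> emeasure (\<xi> \<omega>) (quadrant r) \<le> of_nat C}"
  have "(\<lambda>C. prob (?E C)) \<longlonglongrightarrow> prob (\<Inter>C. ?E C)"
  proof (rule finite_Lim_measure_decseq)
    show "range ?E \<subseteq> events" using m by auto
    show "decseq ?E" by (rule antimonoI) (auto intro: order_trans[of _ "of_nat _" "of_nat _"])
  qed
  also have "(\<Inter>C. ?E C) = {}"
  proof (intro equals0I)
    fix \<omega> assume w: "\<omega> \<in> (\<Inter>C. ?E C)"
    then have "\<omega> \<in> space M'" by auto
    then have "\<xi> \<omega> \<in> radon_measures plane"
      using measurable_space[of \<xi> M' "borel_of_topology (vague_topology plane)" \<omega>] ppp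
      by (auto simp: poisson_point_process_def topspace_vague_topology)
    then have "emeasure (\<xi> \<omega>) (quadrant r) < \<infinity>"
      using compact_quadrant[OF r] quadrant_subset_plane by (auto simp: radon_measures_def)
    then obtain C :: nat where "emeasure (\<xi> \<omega>) (quadrant r) < of_nat C"
      using ennreal_Ex_less_of_nat[of "emeasure (\<xi> \<omega>) (quadrant r)"] by (auto simp: less_top)
    with w show False by (auto simp: not_le dest!: INT_D[of _ _ _ C] dest: less_asym)
  qed
  finally have "(\<lambda>C. prob (?E C)) \<longlonglongrightarrow> 0" by simp
  then have "\<forall>\<^sub>F C in sequentially. prob (?E C) < e" using e by (rule order_tendstoD)
  then show ?thesis using that by (auto simp: eventually_sequentially)
qed

section \<open>Void probabilities of the gap process on a grid\<close>

locale poisson_gaps = decreasing_rate \<alpha> lam1 for \<alpha> lam1 :: real +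
  fixes M :: "'a measure" and N :: "real \<Rightarrow> 'a \<Rightarrow> nat"
  assumes process: "inhomogeneous_poisson_process M (rate \<alpha> lam1) N"
begin

sublocale prob_space M
  using process by (simp add: inhomogeneous_poisson_process_def)

lemma N_measurable: "0 \<le> t \<Longrightarrow> N t \<in> measurable M (count_space UNIV)"
  using process by (simp add: inhomogeneous_poisson_process_def)

lemma N_mono: "\<omega> \<in> space M \<Longrightarrow> 0 \<le> s \<Longrightarrow> s \<le> t \<Longrightarrow> N s \<omega> \<le> N t \<omega>"
  using counting_path_mono[OF counting_pathI[OF process]] by blast

lemma integral_rate:
  assumes "0 \<le> s" "s \<le> t"
  shows "set_lebesgue_integral lborel {s..t} (rate \<alpha> lam1) = cm t - cm s"
proof -
  have int: "set_integrable lborel {0..u} (rate \<alpha> lam1)" if "0 \<le> u" for u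
    using process that by (simp add: inhomogeneous_poisson_process_def)
  have st: "set_integrable lborel {s..t} (rate \<alpha> lam1)"
    by (rule set_integrable_subset[OF int[of t]]) (use assms in auto)
  have I: "(rate \<alpha> lam1 has_integral cm u) {0..u}" if "0 \<le> u" for u
  proof -
    have "((\<lambda>x. lam1 * x powr (\<alpha> - 1)) has_integral lam1 * (u powr (\<alpha> - 1 + 1) / (\<alpha> - 1 + 1))) {0..u}"
      using \<alpha> that by (intro has_integral_mult_right has_integral_powr_from_0) auto
    then show ?thesis by (simp add: rate_def[abs_def] cumulative_rate_def)
  qed
  have "integral {0..s} (rate \<alpha> lam1) + integral {s..t} (rate \<alpha> lam1) = integral {0..t} (rate \<alpha> lam1)"
    using I[of t] assms by (intro Henstock_Kurzweil_Integration.integral_combine) auto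
  then have "integral {s..t} (rate \<alpha> lam1) = cm t - cm s"
    using I[of s] I[of t] assms by (auto dest!: integral_unique)
  then show ?thesis using set_borel_integral_eq_integral(2)[OF st] by simp
qed

lemma prob_increment:
  assumes "0 \<le> s" "s \<le> t"
  shows "prob {\<omega> \<in> space M. N t \<omega> - N s \<omega> = k} = pmf (poisson_law (cm t - cm s)) k"
proof -
  have d: "distr M (count_space UNIV) (\<lambda>\<omega>. N t \<omega> - N s \<omega>) = measure_pmf (poisson_law (cm t - cm s))"
    using process assms integral_rate[OF assms] by (simp add: inhomogeneous_poisson_process_def)
  have m: "(\<lambda>\<omega>. N t \<omega> - N s \<omega>) \<in> measurable M (count_space UNIV)"
  proof (rule measurable_compose_countable[where g = "N s" and f = "\<lambda>i \<omega>. N t \<omega> - i"])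
    show "(\<lambda>\<omega>. N t \<omega> - i) \<in> measurable M (count_space UNIV)" for i
      by (rule measurable_compose[OF N_measurable]) (use assms in auto)
  qed (use N_measurable assms in auto)
  have "prob {\<omega> \<in> space M. N t \<omega> - N s \<omega> = k} = measure (distr M (count_space UNIV) (\<lambda>\<omega>. N t \<omega> - N s \<omega>)) {k}"
    using m by (subst measure_distr) (auto intro!: arg_cong[where f=prob])
  then show ?thesis unfolding d by (simp add: measure_pmf_single)
qed

lemma indep_slot_counts:
  assumes "0 < h" shows "indep_vars (\<lambda>_. count_space UNIV) (slot_count N h) {..<n}"
proof -
  have "\<forall>(\<tau> :: nat \<Rightarrow> real) n. 0 \<le> \<tau> 0 \<and> mono \<tau> \<longrightarrow>
      indep_vars (\<lambda>_. count_space UNIV) (\<lambda>i \<omega>. N (\<tau> (Suc i)) \<omega> - N (\<tau> i) \<omega>) {..<n}"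
    using process unfolding inhomogeneous_poisson_process_def by (elim conjE)
  moreover have "0 \<le> (\<lambda>i. real i * h) 0 \<and> mono (\<lambda>i. real i * h)"
    using assms by (auto intro!: monoI mult_right_mono)
  ultimately show ?thesis
    unfolding slot_count_def[abs_def] by (elim allE[of _ "\<lambda>i. real i * h"] allE[of _ n]) simp
qed

lemma slot_count_measurable: "0 < h \<Longrightarrow> slot_count N h k \<in> measurable M (count_space UNIV)"
  using indep_slot_counts[of h "Suc k"] by (auto simp: indep_vars_def)

lemma sets_slot_predicate:
  assumes "0 < h" "depends_on A P" "finite A"
  shows "{\<omega> \<in> space M. P (\<lambda>i. slot_count N h i \<omega>)} \<in> events"
  using restrict_predicate_event(3)[OF assms(3) slot_count_measurable[OF assms(1)] assms(2)] .

lemma slot_count_sum: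
  assumes "\<omega> \<in> space M" "0 < h"
  shows "N (real (Suc k) * h) \<omega> = N (real k * h) \<omega> + slot_count N h k \<omega>"
  using N_mono[OF assms(1), of "real k * h" "real (Suc k) * h"] assms(2)
  by (simp add: slot_count_def mult_right_mono)

text \<open>A run of empty slots is a single increment that vanishes.\<close>

lemma empty_slots_iff:
  assumes "\<omega> \<in> space M" "0 < h" "m \<le> k"
  shows "(\<forall>j<k. k - m \<le> j \<longrightarrow> slot_count N h j \<omega> = 0) \<longleftrightarrow> N (real k * h) \<omega> - N (real (k - m) * h) \<omega> = 0"
  using assms(3)
proof (induction m)
  case (Suc m)
  have k: "k - m = Suc (k - Suc m)" using Suc.prems by simp
  have "(\<forall>j<k. k - Suc m \<le> j \<longrightarrow> slot_count N h j \<omega> = 0) \<longleftrightarrow>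
    slot_count N h (k - Suc m) \<omega> = 0 \<and> (\<forall>j<k. k - m \<le> j \<longrightarrow> slot_count N h j \<omega> = 0)"
  proof -
    have "k - Suc m \<le> j \<longleftrightarrow> j = k - Suc m \<or> k - m \<le> j" for j using Suc.prems by auto
    moreover have "k - Suc m < k" using Suc.prems by simp
    ultimately show ?thesis by auto
  qed
  also have "\<dots> \<longleftrightarrow> slot_count N h (k - Suc m) \<omega> = 0 \<and> N (real k * h) \<omega> - N (real (k - m) * h) \<omega> = 0"
    using Suc by simp
  also have "\<dots> \<longleftrightarrow> N (real k * h) \<omega> - N (real (k - Suc m) * h) \<omega> = 0"
  proof -
    have "N (real (k - m) * h) \<omega> = N (real (k - Suc m) * h) \<omega> + slot_count N h (k - Suc m) \<omega>"
      using slot_count_sum[OF assms(1,2), of "k - Suc m"] k by simp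
    moreover have "N (real (k - m) * h) \<omega> \<le> N (real k * h) \<omega>"
      using assms by (intro N_mono mult_right_mono) auto
    ultimately show ?thesis by auto
  qed
  finally show ?case .
qed auto

text \<open>Slot \<open>k\<close> ends a gap of length at least about \<open>m\<close> slots.\<close>

definition long_run :: "nat \<Rightarrow> nat \<Rightarrow> (nat \<Rightarrow> nat) \<Rightarrow> bool" where
  "long_run m k s \<longleftrightarrow> s k \<noteq> 0 \<and> m \<le> empty_run s k"

lemma depends_on_run: "depends_on {k - m..<k} (\<lambda>s. m \<le> empty_run s k)"
  unfolding depends_on_def
proof (intro allI impI)
  fix s s' :: "nat \<Rightarrow> nat" assume "\<forall>i\<in>{k - m..<k}. s i = s' i"
  then have "(\<forall>j<k. k - m \<le> j \<longrightarrow> s j = 0) \<longleftrightarrow> (\<forall>j<k. k - m \<le> j \<longrightarrow> s' j = 0)" by auto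
  then show "(m \<le> empty_run s k) = (m \<le> empty_run s' k)" unfolding le_empty_run_iff by blast
qed

lemma depends_on_long_run: "depends_on {k - m..k} (long_run m k)"
  unfolding depends_on_def
proof (intro allI impI)
  fix s s' :: "nat \<Rightarrow> nat" assume eq: "\<forall>i\<in>{k - m..k}. s i = s' i"
  have "(m \<le> empty_run s k) = (m \<le> empty_run s' k)"
    by (rule depends_onD[OF depends_on_run]) (use eq in auto)
  moreover have "s k = s' k" using eq by simp
  ultimately show "long_run m k s = long_run m k s'" by (simp add: long_run_def)
qed

lemma prob_long_run:
  assumes h: "0 < h"
  shows "prob {\<omega> \<in> space M. long_run m k (\<lambda>i. slot_count N h i \<omega>)} = run_prob \<alpha> lam1 h m k"
proof (cases "m \<le> k")
  case False
  then have "\<not> m \<le> empty_run s k" for s using empty_run_le[of s k] by linarith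
  then show ?thesis using False by (simp add: long_run_def run_prob_def)
next
  case True
  let ?P = "\<lambda>s::nat\<Rightarrow>nat. s k \<noteq> 0" and ?Q = "\<lambda>s. m \<le> empty_run s k"
  let ?X = "\<lambda>\<omega> i. slot_count N h i \<omega>"
  have "prob {\<omega> \<in> space M. ?P (?X \<omega>) \<and> ?Q (?X \<omega>)} =
      prob {\<omega> \<in> space M. ?P (?X \<omega>)} * prob {\<omega> \<in> space M. ?Q (?X \<omega>)}"
    by (rule indep_predicates[OF indep_slot_counts[OF h, of "Suc k"], of "{k}" "{k-m..<k}"])
       (auto simp: depends_on_run, simp add: depends_on_def)
  also have "prob {\<omega> \<in> space M. ?P (?X \<omega>)} = 1 - prob {\<omega> \<in> space M. N (real (Suc k) * h) \<omega> - N (real k * h) \<omega> = 0}"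
  proof -
    have "{\<omega> \<in> space M. ?P (?X \<omega>)} = space M - {\<omega> \<in> space M. N (real (Suc k) * h) \<omega> - N (real k * h) \<omega> = 0}"
      by (auto simp: slot_count_def)
    moreover have "{\<omega> \<in> space M. N (real (Suc k) * h) \<omega> - N (real k * h) \<omega> = 0} \<in> events"
      using sets_slot_predicate[OF h, of "{k}" "\<lambda>s. s k = 0"] by (simp add: depends_on_def slot_count_def)
    ultimately show ?thesis by (simp add: prob_compl)
  qed
  also have "prob {\<omega> \<in> space M. N (real (Suc k) * h) \<omega> - N (real k * h) \<omega> = 0} =
      exp (- (cm (real (Suc k) * h) - cm (real k * h)))"
    using h cumulative_rate_mono[of "real k * h" "real (Suc k) * h"]
    by (subst prob_increment) (auto simp: pmf_poisson_law_0 mult_right_mono)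
  also have "prob {\<omega> \<in> space M. ?Q (?X \<omega>)} = prob {\<omega> \<in> space M. N (real k * h) \<omega> - N (real (k - m) * h) \<omega> = 0}"
  proof (intro arg_cong[where f=prob] Collect_cong conj_cong refl)
    fix \<omega> assume "\<omega> \<in> space M"
    then show "(m \<le> empty_run (?X \<omega>) k) = (N (real k * h) \<omega> - N (real (k - m) * h) \<omega> = 0)"
      using empty_slots_iff[OF _ h True, of \<omega>] True by (simp add: le_empty_run_iff)
  qed
  also have "\<dots> = exp (- (cm (real k * h) - cm (real (k - m) * h)))"
    using h cumulative_rate_mono[of "real (k - m) * h" "real k * h"]
    by (subst prob_increment) (auto simp: pmf_poisson_law_0 mult_right_mono)
  finally show ?thesis using True by (simp add: run_prob_def long_run_def)
qed

lemma prob_crowded_slot: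
  assumes h: "0 < h"
  shows "prob {\<omega> \<in> space M. 2 \<le> slot_count N h k \<omega>} \<le> (cm (real (Suc k) * h) - cm (real k * h))\<^sup>2"
proof -
  let ?m = "cm (real (Suc k) * h) - cm (real k * h)"
  let ?E = "\<lambda>i. {\<omega> \<in> space M. slot_count N h k \<omega> = i}"
  have m0: "0 \<le> ?m" using h cumulative_rate_mono[of "real k * h" "real (Suc k) * h"] by (simp add: mult_right_mono)
  have ev: "?E i \<in> events" for i using slot_count_measurable[OF h, of k] by measurable
  have P: "prob (?E i) = pmf (poisson_law ?m) i" for i
    using prob_increment[of "real k * h" "real (Suc k) * h" i] h by (simp add: slot_count_def mult_right_mono)
  have "{\<omega> \<in> space M. 2 \<le> slot_count N h k \<omega>} = space M - (?E 0 \<union> ?E 1)" by auto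
  then have "prob {\<omega> \<in> space M. 2 \<le> slot_count N h k \<omega>} = 1 - prob (?E 0 \<union> ?E 1)"
    using ev[of 0] ev[of 1] by (simp add: prob_compl)
  also have "prob (?E 0 \<union> ?E 1) = prob (?E 0) + prob (?E 1)"
    using ev[of 0] ev[of 1] by (intro finite_measure_Union) auto
  also have "\<dots> = exp (- ?m) * (1 + ?m)"
    unfolding P pmf_poisson_law_0[OF m0] pmf_poisson_law_1[OF m0] by (simp add: algebra_simps)
  also have "1 - exp (- ?m) * (1 + ?m) \<le> 1 - (1 - ?m) * (1 + ?m)"
  proof (intro diff_left_mono mult_right_mono)
    show "1 - ?m \<le> exp (- ?m)" using exp_ge_add_one_self[of "- ?m"] by linarith
  qed (use m0 in linarith)
  finally show ?thesis by (simp add: power2_eq_square algebra_simps)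
qed

text \<open>
  The sum of squares of the slot means is at most their sum times their maximum, and the first
  slot bounds the maximum.
\<close>

lemma prob_crowded_slots:
  assumes h: "0 < h"
  shows "prob {\<omega> \<in> space M. \<exists>k<n. 2 \<le> slot_count N h k \<omega>} \<le> cm h * cm (real n * h)"
proof -
  let ?D = "\<lambda>k. cm (real (Suc k) * h) - cm (real k * h)"
  have D0: "0 \<le> ?D k" for k using h cumulative_rate_mono[of "real k * h" "real (Suc k) * h"] by (simp add: mult_right_mono)
  have Dh: "?D k \<le> cm h" for k
    using cum_subadditive[of "real k * h" h] h by (simp add: distrib_right add.commute)
  have ev: "{\<omega> \<in> space M. 2 \<le> slot_count N h k \<omega>} \<in> events" for k using slot_count_measurable[OF h, of k] by measurable
  have "{\<omega> \<in> space M. \<exists>k<n. 2 \<le> slot_count N h k \<omega>} = (\<Union>k<n. {\<omega> \<in> space M. 2 \<le> slot_count N h k \<omega>})" by auto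
  also have "prob \<dots> \<le> (\<Sum>k<n. prob {\<omega> \<in> space M. 2 \<le> slot_count N h k \<omega>})"
    using ev by (intro finite_measure_subadditive_finite) auto
  also have "\<dots> \<le> (\<Sum>k<n. cm h * ?D k)"
  proof (intro sum_mono)
    fix k
    have "(?D k)\<^sup>2 \<le> cm h * ?D k" unfolding power2_eq_square using D0 Dh by (intro mult_right_mono) auto
    then show "prob {\<omega> \<in> space M. 2 \<le> slot_count N h k \<omega>} \<le> cm h * ?D k"
      using prob_crowded_slot[OF h, of k] by linarith
  qed
  also have "\<dots> = cm h * (cm (real n * h) - cm (real 0 * h))"
    unfolding sum_distrib_left[symmetric] using sum_lessThan_telescope[of "\<lambda>k. cm (real k * h)" n] by simp
  finally show ?thesis by (simp add: cumulative_rate_def)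
qed


text \<open>
  The mesh has to be small compared with the gap length and must make slots with two epochs
  before time \<open>t\<close> unlikely, that is, \<open>mesh t * t\<close> must vanish; any
  sufficiently fast decay would do.
\<close>

definition mesh :: "real \<Rightarrow> real" where "mesh t = 1 / (1 + t\<^sup>2)"

lemma mesh_pos: "0 < mesh t"
  by (simp add: mesh_def add_pos_nonneg)

lemma mesh_rate_limit: "((\<lambda>t. rt t * mesh t) \<longlongrightarrow> 0) at_top"
  unfolding rate_def mesh_def using \<alpha> lam1 by real_asymp

lemma mesh_ln_limit: "((\<lambda>t. mesh t * ln t / t) \<longlongrightarrow> 0) at_top"
  unfolding mesh_def by real_asymp

lemma mesh_times_limit: "((\<lambda>t. mesh t * t) \<longlongrightarrow> 0) at_top"
  unfolding mesh_def by real_asymp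

lemma centering_at_top: "filterlim (centering \<alpha> lam1) at_top at_top"
  unfolding centering_def[abs_def] using \<alpha> by real_asymp

abbreviation "counts t \<omega> \<equiv> (\<lambda>k. slot_count N (mesh t) k \<omega>)"

text \<open>
  The coordinate \<open>u\<close> of the point contributed by slot \<open>k\<close>, with the
  length of the empty run in place of the gap.
\<close>

definition gap_coord :: "real \<Rightarrow> nat \<Rightarrow> (nat \<Rightarrow> nat) \<Rightarrow> real" where
  "gap_coord t k s = exp (- (rt t * mesh t * real (empty_run s k) - centering \<alpha> lam1 t))"

text \<open>
  The coordinate \<open>v\<close> of the point contributed by slot \<open>k\<close>, with the
  end of the slot in place of the epoch.
\<close>

definition time_coord :: "real \<Rightarrow> nat \<Rightarrow> real" where
  "time_coord t k = exp (- ((t - real (Suc k) * mesh t) / t * ln t))"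

end

locale gap_grid = poisson_gaps +
  fixes d :: real and D :: nat
  assumes d: "0 < d" and D: "0 < D"
begin

text \<open>
  The least run of empty slots for which the coordinate \<open>u\<close> is at most \<open>i *
  d\<close>. Long gaps have small \<open>u\<close>, so the threshold decreases with
  \<open>i\<close>.
\<close>

definition run_len :: "real \<Rightarrow> nat \<Rightarrow> nat" where
  "run_len t i = nat \<lceil>(centering \<alpha> lam1 t - ln (real i * d)) / (rt t * mesh t)\<rceil>"

text \<open>
  The slots for which the coordinate \<open>v\<close> is at most \<open>j * d\<close> are the
  first ones.
\<close>

definition slots_before :: "real \<Rightarrow> nat \<Rightarrow> nat" where
  "slots_before t j = nat \<lfloor>t * (1 + ln (real j * d) / ln t) / mesh t\<rfloor>"

lemma gap_coord_le_iff:
  assumes "1 < t" "0 < i"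
  shows "gap_coord t k s \<le> real i * d \<longleftrightarrow> run_len t i \<le> empty_run s k"
proof -
  have c: "0 < rt t * mesh t" using rate_pos[of t] mesh_pos[of t] assms by simp
  have id: "0 < real i * d" using assms d by simp
  have "gap_coord t k s \<le> real i * d \<longleftrightarrow> - (rt t * mesh t * real (empty_run s k) - centering \<alpha> lam1 t) \<le> ln (real i * d)"
    unfolding gap_coord_def using id by (metis exp_le_cancel_iff exp_ln)
  also have "\<dots> \<longleftrightarrow> centering \<alpha> lam1 t - ln (real i * d) \<le> real (empty_run s k) * (rt t * mesh t)"
    by (auto simp: mult.commute)
  also have "\<dots> \<longleftrightarrow> (centering \<alpha> lam1 t - ln (real i * d)) / (rt t * mesh t) \<le> real (empty_run s k)"
    using c by (simp only: pos_divide_le_eq)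
  also have "\<dots> \<longleftrightarrow> run_len t i \<le> empty_run s k"
    unfolding run_len_def by linarith
  finally show ?thesis .
qed

lemma time_coord_le_iff:
  assumes "1 < t" "0 < j"
  shows "time_coord t k \<le> real j * d \<longleftrightarrow> k < slots_before t j"
proof -
  have id: "0 < real j * d" using assms d by simp
  have l: "0 < ln t" using assms by simp
  have "time_coord t k \<le> real j * d \<longleftrightarrow> - ((t - real (Suc k) * mesh t) / t * ln t) \<le> ln (real j * d)"
    unfolding time_coord_def using id by (metis exp_le_cancel_iff exp_ln)
  also have "\<dots> \<longleftrightarrow> real (Suc k) * mesh t \<le> t * (1 + ln (real j * d) / ln t)"
    using l assms by (simp add: field_simps)
  also have "\<dots> \<longleftrightarrow> real (Suc k) \<le> t * (1 + ln (real j * d) / ln t) / mesh t"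
    using mesh_pos[of t] by (simp only: pos_le_divide_eq)
  also have "\<dots> \<longleftrightarrow> k < slots_before t j"
    unfolding slots_before_def by linarith
  finally show ?thesis .
qed

lemma run_len_bounds: "\<forall>\<^sub>F t in at_top. real (run_len t i) * (rt t * mesh t) \<in>
    {centering \<alpha> lam1 t - ln (real i * d) .. centering \<alpha> lam1 t - ln (real i * d) + rt t * mesh t}"
proof -
  have "\<forall>\<^sub>F t in at_top. ln (real i * d) < centering \<alpha> lam1 t"
    using centering_at_top by (simp add: filterlim_at_top_dense)
  then show ?thesis using eventually_gt_at_top[of 1]
  proof eventually_elim
    case (elim t)
    have c: "0 < rt t * mesh t" using rate_pos[of t] mesh_pos[of t] elim by simp
    let ?y = "(centering \<alpha> lam1 t - ln (real i * d)) / (rt t * mesh t)"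
    have "0 \<le> ?y" using elim c by simp
    then have "?y \<le> real (run_len t i)" "real (run_len t i) \<le> ?y + 1" unfolding run_len_def by linarith+
    from mult_right_mono[OF this(1), of "rt t * mesh t"] mult_right_mono[OF this(2), of "rt t * mesh t"] c
    have "?y * (rt t * mesh t) \<le> real (run_len t i) * (rt t * mesh t)" 
      "real (run_len t i) * (rt t * mesh t) \<le> (?y + 1) * (rt t * mesh t)" by simp_all
    moreover have "x / y * y = x" if "0 < y" for x y :: real using that by simp
    from this[OF c] have "?y * (rt t * mesh t) = centering \<alpha> lam1 t - ln (real i * d)" .
    ultimately show ?case by (simp add: distrib_right)
  qed
qed

lemma run_len_limit: "((\<lambda>t. rt t * (real (run_len t i) * mesh t) - centering \<alpha> lam1 t) \<longlongrightarrow> - ln (real i * d)) at_top"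
proof (rule tendsto_sandwich)
  show "\<forall>\<^sub>F t in at_top. - ln (real i * d) \<le> rt t * (real (run_len t i) * mesh t) - centering \<alpha> lam1 t"
    using run_len_bounds[of i] by eventually_elim (simp add: mult_ac)
  show "\<forall>\<^sub>F t in at_top. rt t * (real (run_len t i) * mesh t) - centering \<alpha> lam1 t \<le> - ln (real i * d) + rt t * mesh t"
    using run_len_bounds[of i] by eventually_elim (simp add: mult_ac)
  show "((\<lambda>t. - ln (real i * d) + rt t * mesh t) \<longlongrightarrow> - ln (real i * d)) at_top"
    using tendsto_add[OF tendsto_const mesh_rate_limit, of "- ln (real i * d)"] by simp
qed simp

lemma slots_before_bounds: "\<forall>\<^sub>F t in at_top. real (slots_before t j) * mesh t \<in>
    {t * (1 + ln (real j * d) / ln t) - mesh t .. t * (1 + ln (real j * d) / ln t)}"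
proof -
  have "\<forall>\<^sub>F t in at_top. 0 \<le> t * (1 + ln (real j * d) / ln t)" by real_asymp
  then show ?thesis
  proof eventually_elim
    case (elim t)
    let ?y = "t * (1 + ln (real j * d) / ln t) / mesh t"
    have "0 \<le> ?y" using elim mesh_pos[of t] by simp
    then have "?y - 1 \<le> real (slots_before t j)" "real (slots_before t j) \<le> ?y" unfolding slots_before_def by linarith+
    from mult_right_mono[OF this(1), of "mesh t"] mult_right_mono[OF this(2), of "mesh t"] mesh_pos[of t]
    have "(?y - 1) * mesh t \<le> real (slots_before t j) * mesh t" "real (slots_before t j) * mesh t \<le> ?y * mesh t" by simp_all
    moreover have "?y * mesh t = t * (1 + ln (real j * d) / ln t)" using mesh_pos[of t] by simp
    ultimately show ?case by (simp add: left_diff_distrib)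
  qed
qed

lemma slots_before_limit: "((\<lambda>t. (t - real (slots_before t j) * mesh t) / t * ln t) \<longlongrightarrow> - ln (real j * d)) at_top"
proof (rule tendsto_sandwich)
  have e: "(t - t * (1 + ln (real j * d) / ln t)) / t * ln t = - ln (real j * d)" if "1 < t" for t
    using that by (simp add: field_simps)
  show "\<forall>\<^sub>F t in at_top. - ln (real j * d) \<le> (t - real (slots_before t j) * mesh t) / t * ln t"
    using slots_before_bounds[of j] eventually_gt_at_top[of 1]
  proof eventually_elim
    case (elim t)
    have "(t - t * (1 + ln (real j * d) / ln t)) / t * ln t \<le> (t - real (slots_before t j) * mesh t) / t * ln t"
      using elim by (intro mult_right_mono divide_right_mono) auto
    then show ?case unfolding e[OF elim(2)] .
  qed
  show "\<forall>\<^sub>F t in at_top. (t - real (slots_before t j) * mesh t) / t * ln t \<le> - ln (real j * d) + mesh t * ln t / t"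
    using slots_before_bounds[of j] eventually_gt_at_top[of 1]
  proof eventually_elim
    case (elim t)
    have "(t - real (slots_before t j) * mesh t) / t * ln t \<le> (t - (t * (1 + ln (real j * d) / ln t) - mesh t)) / t * ln t"
      using elim by (intro mult_right_mono divide_right_mono) auto
    also have "\<dots> = (t - t * (1 + ln (real j * d) / ln t)) / t * ln t + mesh t * ln t / t"
      by (simp add: diff_divide_distrib add_divide_distrib left_diff_distrib)
    finally show ?case unfolding e[OF elim(2)] .
  qed
  show "((\<lambda>t. - ln (real j * d) + mesh t * ln t / t) \<longlongrightarrow> - ln (real j * d)) at_top"
    using tendsto_add[OF tendsto_const mesh_ln_limit, of "- ln (real j * d)"] by simp
qed simp

lemma run_len_antimono: "1 < t \<Longrightarrow> 0 < i \<Longrightarrow> i \<le> j \<Longrightarrow> run_len t j \<le> run_len t i"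
  unfolding run_len_def using d rate_pos[of t] mesh_pos[of t]
  by (intro nat_mono ceiling_mono divide_right_mono diff_left_mono) (auto intro!: mult_right_mono)

lemma slots_before_mono: "1 < t \<Longrightarrow> 0 < i \<Longrightarrow> i \<le> j \<Longrightarrow> slots_before t i \<le> slots_before t j"
  unfolding slots_before_def using d mesh_pos[of t]
  by (intro nat_mono floor_mono divide_right_mono mult_left_mono add_left_mono) (auto intro!: mult_right_mono)

lemma level_gap_coord: "1 < t \<Longrightarrow> level d (gap_coord t k s) < i \<longleftrightarrow> 0 < i \<and> run_len t i \<le> empty_run s k"
  using level_less_iff[OF d, of "gap_coord t k s" i] gap_coord_le_iff[of t i k s] by (auto simp: gap_coord_def)

lemma level_time_coord: "1 < t \<Longrightarrow> level d (time_coord t k) < j \<longleftrightarrow> 0 < j \<and> k < slots_before t j"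
  using level_less_iff[OF d, of "time_coord t k" j] time_coord_le_iff[of t j k] by (auto simp: time_coord_def)

text \<open>
  The mean number of points in the box of \<open>i\<close> by \<open>j\<close> cells at the
  origin.
\<close>

definition mean_lower :: "real \<Rightarrow> nat \<Rightarrow> nat \<Rightarrow> real" where
  "mean_lower t i j = (if i = 0 \<or> j = 0 then 0 else \<Sum>k<slots_before t j. run_prob \<alpha> lam1 (mesh t) (run_len t i) k)"

lemma mean_lower_limit: "((\<lambda>t. mean_lower t i j) \<longlongrightarrow> real i * d * (real j * d) powr (\<alpha> * (1 - \<alpha>))) at_top"
proof (cases "i = 0 \<or> j = 0")
  case True
  then have "(\<lambda>t. mean_lower t i j) = (\<lambda>_. 0)" by (auto simp: mean_lower_def)
  then show ?thesis using True by auto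
next
  case False
  have "exp (- (- ln (real i * d) + \<alpha> * (1 - \<alpha>) * - ln (real j * d))) = exp (ln (real i * d)) * exp (\<alpha> * (1 - \<alpha>) * ln (real j * d))"
    by (simp flip: exp_add)
  also have "\<dots> = real i * d * (real j * d) powr (\<alpha> * (1 - \<alpha>))"
    using False d by (simp add: powr_def)
  finally have e: "exp (- (- ln (real i * d) + \<alpha> * (1 - \<alpha>) * - ln (real j * d))) = real i * d * (real j * d) powr (\<alpha> * (1 - \<alpha>))" .
  have "((\<lambda>t. \<Sum>k<slots_before t j. run_prob \<alpha> lam1 (mesh t) (run_len t i) k) \<longlongrightarrow> exp (- (- ln (real i * d) + \<alpha> * (1 - \<alpha>) * - ln (real j * d)))) at_top"
    by (rule sum_run_prob_limit[OF mesh_pos mesh_rate_limit mesh_ln_limit run_len_limit slots_before_limit])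
  then show ?thesis unfolding e using False by (simp add: mean_lower_def)
qed

abbreviation "cells \<equiv> {..<D} \<times> {..<D}"

text \<open>Slot \<open>k\<close> contributes a point to the cell \<open>c\<close>.\<close>

definition hit :: "real \<Rightarrow> nat \<times> nat \<Rightarrow> nat \<Rightarrow> (nat \<Rightarrow> nat) \<Rightarrow> bool" where
  "hit t c k s \<longleftrightarrow> s k \<noteq> 0 \<and> level d (gap_coord t k s) = fst c \<and> level d (time_coord t k) = snd c"

abbreviation "horizon t \<equiv> slots_before t D"

lemma hit_long_run: "1 < t \<Longrightarrow> c \<in> cells \<Longrightarrow> hit t c k s \<Longrightarrow> long_run (run_len t D) k s"
  using level_gap_coord[of t k s D] by (auto simp: hit_def long_run_def)

text \<open>
  Telling the cells of the grid apart requires looking back over the largest finite threshold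
  only, even though the gap itself may be much longer.
\<close>

lemma depends_on_hit:
  assumes t: "1 < t" and c: "c \<in> cells"
  shows "depends_on {k - run_len t 1..k} (hit t c k)"
  unfolding depends_on_def
proof (intro allI impI)
  fix s s' :: "nat \<Rightarrow> nat" assume eq: "\<forall>i\<in>{k - run_len t 1..k}. s i = s' i"
  have less: "level d (gap_coord t k s) < i \<longleftrightarrow> level d (gap_coord t k s') < i" for i
  proof (cases "i = 0")
    case False
    then have "run_len t i \<le> run_len t 1" using run_len_antimono[OF t, of 1 i] by simp
    then have "(run_len t i \<le> empty_run s k) = (run_len t i \<le> empty_run s' k)"
      using eq by (intro depends_onD[OF depends_on_run]) auto
    then show ?thesis using level_gap_coord[OF t] by simp
  qed simp
  have "level d (gap_coord t k s) = level d (gap_coord t k s')"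
    using less[of "level d (gap_coord t k s)"] less[of "level d (gap_coord t k s')"] by linarith
  moreover have "s k = s' k" using eq by simp
  ultimately show "hit t c k s = hit t c k s'" by (simp add: hit_def)
qed

lemma hit_event: "1 < t \<Longrightarrow> c \<in> cells \<Longrightarrow> {\<omega> \<in> space M. hit t c k (counts t \<omega>)} \<in> events"
  by (rule sets_slot_predicate[OF mesh_pos depends_on_hit]) auto

lemma long_run_event: "{\<omega> \<in> space M. long_run m k (counts t \<omega>)} \<in> events"
  by (rule sets_slot_predicate[OF mesh_pos depends_on_long_run]) auto

definition run_tail :: "real \<Rightarrow> nat \<Rightarrow> nat \<Rightarrow> real" where
  "run_tail t i k = (if i = 0 then 0 else run_prob \<alpha> lam1 (mesh t) (run_len t i) k)"

lemma prob_hit: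
  assumes t: "1 < t"
  shows "prob {\<omega> \<in> space M. hit t (i, j) k (counts t \<omega>)} =
    (if level d (time_coord t k) = j then run_tail t (Suc i) k - run_tail t i k else 0)"
proof (cases "level d (time_coord t k) = j")
  case True
  let ?R = "\<lambda>i. {\<omega> \<in> space M. i \<noteq> 0 \<and> long_run (run_len t i) k (counts t \<omega>)}"
  have R: "prob (?R i) = run_tail t i k" for i
    using prob_long_run[OF mesh_pos[of t]] by (simp add: run_tail_def)
  have ev: "?R i \<in> events" for i using long_run_event[of "run_len t i" k t] by (cases "i = 0") auto
  have "level d (gap_coord t k s) = i \<longleftrightarrow> level d (gap_coord t k s) < Suc i \<and> \<not> level d (gap_coord t k s) < i" for s
    by auto
  then have "{\<omega> \<in> space M. hit t (i, j) k (counts t \<omega>)} = ?R (Suc i) - ?R i"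
    using True level_gap_coord[OF t] by (auto simp: hit_def long_run_def)
  moreover have sub: "?R i \<subseteq> ?R (Suc i)"
    using run_len_antimono[OF t, of i "Suc i"] by (auto simp: long_run_def)
  ultimately have "prob {\<omega> \<in> space M. hit t (i, j) k (counts t \<omega>)} = prob (?R (Suc i)) - prob (?R i)"
    using finite_measure_Diff[OF ev ev sub] by (simp only:)
  then show ?thesis unfolding R using True by (simp only: simp_thms if_True)
qed (simp add: hit_def)

lemma sum_prob_hit:
  assumes t: "1 < t" and c: "(i, j) \<in> cells"
  shows "(\<Sum>k<horizon t. prob {\<omega> \<in> space M. hit t (i, j) k (counts t \<omega>)}) =
    mean_lower t (Suc i) (Suc j) - mean_lower t i (Suc j) - mean_lower t (Suc i) j + mean_lower t i j"
proof -
  let ?g = "\<lambda>k. run_tail t (Suc i) k - run_tail t i k"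
  let ?n = "\<lambda>j. if j = 0 then 0 else slots_before t j"
  have nj: "?n j \<le> ?n (Suc j)" "?n (Suc j) \<le> horizon t"
    using slots_before_mono[OF t, of j "Suc j"] slots_before_mono[OF t, of "Suc j" D] c by auto
  have lv: "level d (time_coord t k) = j \<longleftrightarrow> k < ?n (Suc j) \<and> \<not> k < ?n j" for k
    using level_time_coord[OF t, of k "Suc j"] level_time_coord[OF t, of k j] by auto
  have "(\<Sum>k<horizon t. prob {\<omega> \<in> space M. hit t (i, j) k (counts t \<omega>)}) =
     (\<Sum>k<horizon t. (if k < ?n (Suc j) then ?g k else 0) - (if k < ?n j then ?g k else 0))"
    unfolding prob_hit[OF t] lv using nj(1) by (intro sum.cong) auto
  also have "\<dots> = (\<Sum>k<?n (Suc j). ?g k) - (\<Sum>k<?n j. ?g k)"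
  proof -
    have "(\<Sum>k<horizon t. if k < n then ?g k else 0) = (\<Sum>k<n. ?g k)" if "n \<le> horizon t" for n
    proof -
      have "{k \<in> {..<horizon t}. k < n} = {..<n}" using that by auto
      then show ?thesis by (subst sum.inter_filter[symmetric]) auto
    qed
    then show ?thesis using nj unfolding sum_subtractf by simp
  qed
  also have "(\<Sum>k<?n (Suc j). ?g k) = mean_lower t (Suc i) (Suc j) - mean_lower t i (Suc j)"
    by (simp add: mean_lower_def run_tail_def sum_subtractf)
  also have "(\<Sum>k<?n j. ?g k) = mean_lower t (Suc i) j - mean_lower t i j"
    by (simp add: mean_lower_def run_tail_def sum_subtractf)
  finally show ?thesis by simp
qed

lemma sum_prob_hit_limit:
  assumes c: "c \<in> cells"
  shows "((\<lambda>t. \<Sum>k<horizon t. prob {\<omega> \<in> space M. hit t c k (counts t \<omega>)}) \<longlongrightarrow> cell_mass \<alpha> d c) at_top"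
proof -
  obtain i j where ij: "c = (i, j)" by (cases c)
  have "((\<lambda>t. mean_lower t (Suc i) (Suc j) - mean_lower t i (Suc j) - mean_lower t (Suc i) j + mean_lower t i j) \<longlongrightarrow> cell_mass \<alpha> d c) at_top"
    unfolding ij cell_mass_def Let_def prod.case by (intro tendsto_intros mean_lower_limit)
  moreover have "\<forall>\<^sub>F t in at_top. mean_lower t (Suc i) (Suc j) - mean_lower t i (Suc j) - mean_lower t (Suc i) j + mean_lower t i j = 
      (\<Sum>k<horizon t. prob {\<omega> \<in> space M. hit t c k (counts t \<omega>)})"
    using eventually_gt_at_top[of 1] by eventually_elim (use sum_prob_hit c ij in auto)
  ultimately show ?thesis by (rule Lim_transform_eventually)
qed

text \<open>
  The window is as long as the largest threshold, whereas long gaps are those above the smallest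
  one; both have the same order.
\<close>

lemma window_limit: "((\<lambda>t. cm (real (Suc (run_len t 1)) * mesh t) * phi (real (run_len t D) * mesh t) (real (horizon t) * mesh t)) \<longlongrightarrow> 0) at_top"
proof (rule cum_threshold_limit[OF _ run_len_limit slots_before_limit])
  have "((\<lambda>t. (rt t * (real (run_len t 1) * mesh t) - centering \<alpha> lam1 t) + rt t * mesh t) \<longlongrightarrow> - ln (real 1 * d) + 0) at_top"
    by (intro tendsto_add run_len_limit mesh_rate_limit)
  then show "((\<lambda>t. rt t * (real (Suc (run_len t 1)) * mesh t) - centering \<alpha> lam1 t) \<longlongrightarrow> - ln (real 1 * d)) at_top"
    by (simp add: algebra_simps)
qed

text \<open>
  The rare events of \<open>dissociated_void_probability\<close> are the hits of
  \<open>W\<close>, and the events containing them are the gaps that reach the box at all.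
\<close>

lemma void_limit:
  assumes W: "W \<subseteq> cells"
  shows "((\<lambda>t. prob {\<omega> \<in> space M. \<forall>k<horizon t. \<forall>c\<in>W. \<not> hit t c k (counts t \<omega>)}) \<longlongrightarrow>
     exp (- (\<Sum>c\<in>W. cell_mass \<alpha> d c))) at_top"
proof -
  have fW: "finite W" using W finite_subset by auto
  let ?s = "\<lambda>t. cm (real (Suc (run_len t 1)) * mesh t) * phi (real (run_len t D) * mesh t) (real (horizon t) * mesh t)"
  let ?G = "\<lambda>t k. {\<omega> \<in> space M. \<exists>c\<in>W. hit t c k (counts t \<omega>)}"
  let ?H = "\<lambda>t k. {\<omega> \<in> space M. long_run (run_len t D) k (counts t \<omega>)}"
  have Gp: "prob (?G t k) = (\<Sum>c\<in>W. prob {\<omega> \<in> space M. hit t c k (counts t \<omega>)})" if "1 < t" for t k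
  proof -
    have "?G t k = (\<Union>c\<in>W. {\<omega> \<in> space M. hit t c k (counts t \<omega>)})" by auto
    moreover have "disjoint_family_on (\<lambda>c. {\<omega> \<in> space M. hit t c k (counts t \<omega>)}) W"
      by (auto simp: disjoint_family_on_def hit_def prod_eq_iff)
    ultimately show ?thesis
      using fW W hit_event[OF that] by (auto intro!: finite_measure_finite_Union)
  qed
  have bound: "\<forall>\<^sub>F t in at_top. \<bar>prob {\<omega> \<in> space M. \<forall>k<horizon t. \<forall>c\<in>W. \<not> hit t c k (counts t \<omega>)} -
      exp (- (\<Sum>c\<in>W. \<Sum>k<horizon t. prob {\<omega> \<in> space M. hit t c k (counts t \<omega>)}))\<bar> \<le> 3 * ?s t * mean_lower t D D"
    using eventually_gt_at_top[of 1] eventually_run_pos[OF mesh_pos mesh_rate_limit mesh_ln_limit run_len_limit[of D] slots_before_limit[of D]]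
  proof eventually_elim
    case (elim t)
    let ?n = "horizon t" and ?m = "run_len t 1" and ?mD = "run_len t D"
    have mD: "?mD \<le> ?m" using run_len_antimono[OF elim(1), of 1 D] D by simp
    let ?g = "\<lambda>k s. \<exists>c\<in>W. hit t c k s"
    have dep: "depends_on {k - ?m..k} (?g k)" for k
      using depends_on_hit[OF elim(1)] W unfolding depends_on_def by blast
    have Gev: "?G t k \<in> events" for k
      by (rule sets_slot_predicate[OF mesh_pos dep]) simp
    have indep: "indep_vars (\<lambda>_. count_space UNIV) (slot_count N (mesh t)) {..<Suc k}" for k
      by (rule indep_slot_counts[OF mesh_pos])
    have "\<bar>prob (space M - (\<Union>k<?n. ?G t k)) - exp (- (\<Sum>k<?n. prob (?G t k)))\<bar> \<le> 3 * ?s t * (\<Sum>k<?n. prob (?H t k))"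
    proof (rule dissociated_void_probability[where m = ?m])
      show "?G t k \<in> events" for k by (rule Gev)
      show "?H t k \<in> events" for k by (rule long_run_event)
      show "?G t k \<subseteq> ?H t k" for k using hit_long_run[OF elim(1)] W by blast
      fix k
      let ?P = "\<lambda>s. \<forall>j<k - ?m. \<not> ?g j s"
      have dP: "depends_on {..<k - ?m} ?P"
        unfolding depends_on_def
      proof (intro allI impI)
        fix s s' :: "nat \<Rightarrow> nat" assume eq: "\<forall>i\<in>{..<k - ?m}. s i = s' i"
        have "?g j s = ?g j s'" if "j < k - ?m" for j
          by (rule depends_onD[OF dep]) (use eq that in auto)
        then show "?P s = ?P s'" by blast
      qed
      have "prob {\<omega> \<in> space M. ?P (counts t \<omega>) \<and> ?g k (counts t \<omega>)} = 
          prob {\<omega> \<in> space M. ?P (counts t \<omega>)} * prob {\<omega> \<in> space M. ?g k (counts t \<omega>)}"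
        by (rule indep_predicates[OF indep[of k] _ _ _ _ _ dP dep]) auto
      moreover have "{\<omega> \<in> space M. ?P (counts t \<omega>)} = space M - (\<Union>j<k - ?m. ?G t j)" by auto
      moreover have "{\<omega> \<in> space M. ?P (counts t \<omega>) \<and> ?g k (counts t \<omega>)} = (space M - (\<Union>j<k - ?m. ?G t j)) \<inter> ?G t k" by auto
      ultimately show "prob ((space M - (\<Union>j<k - ?m. ?G t j)) \<inter> ?G t k) = prob (space M - (\<Union>j<k - ?m. ?G t j)) * prob (?G t k)"
        by simp
      show "(\<Sum>j\<in>{k - ?m..k}. prob (?H t j)) \<le> ?s t" if "k < ?n"
        unfolding prob_long_run[OF mesh_pos] by (rule window_run_prob[OF mesh_pos elim(2) that])
      fix j assume jk: "j < k"
      show "prob (?H t j \<inter> ?H t k) \<le> prob (?H t j) * prob (?H t k)"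
      proof (cases "k - ?mD \<le> j")
        case True
        have "?H t j \<inter> ?H t k = {}"
          using True jk by (auto simp: long_run_def le_empty_run_iff)
        then show ?thesis by simp
      next
        case False
        have "prob {\<omega> \<in> space M. long_run ?mD j (counts t \<omega>) \<and> long_run ?mD k (counts t \<omega>)} = prob (?H t j) * prob (?H t k)"
          by (rule indep_predicates[OF indep[of k] _ _ _ _ _ depends_on_long_run depends_on_long_run])
             (use False jk in auto)
        moreover have "{\<omega> \<in> space M. long_run ?mD j (counts t \<omega>) \<and> long_run ?mD k (counts t \<omega>)} = ?H t j \<inter> ?H t k" by auto
        ultimately show ?thesis by simp
      qed
    qed
    moreover have "space M - (\<Union>k<?n. ?G t k) = {\<omega> \<in> space M. \<forall>k<?n. \<forall>c\<in>W. \<not> hit t c k (counts t \<omega>)}" by auto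
    moreover have "(\<Sum>k<?n. prob (?G t k)) = (\<Sum>c\<in>W. \<Sum>k<?n. prob {\<omega> \<in> space M. hit t c k (counts t \<omega>)})"
      unfolding Gp[OF elim(1)] by (rule sum.swap)
    moreover have "(\<Sum>k<?n. prob (?H t k)) = mean_lower t D D"
      unfolding prob_long_run[OF mesh_pos] using D by (simp add: mean_lower_def)
    ultimately show ?case by simp
  qed
  have "((\<lambda>t. 3 * ?s t * mean_lower t D D) \<longlongrightarrow> 3 * 0 * (real D * d * (real D * d) powr (\<alpha> * (1 - \<alpha>)))) at_top"
    by (intro tendsto_mult tendsto_const window_limit mean_lower_limit)
  then have "((\<lambda>t. 3 * ?s t * mean_lower t D D) \<longlongrightarrow> 0) at_top" by simp
  from Lim_null_comparison[OF _ this, of "\<lambda>t. prob {\<omega> \<in> space M. \<forall>k<horizon t. \<forall>c\<in>W. \<not> hit t c k (counts t \<omega>)} -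
      exp (- (\<Sum>c\<in>W. \<Sum>k<horizon t. prob {\<omega> \<in> space M. hit t c k (counts t \<omega>)}))"] bound
  have 1: "((\<lambda>t. prob {\<omega> \<in> space M. \<forall>k<horizon t. \<forall>c\<in>W. \<not> hit t c k (counts t \<omega>)} -
      exp (- (\<Sum>c\<in>W. \<Sum>k<horizon t. prob {\<omega> \<in> space M. hit t c k (counts t \<omega>)}))) \<longlongrightarrow> 0) at_top"
    by (simp only: real_norm_def)
  have 2: "((\<lambda>t. exp (- (\<Sum>c\<in>W. \<Sum>k<horizon t. prob {\<omega> \<in> space M. hit t c k (counts t \<omega>)}))) \<longlongrightarrow> exp (- (\<Sum>c\<in>W. cell_mass \<alpha> d c))) at_top"
    using W by (intro tendsto_exp tendsto_minus tendsto_sum sum_prob_hit_limit) auto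
  from tendsto_add[OF 1 2] show ?thesis by simp
qed

text \<open>
  The mean number of points beyond the first in a cell of mass \<open>m\<close> tends to
  \<open>m - (1 - exp (- m))\<close>, which is at most \<open>m\<^sup>2\<close>.
\<close>

lemma double_hit_limit:
  assumes e: "0 < e"
  shows "\<forall>\<^sub>F t in at_top. prob {\<omega> \<in> space M. \<exists>c\<in>cells. \<exists>k<horizon t. \<exists>j<k. hit t c j (counts t \<omega>) \<and> hit t c k (counts t \<omega>)}
     < (\<Sum>c\<in>cells. (cell_mass \<alpha> d c)\<^sup>2) + e"
proof -
  let ?E = "\<lambda>t c k. {\<omega> \<in> space M. hit t c k (counts t \<omega>)}"
  let ?V = "\<lambda>t c. prob {\<omega> \<in> space M. \<forall>k<horizon t. \<forall>c'\<in>{c}. \<not> hit t c' k (counts t \<omega>)}"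
  let ?b = "\<lambda>t. \<Sum>c\<in>cells. (\<Sum>k<horizon t. prob (?E t c k)) - (1 - ?V t c)"
  have "(?b \<longlongrightarrow> (\<Sum>c\<in>cells. cell_mass \<alpha> d c - (1 - exp (- (\<Sum>c\<in>{c}. cell_mass \<alpha> d c))))) at_top"
    by (intro tendsto_sum tendsto_diff tendsto_const sum_prob_hit_limit void_limit) auto
  moreover have "(\<Sum>c\<in>cells. cell_mass \<alpha> d c - (1 - exp (- (\<Sum>c\<in>{c}. cell_mass \<alpha> d c)))) \<le> (\<Sum>c\<in>cells. (cell_mass \<alpha> d c)\<^sup>2)"
  proof (intro sum_mono)
    fix c
    let ?m = "cell_mass \<alpha> d c"
    have m0: "0 \<le> ?m" using cell_mass_nonneg[OF \<alpha> d] .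
    have "exp (- ?m) \<le> 1 / (1 + ?m)"
      using exp_ge_add_one_self[of ?m] m0 by (simp add: exp_minus field_simps)
    also have "\<dots> \<le> 1 - ?m + ?m * ?m" using m0 by (simp add: field_simps)
    finally show "?m - (1 - exp (- (\<Sum>c\<in>{c}. cell_mass \<alpha> d c))) \<le> ?m\<^sup>2" by (simp add: power2_eq_square)
  qed
  ultimately have "\<forall>\<^sub>F t in at_top. ?b t < (\<Sum>c\<in>cells. (cell_mass \<alpha> d c)\<^sup>2) + e"
    using e by (intro order_tendstoD(2)) auto
  then show ?thesis using eventually_gt_at_top[of 1]
  proof eventually_elim
    case (elim t)
    let ?D = "\<lambda>c. {\<omega> \<in> space M. \<exists>k<horizon t. \<exists>j<k. \<omega> \<in> ?E t c j \<and> \<omega> \<in> ?E t c k}"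
    have ev: "?E t c k \<in> events" if "c \<in> cells" for c k using hit_event[OF elim(2) that] .
    have Dev: "?D c \<in> events" if "c \<in> cells" for c
    proof -
      have "?D c = (\<Union>k<horizon t. \<Union>j<k. ?E t c j \<inter> ?E t c k)" by auto
      also have "\<dots> \<in> events" by (intro sets.Int sets.finite_UN ev that) auto
      finally show ?thesis .
    qed
    have one: "prob (?D c) \<le> (\<Sum>k<horizon t. prob (?E t c k)) - (1 - ?V t c)" if c: "c \<in> cells" for c
    proof -
      have "(\<Union>k<horizon t. ?E t c k) = space M - {\<omega> \<in> space M. \<forall>k<horizon t. \<forall>c'\<in>{c}. \<not> hit t c' k (counts t \<omega>)}" by auto
      moreover have "{\<omega> \<in> space M. \<forall>k<horizon t. \<forall>c'\<in>{c}. \<not> hit t c' k (counts t \<omega>)} = space M - (\<Union>k<horizon t. ?E t c k)" by auto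
      moreover have "space M - (\<Union>k<horizon t. ?E t c k) \<in> events" using ev[OF c] by auto
      ultimately have "prob (\<Union>k<horizon t. ?E t c k) = 1 - ?V t c" by (metis (no_types, lifting) prob_compl)
      then show ?thesis using prob_two_events_le[of "horizon t" "?E t c"] ev[OF c] by simp
    qed
    have "{\<omega> \<in> space M. \<exists>c\<in>K. \<exists>k<n. \<exists>j<k. Q c j \<omega> \<and> Q c k \<omega>} =
        (\<Union>c\<in>K. {\<omega> \<in> space M. \<exists>k<n. \<exists>j<k. \<omega> \<in> {\<omega> \<in> space M. Q c j \<omega>} \<and> \<omega> \<in> {\<omega> \<in> space M. Q c k \<omega>}})"
      for K :: "(nat \<times> nat) set" and n :: nat and Q by auto
    then have eq: "{\<omega> \<in> space M. \<exists>c\<in>cells. \<exists>k<horizon t. \<exists>j<k. hit t c j (counts t \<omega>) \<and> hit t c k (counts t \<omega>)} = (\<Union>c\<in>cells. ?D c)" .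
    have "prob (\<Union>c\<in>cells. ?D c) \<le> (\<Sum>c\<in>cells. prob (?D c))"
      by (intro finite_measure_subadditive_finite image_subsetI Dev finite_cartesian_product finite_lessThan)
    moreover have "(\<Sum>c\<in>cells. prob (?D c)) \<le> ?b t" by (rule sum_mono) (rule one)
    ultimately show ?case using elim(1) unfolding eq by linarith
  qed
qed

lemma crowded_limit: "((\<lambda>t. prob {\<omega> \<in> space M. \<exists>k<horizon t. 2 \<le> counts t \<omega> k}) \<longlongrightarrow> 0) at_top"
proof -
  have "((\<lambda>t. real (horizon t) * mesh t / t) \<longlongrightarrow> 1) at_top"
    by (rule epoch_ratio[OF slots_before_limit])
  from tendsto_mult[OF this mesh_times_limit]
  have "((\<lambda>t. real (horizon t) * mesh t / t * (mesh t * t)) \<longlongrightarrow> 0) at_top" by simp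
  then have "((\<lambda>t. (real (horizon t) * mesh t / t * (mesh t * t)) powr \<alpha>) \<longlongrightarrow> 0 powr \<alpha>) at_top"
    using \<alpha> mesh_pos by (intro tendsto_powr' tendsto_const) (auto intro!: always_eventually simp: less_imp_le)
  then have "((\<lambda>t. (lam1 / \<alpha>)\<^sup>2 * (real (horizon t) * mesh t / t * (mesh t * t)) powr \<alpha>) \<longlongrightarrow> (lam1 / \<alpha>)\<^sup>2 * 0) at_top"
    by (intro tendsto_mult_left) simp
  moreover have "\<forall>\<^sub>F t in at_top. (lam1 / \<alpha>)\<^sup>2 * (real (horizon t) * mesh t / t * (mesh t * t)) powr \<alpha> = cm (mesh t) * cm (real (horizon t) * mesh t)"
    using eventually_gt_at_top[of 1]
  proof eventually_elim
    case (elim t)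
    have "real (horizon t) * mesh t / t * (mesh t * t) = mesh t * (real (horizon t) * mesh t)" using elim by simp
    then have "(real (horizon t) * mesh t / t * (mesh t * t)) powr \<alpha> = mesh t powr \<alpha> * (real (horizon t) * mesh t) powr \<alpha>"
      by (simp only: powr_mult)
    then show ?case by (simp only: cumulative_rate_def power2_eq_square mult_ac)
  qed
  ultimately have lim: "((\<lambda>t. cm (mesh t) * cm (real (horizon t) * mesh t)) \<longlongrightarrow> 0) at_top"
    using Lim_transform_eventually by fastforce
  show ?thesis
    by (rule tendsto_sandwich[OF _ _ tendsto_const lim])
       (auto intro!: always_eventually prob_crowded_slots[OF mesh_pos] measure_nonneg)
qed

end

section \<open>From the grid to the vague topology\<close>

lemma unit_mass_integral_close:
  fixes f :: "'c \<Rightarrow> real"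
  assumes A: "A \<in> sets \<nu>" "emeasure \<nu> A = 1" and f: "integrable \<nu> f"
    and close: "\<And>q. q \<in> A \<Longrightarrow> \<bar>f q - y\<bar> \<le> e"
  shows "\<bar>(\<integral>q. indicator A q * f q \<partial>\<nu>) - y\<bar> \<le> e"
proof -
  have iA: "integrable \<nu> (\<lambda>q. indicator A q * c)" for c :: real
    using A by (intro integrable_mult_left integrable_real_indicator) auto
  have mA: "measure \<nu> A = 1" using A(2) by (simp add: measure_def)
  have IA: "(\<integral>q. indicator A q * c \<partial>\<nu>) = c" for c :: real
    using A mA by (simp add: sets.Int_space_eq2)
  have if': "integrable \<nu> (\<lambda>q. indicator A q * f q)"
    using integrable_mult_indicator[OF A(1) f] by simp
  have "(\<integral>q. indicator A q * f q \<partial>\<nu>) - y = (\<integral>q. indicator A q * f q - indicator A q * y \<partial>\<nu>)"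
    using if' iA IA[of y] by simp
  also have "\<bar>\<dots>\<bar> \<le> (\<integral>q. \<bar>indicator A q * f q - indicator A q * y\<bar> \<partial>\<nu>)" by (rule integral_abs_bound)
  also have "\<dots> \<le> (\<integral>q. indicator A q * e \<partial>\<nu>)"
    using if' iA close by (intro integral_mono) (auto simp: indicator_def)
  finally show ?thesis unfolding IA .
qed

context gap_grid
begin

abbreviation "width \<equiv> real D * d"

definition occupied :: "real \<Rightarrow> 'a \<Rightarrow> (nat \<times> nat) set" where
  "occupied t \<omega> = {c \<in> cells. \<exists>k<horizon t. hit t c k (counts t \<omega>)}"

lemma occupied_event: "{\<omega> \<in> space M. c \<in> occupied t \<omega>} \<in> events"
proof -
  have dep: "depends_on {..k} (hit t c k)" for k
    unfolding depends_on_def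
  proof (intro allI impI)
    fix s s' :: "nat \<Rightarrow> nat" assume eq: "\<forall>i\<in>{..k}. s i = s' i"
    have "m \<le> empty_run s k \<longleftrightarrow> m \<le> empty_run s' k" for m
      by (rule depends_onD[OF depends_on_run]) (use eq in auto)
    then have "empty_run s k = empty_run s' k" by (meson order_antisym order_refl)
    then show "hit t c k s = hit t c k s'" using eq by (simp add: hit_def gap_coord_def)
  qed
  have "{\<omega> \<in> space M. c \<in> occupied t \<omega>} = (if c \<in> cells then \<Union>k<horizon t. {\<omega> \<in> space M. hit t c k (counts t \<omega>)} else {})"
    by (auto simp: occupied_def)
  then show ?thesis using sets_slot_predicate[OF mesh_pos dep] by auto
qed

lemma neg_exp_gap_point:
  "neg_exp (fst (gap_point \<alpha> lam1 N t \<omega> i)) = exp (- (rt t * gap N i \<omega> - centering \<alpha> lam1 t))"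
  "neg_exp (snd (gap_point \<alpha> lam1 N t \<omega> i)) = exp (- ((t - epoch N i \<omega>) / t * ln t))"
  by (simp_all add: gap_point_def)

text \<open>
  Passing from the gap and the epoch to the slots changes both coordinates by factors that tend
  to \<open>1\<close>.
\<close>

lemma gap_point_near_grid:
  assumes w: "\<omega> \<in> space M" and t: "1 < t"
    and simple: "\<And>k. k < horizon t \<Longrightarrow> counts t \<omega> k \<le> 1"
    and k: "k < horizon t" "counts t \<omega> k \<noteq> 0"
  defines "p \<equiv> gap_point \<alpha> lam1 N t \<omega> (N (real (Suc k) * mesh t) \<omega>)"
  shows "neg_exp (fst p) \<le> gap_coord t k (counts t \<omega>)"
    and "gap_coord t k (counts t \<omega>) * exp (- (2 * (rt t * mesh t))) \<le> neg_exp (fst p)"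
    and "neg_exp (snd p) \<le> time_coord t k"
    and "time_coord t k * exp (- (mesh t * ln t / t)) \<le> neg_exp (snd p)"
proof -
  have path: "counting_path N \<omega>" using counting_pathI[OF process w] .
  let ?i = "N (real (Suc k) * mesh t) \<omega>" and ?L = "real (empty_run (counts t \<omega>) k)"
  have r: "0 < rt t" using rate_pos t by simp
  have T: "real k * mesh t < epoch N ?i \<omega>" "epoch N ?i \<omega> \<le> real (Suc k) * mesh t"
    by (rule epoch_of_slot(2,3)[where s = "counts t \<omega>" and n = "horizon t" and k = k and h = "mesh t" and N = N and \<omega> = \<omega>, OF path mesh_pos _ _ k]; use simple in simp)+
  have g: "?L * mesh t \<le> gap N ?i \<omega>" "gap N ?i \<omega> \<le> ?L * mesh t + 2 * mesh t"
    by (rule gap_of_slot[where s = "counts t \<omega>" and n = "horizon t" and k = k and h = "mesh t" and N = N and \<omega> = \<omega>, OF path mesh_pos _ _ k]; use simple in simp)+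
  have "rt t * (?L * mesh t) \<le> rt t * gap N ?i \<omega>" using g(1) r by (intro mult_left_mono) auto
  then show "neg_exp (fst p) \<le> gap_coord t k (counts t \<omega>)"
    unfolding p_def neg_exp_gap_point gap_coord_def by (simp add: mult_ac)
  have "rt t * gap N ?i \<omega> \<le> rt t * (?L * mesh t + 2 * mesh t)" using g(2) r by (intro mult_left_mono) auto
  then show "gap_coord t k (counts t \<omega>) * exp (- (2 * (rt t * mesh t))) \<le> neg_exp (fst p)"
    unfolding p_def neg_exp_gap_point gap_coord_def by (simp add: algebra_simps flip: exp_add)
  have l: "0 < ln t" using t by simp
  have "(t - real (Suc k) * mesh t) / t * ln t \<le> (t - epoch N ?i \<omega>) / t * ln t"
    using T t l by (intro mult_right_mono divide_right_mono) auto
  then show "neg_exp (snd p) \<le> time_coord t k"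
    unfolding p_def neg_exp_gap_point time_coord_def by simp
  have "(t - epoch N ?i \<omega>) / t * ln t \<le> (t - (real (Suc k) * mesh t - mesh t)) / t * ln t"
    using T t l by (intro mult_right_mono divide_right_mono) (auto simp: algebra_simps)
  also have "\<dots> = (t - real (Suc k) * mesh t) / t * ln t + mesh t * ln t / t"
    by (simp add: diff_divide_distrib add_divide_distrib algebra_simps)
  finally show "time_coord t k * exp (- (mesh t * ln t / t)) \<le> neg_exp (snd p)"
    unfolding p_def neg_exp_gap_point time_coord_def by (simp flip: exp_add)
qed

text \<open>
  Both integrals are sums over the same nonempty cells, each of which holds one point of either
  measure. Within a cell the function varies by at most \<open>e\<close>, also after the point
  of the gap process is moved from its position on the time grid to its true position.
\<close>

lemma integral_close:
  fixes \<psi> :: "real \<times> real \<Rightarrow> real" and \<nu> :: "(ereal \<times> ereal) measure"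
  assumes w: "\<omega> \<in> space M" and t: "1 < t"
    and simple: "\<And>k. k < horizon t \<Longrightarrow> counts t \<omega> k \<le> 1"
    and single: "\<And>c j k. c \<in> cells \<Longrightarrow> k < horizon t \<Longrightarrow> j < k \<Longrightarrow> hit t c j (counts t \<omega>) \<Longrightarrow> \<not> hit t c k (counts t \<omega>)"
    and r: "0 < r" and supp: "\<And>w. r \<le> max \<bar>fst w\<bar> \<bar>snd w\<bar> \<Longrightarrow> \<psi> w = 0"
    and modulus: "\<And>u v u' v'. {u, v, u', v'} \<subseteq> {0..width} \<Longrightarrow> \<bar>u - u'\<bar> \<le> \<delta> \<Longrightarrow> \<bar>v - v'\<bar> \<le> \<delta> \<Longrightarrow> \<bar>\<psi> (u, v) - \<psi> (u', v')\<bar> \<le> e"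
    and fm: "(\<lambda>p. \<psi> (neg_exp (fst p), neg_exp (snd p))) \<in> borel_measurable (restrict_space borel plane)"
    and d\<delta>: "d \<le> \<delta> / 2"
    and s1: "width * (1 - exp (- (2 * (rt t * mesh t)))) \<le> \<delta> / 2"
    and s2: "width * (1 - exp (- (mesh t * ln t / t))) \<le> \<delta> / 2"
    and s3: "r \<le> width * exp (- (2 * (rt t * mesh t)))"
    and s4: "t * (1 + ln r / ln t) \<le> real (horizon t) * mesh t"
    and \<nu>: "\<nu> \<in> radon_measures plane" "integrable \<nu> (\<lambda>p. \<psi> (neg_exp (fst p), neg_exp (snd p)))"
    and unit: "\<And>c. c \<in> cells \<Longrightarrow> emeasure \<nu> (cell d c) \<in> {0, 1}"
    and occ: "{c \<in> cells. emeasure \<nu> (cell d c) \<noteq> 0} = occupied t \<omega>"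
  shows "\<bar>integral\<^sup>L (gap_process \<alpha> lam1 N t \<omega>) (\<lambda>p. \<psi> (neg_exp (fst p), neg_exp (snd p))) -
          integral\<^sup>L \<nu> (\<lambda>p. \<psi> (neg_exp (fst p), neg_exp (snd p)))\<bar> \<le> e * real (card (occupied t \<omega>))"
proof -
  let ?f = "\<lambda>p :: ereal \<times> ereal. \<psi> (neg_exp (fst p), neg_exp (snd p))"
  let ?s = "counts t \<omega>"
  let ?p = "\<lambda>k. gap_point \<alpha> lam1 N t \<omega> (N (real (Suc k) * mesh t) \<omega>)"
  let ?U = "\<lambda>k. gap_coord t k ?s" and ?V = "\<lambda>k. time_coord t k"
  define K where "K = {k. k < horizon t \<and> ?s k \<noteq> 0}"
  define K' where "K' = {k \<in> K. ?U k \<le> width}"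
  define \<kappa> where "\<kappa> k = (level d (?U k), level d (?V k))" for k
  have path: "counting_path N \<omega>" using counting_pathI[OF process w] .
  have fK: "finite K" by (simp add: K_def)
  have W: "0 < width" using d D by simp
  have rW: "r \<le> width"
  proof -
    have "width * exp (- (2 * (rt t * mesh t))) \<le> width * 1"
      using W rate_pos[of t] mesh_pos[of t] t by (intro mult_left_mono) auto
    then show ?thesis using s3 by simp
  qed
  have near: "neg_exp (fst (?p k)) \<le> ?U k" "?U k * exp (- (2 * (rt t * mesh t))) \<le> neg_exp (fst (?p k))"
    "neg_exp (snd (?p k)) \<le> ?V k" "?V k * exp (- (mesh t * ln t / t)) \<le> neg_exp (snd (?p k))" if "k \<in> K" for k
    using gap_point_near_grid[OF w t simple, of k] that by (auto simp: K_def)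
  have V_le: "?V k \<le> width" if "k \<in> K" for k
    using time_coord_le_iff[OF t D, of k] that by (simp add: K_def)
  have pos: "0 \<le> ?U k" "0 \<le> ?V k" for k by (simp_all add: gap_coord_def time_coord_def)
  \<comment> \<open>the gap process as a sum over occupied slots; slots with large \<open>u\<close> do not meet the support\<close>
  have "integral\<^sup>L (gap_process \<alpha> lam1 N t \<omega>) ?f = (\<Sum>i | i \<in> epoch_indices N \<omega> \<and> epoch N i \<omega> \<le> real (horizon t) * mesh t. ?f (gap_point \<alpha> lam1 N t \<omega> i))"
  proof (rule integral_gap_process[OF path t r fm])
    fix p assume p: "p \<in> plane" "?f p \<noteq> 0"
    then have "\<not> r \<le> max \<bar>neg_exp (fst p)\<bar> \<bar>neg_exp (snd p)\<bar>"
      using supp[of "(neg_exp (fst p), neg_exp (snd p))"] by auto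
    with p show "p \<in> quadrant r" by (auto simp: quadrant_def)
  qed (use s4 mesh_pos[of t] in auto)
  also have "\<dots> = (\<Sum>k\<in>K. ?f (?p k))"
    unfolding K_def
    by (rule sum.reindex_bij_betw[symmetric, OF bij_betw_slots_epochs[OF path mesh_pos, of ?s t "horizon t"]])
       (use simple in auto)
  also have "\<dots> = (\<Sum>k\<in>K'. ?f (?p k))"
  proof (rule sum.mono_neutral_right[OF fK])
    show "\<forall>k\<in>K - K'. ?f (?p k) = 0"
    proof
      fix k assume k: "k \<in> K - K'"
      have "r \<le> width * exp (- (2 * (rt t * mesh t)))" by (rule s3)
      also have "\<dots> \<le> ?U k * exp (- (2 * (rt t * mesh t)))" using k by (intro mult_right_mono) (auto simp: K'_def)
      also have "\<dots> \<le> neg_exp (fst (?p k))" using near k by simp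
      finally show "?f (?p k) = 0" by (intro supp) simp
    qed
  qed (auto simp: K'_def)
  finally have gap_sum: "integral\<^sup>L (gap_process \<alpha> lam1 N t \<omega>) ?f = (\<Sum>k\<in>K'. ?f (?p k))" .
  \<comment> \<open>since no cell is hit twice, the remaining slots correspond to the occupied cells\<close>
  have \<kappa>_cells: "\<kappa> k \<in> cells" if "k \<in> K'" for k
    using that V_le[of k] pos[of k] level_less_iff[OF d, of "?U k" D] level_less_iff[OF d, of "?V k" D] D
    by (auto simp: \<kappa>_def K'_def)
  have \<kappa>_hit: "hit t (\<kappa> k) k ?s" if "k \<in> K'" for k using that by (auto simp: hit_def \<kappa>_def K'_def K_def)
  have bij: "bij_betw \<kappa> K' (occupied t \<omega>)"
    unfolding bij_betw_def
  proof
    show "inj_on \<kappa> K'"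
    proof (rule inj_onI)
      fix j k assume jk: "j \<in> K'" "k \<in> K'" "\<kappa> j = \<kappa> k"
      show "j = k"
        using single[OF \<kappa>_cells[OF jk(1)], of k j] single[OF \<kappa>_cells[OF jk(1)], of j k] \<kappa>_hit[OF jk(1)] \<kappa>_hit[OF jk(2)] jk
        by (cases j k rule: linorder_cases) (auto simp: K'_def K_def)
    qed
    show "\<kappa> ` K' = occupied t \<omega>"
    proof (intro equalityI subsetI)
      fix c assume "c \<in> \<kappa> ` K'"
      then obtain k where "k \<in> K'" "c = \<kappa> k" by auto
      then show "c \<in> occupied t \<omega>" using \<kappa>_cells[of k] \<kappa>_hit[of k] by (auto simp: occupied_def K'_def K_def)
    next
      fix c assume "c \<in> occupied t \<omega>"
      then obtain k where c: "c \<in> cells" and k: "k < horizon t" "hit t c k ?s" by (auto simp: occupied_def)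
      have "level d (?U k) < D" using c k(2) by (auto simp: hit_def)
      then have "?U k \<le> width" using level_less_iff[OF d pos(1), of k D] by simp
      then have "k \<in> K'" using k by (auto simp: K'_def K_def hit_def)
      moreover have "c = \<kappa> k" using k(2) by (simp add: hit_def \<kappa>_def prod_eq_iff)
      ultimately show "c \<in> \<kappa> ` K'" by simp
    qed
  qed
  have sets_\<nu>: "sets \<nu> = sets (restrict_space borel plane)" using \<nu>(1) by (simp add: radon_measures_def)
  have space_\<nu>: "space \<nu> = plane" using sets_eq_imp_space_eq[OF sets_\<nu>] by (simp add: space_restrict_space)
  have cell_\<nu>: "cell d c \<in> sets \<nu>" for c using cell_sets[OF d] sets_\<nu> by simp
  have int_cell: "integrable \<nu> (\<lambda>q. indicator (cell d c) q * ?f q)" for c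
    using integrable_mult_indicator[OF cell_\<nu> \<nu>(2)] by simp
  have "integral\<^sup>L \<nu> ?f = (\<integral>q. (\<Sum>c\<in>cells. indicator (cell d c) q * ?f q) \<partial>\<nu>)"
  proof (rule Bochner_Integration.integral_cong[OF refl])
    fix q assume "q \<in> space \<nu>"
    then have q: "q \<in> plane" by (simp add: space_\<nu>)
    show "?f q = (\<Sum>c\<in>cells. indicator (cell d c) q * ?f q)"
    proof (cases "?f q = 0")
      case False
      then have "\<not> r \<le> max \<bar>neg_exp (fst q)\<bar> \<bar>neg_exp (snd q)\<bar>"
        using supp[of "(neg_exp (fst q), neg_exp (snd q))"] by auto
      then have "neg_exp (fst q) \<le> width" "neg_exp (snd q) \<le> width" using rW by auto
      then have "q \<in> quadrant width" using q by (simp add: quadrant_def)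
      then obtain c0 where c0: "c0 \<in> cells" "q \<in> cell d c0" using Union_cells[OF d D] by blast
      have "q \<notin> cell d c" if "c \<noteq> c0" for c using that c0(2) by (auto simp: cell_def prod_eq_iff)
      then have "(\<Sum>c\<in>cells. indicator (cell d c) q * ?f q) = (\<Sum>c\<in>cells. if c = c0 then ?f q else 0)"
        using c0 by (intro sum.cong) auto
      then show ?thesis using c0 by simp
    qed simp
  qed
  also have "\<dots> = (\<Sum>c\<in>cells. \<integral>q. indicator (cell d c) q * ?f q \<partial>\<nu>)"
    using int_cell by (intro Bochner_Integration.integral_sum) auto
  also have "\<dots> = (\<Sum>c\<in>occupied t \<omega>. \<integral>q. indicator (cell d c) q * ?f q \<partial>\<nu>)"
  proof (rule sum.mono_neutral_right)
    show "\<forall>c\<in>cells - occupied t \<omega>. (\<integral>q. indicator (cell d c) q * ?f q \<partial>\<nu>) = 0"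
    proof
      fix c assume "c \<in> cells - occupied t \<omega>"
      then have "emeasure \<nu> (cell d c) = 0" using occ by blast
      then have "AE q in \<nu>. q \<notin> cell d c" using cell_\<nu> by (intro AE_not_in) (auto simp: null_sets_def)
      then have "AE q in \<nu>. indicator (cell d c) q * ?f q = 0" by eventually_elim auto
      then show "(\<integral>q. indicator (cell d c) q * ?f q \<partial>\<nu>) = 0" by (rule integral_eq_zero_AE)
    qed
  qed (auto simp: occupied_def)
  also have "\<dots> = (\<Sum>k\<in>K'. \<integral>q. indicator (cell d (\<kappa> k)) q * ?f q \<partial>\<nu>)"
    by (rule sum.reindex_bij_betw[symmetric, OF bij])
  finally have \<nu>_sum: "integral\<^sup>L \<nu> ?f = (\<Sum>k\<in>K'. \<integral>q. indicator (cell d (\<kappa> k)) q * ?f q \<partial>\<nu>)" .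
  have one: "\<bar>(\<integral>q. indicator (cell d (\<kappa> k)) q * ?f q \<partial>\<nu>) - ?f (?p k)\<bar> \<le> e" if k: "k \<in> K'" for k
  proof (rule unit_mass_integral_close[OF cell_\<nu> _ \<nu>(2)])
    have "\<kappa> k \<in> occupied t \<omega>" using bij k by (auto simp: bij_betw_def)
    then show "emeasure \<nu> (cell d (\<kappa> k)) = 1" using occ unit \<kappa>_cells[OF k] by blast
    fix q assume q: "q \<in> cell d (\<kappa> k)"
    have kK: "k \<in> K" and UW: "?U k \<le> width" using k by (auto simp: K'_def)
    have qU: "\<bar>neg_exp (fst q) - ?U k\<bar> \<le> d" using q by (intro level_close[OF d]) (auto simp: cell_def \<kappa>_def pos)
    have qV: "\<bar>neg_exp (snd q) - ?V k\<bar> \<le> d" using q by (intro level_close[OF d]) (auto simp: cell_def \<kappa>_def pos)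
    have qW: "neg_exp (fst q) \<le> width" "neg_exp (snd q) \<le> width"
      using q \<kappa>_cells[OF k] level_less_iff[OF d, of "neg_exp (fst q)" D] level_less_iff[OF d, of "neg_exp (snd q)" D]
      by (auto simp: cell_def)
    have pU: "\<bar>?U k - neg_exp (fst (?p k))\<bar> \<le> \<delta> / 2"
    proof -
      have "?U k - neg_exp (fst (?p k)) \<le> ?U k * (1 - exp (- (2 * (rt t * mesh t))))"
        using near(2)[OF kK] by (simp add: algebra_simps)
      also have "\<dots> \<le> width * (1 - exp (- (2 * (rt t * mesh t))))"
        using UW rate_pos[of t] mesh_pos[of t] t by (intro mult_right_mono) auto
      finally show ?thesis using s1 near(1)[OF kK] by simp
    qed
    have pV: "\<bar>?V k - neg_exp (snd (?p k))\<bar> \<le> \<delta> / 2"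
    proof -
      have "?V k - neg_exp (snd (?p k)) \<le> ?V k * (1 - exp (- (mesh t * ln t / t)))"
        using near(4)[OF kK] by (simp add: algebra_simps)
      also have "\<dots> \<le> width * (1 - exp (- (mesh t * ln t / t)))"
        using V_le[OF kK] mesh_pos[of t] t by (intro mult_right_mono) auto
      finally show ?thesis using s2 near(3)[OF kK] by simp
    qed
    show "\<bar>?f q - ?f (?p k)\<bar> \<le> e"
    proof (rule modulus)
      show "\<bar>neg_exp (fst q) - neg_exp (fst (?p k))\<bar> \<le> \<delta>" using qU pU d\<delta> by linarith
      show "\<bar>neg_exp (snd q) - neg_exp (snd (?p k))\<bar> \<le> \<delta>" using qV pV d\<delta> by linarith
      show "{neg_exp (fst q), neg_exp (snd q), neg_exp (fst (?p k)), neg_exp (snd (?p k))} \<subseteq> {0..width}"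
        using qW near(1,3)[OF kK] UW V_le[OF kK] by auto
    qed
  qed
  have "\<bar>integral\<^sup>L (gap_process \<alpha> lam1 N t \<omega>) ?f - integral\<^sup>L \<nu> ?f\<bar> =
      \<bar>\<Sum>k\<in>K'. ?f (?p k) - (\<integral>q. indicator (cell d (\<kappa> k)) q * ?f q \<partial>\<nu>)\<bar>"
    unfolding gap_sum \<nu>_sum sum_subtractf ..
  also have "\<dots> \<le> (\<Sum>k\<in>K'. \<bar>?f (?p k) - (\<integral>q. indicator (cell d (\<kappa> k)) q * ?f q \<partial>\<nu>)\<bar>)" by (rule sum_abs)
  also have "\<dots> \<le> (\<Sum>k\<in>K'. e)" using one by (intro sum_mono) (simp add: abs_minus_commute)
  also have "\<dots> = e * real (card (occupied t \<omega>))" using bij_betw_same_card[OF bij] by simp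
  finally show ?thesis .
qed

end

lemma uniform_modulus:
  fixes \<psi> :: "nat \<Rightarrow> real \<times> real \<Rightarrow> real"
  assumes cont: "\<And>j. continuous_on UNIV (\<psi> j)" and e: "0 < e"
  obtains \<delta> where "0 < \<delta>" "\<And>j u v u' v'. j < n \<Longrightarrow> {u, v, u', v'} \<subseteq> {0..R} \<Longrightarrow> \<bar>u - u'\<bar> \<le> \<delta> \<Longrightarrow> \<bar>v - v'\<bar> \<le> \<delta> \<Longrightarrow>
      \<bar>\<psi> j (u, v) - \<psi> j (u', v')\<bar> \<le> e"
proof -
  have "\<exists>\<delta>>0. \<forall>u v u' v'. {u, v, u', v'} \<subseteq> {0..R} \<longrightarrow> \<bar>u - u'\<bar> \<le> \<delta> \<longrightarrow> \<bar>v - v'\<bar> \<le> \<delta> \<longrightarrow> \<bar>\<psi> j (u, v) - \<psi> j (u', v')\<bar> \<le> e" for j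
  proof -
    have "compact ({0..R} \<times> {0..R})" by (intro compact_Times) auto
    then have "uniformly_continuous_on ({0..R} \<times> {0..R}) (\<psi> j)"
      by (rule compact_uniformly_continuous[rotated]) (rule continuous_on_subset[OF cont], simp)
    then obtain r where r: "0 < r" "\<And>x y. x \<in> {0..R} \<times> {0..R} \<Longrightarrow> y \<in> {0..R} \<times> {0..R} \<Longrightarrow> dist y x < r \<Longrightarrow> dist (\<psi> j y) (\<psi> j x) < e"
      unfolding uniformly_continuous_on_def using e by blast
    have "\<bar>\<psi> j (u, v) - \<psi> j (u', v')\<bar> \<le> e" if "{u, v, u', v'} \<subseteq> {0..R}" "\<bar>u - u'\<bar> \<le> r / 3" "\<bar>v - v'\<bar> \<le> r / 3" for u v u' v'
    proof -
      have "dist (u, v) (u', v') \<le> dist u u' + dist v v'"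
        unfolding dist_Pair_Pair by (rule sqrt_sum_squares_le_sum) auto
      then have "dist (u, v) (u', v') < r" using that r(1) by (simp add: dist_real_def)
      then show ?thesis using r(2)[of "(u', v')" "(u, v)"] that(1) by (simp add: dist_real_def less_imp_le)
    qed
    then show ?thesis using r(1) by (intro exI[of _ "r/3"]) auto
  qed
  then obtain \<delta> where \<delta>: "\<And>j. 0 < \<delta> j" "\<And>j u v u' v'. {u, v, u', v'} \<subseteq> {0..R} \<Longrightarrow> \<bar>u - u'\<bar> \<le> \<delta> j \<Longrightarrow> \<bar>v - v'\<bar> \<le> \<delta> j \<Longrightarrow> \<bar>\<psi> j (u, v) - \<psi> j (u', v')\<bar> \<le> e"
    by metis
  define d where "d = Min (insert 1 (\<delta> ` {..<n}))"
  have "0 < d" unfolding d_def using \<delta>(1) by (subst Min_gr_iff) auto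
  moreover have "d \<le> \<delta> j" if "j < n" for j unfolding d_def using that by (intro Min_le) auto
  then have "\<bar>\<psi> j (u, v) - \<psi> j (u', v')\<bar> \<le> e"
    if "j < n" "{u, v, u', v'} \<subseteq> {0..R}" "\<bar>u - u'\<bar> \<le> d" "\<bar>v - v'\<bar> \<le> d" for j u v u' v'
    using that by (intro \<delta>(2)[OF that(2)] order_trans[OF that(3)] order_trans[OF that(4)])
  ultimately show ?thesis by (rule that)
qed

context poisson_gaps
begin

text \<open>
  Shrinking \<open>V\<close> to a closed set that is stable under small changes of finitely many
  integrals turns the event for the limit into one that can be read off, up to small
  probability, from the nonempty cells of a fine grid; its probability is then the limit of the
  corresponding probabilities for the gap process.
\<close>

lemma open_set_lower_bound:
  fixes M' :: "'b measure" and \<xi> :: "'b \<Rightarrow> (ereal \<times> ereal) measure"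
  assumes ppp: "poisson_point_process M' plane (limit_intensity \<alpha>) \<xi>"
    and V: "openin (vague_topology plane) V" and e: "0 < e"
  shows "\<forall>\<^sub>F t in at_top. measure M' {\<omega> \<in> space M'. \<xi> \<omega> \<in> V} - e \<le> prob {\<omega> \<in> space M. gap_process \<alpha> lam1 N t \<omega> \<in> V}"
proof -
  interpret M': prob_space M' using ppp by (simp add: poisson_point_process_def)
  have \<xi>m: "\<xi> \<in> measurable M' (borel_of_topology (vague_topology plane))"
    using ppp by (simp add: poisson_point_process_def)
  have \<xi>r: "\<xi> \<omega> \<in> radon_measures plane" if "\<omega> \<in> space M'" for \<omega>
    using measurable_space[OF \<xi>m that] by (simp add: topspace_vague_topology)
  define \<eta> where "\<eta> = e / 8"
  have \<eta>: "0 < \<eta>" using e by (simp add: \<eta>_def)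
  \<comment> \<open>\<open>V\<close> is exhausted by closed conditions that are stable in finitely many probes\<close>
  obtain G where G: "open G" "V = {\<nu> \<in> radon_measures plane. probe_integrals \<nu> \<in> G}"
    using openin_vague_topology_pullback[OF V] by blast
  obtain F where F: "\<And>n. closed (F n)" "incseq F" "G = (\<Union>n. F n)"
    "\<And>n v w. v \<in> F n \<Longrightarrow> (\<And>j. j < n \<Longrightarrow> \<bar>w j - v j\<bar> < 1 / (real n + 1)) \<Longrightarrow> w \<in> G"
    using open_eq_Union_stable[OF G(1)] by blast
  let ?F = "\<lambda>n. {\<omega> \<in> space M'. probe_integrals (\<xi> \<omega>) \<in> F n}"
  have pm: "(\<lambda>\<omega>. probe_integrals (\<xi> \<omega>)) \<in> borel_measurable M'"
    by (rule measurable_compose[OF \<xi>m measurable_probe_integrals])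
  have Fev: "?F n \<in> sets M'" for n
    using measurable_sets[OF pm, of "F n"] F(1) by (simp add: vimage_def Int_def conj_commute borel_closed)
  have "(\<lambda>n. M'.prob (?F n)) \<longlonglongrightarrow> M'.prob (\<Union>n. ?F n)"
    using Fev F(2) by (intro M'.finite_Lim_measure_incseq) (auto simp: incseq_def)
  also have "(\<Union>n. ?F n) = {\<omega> \<in> space M'. \<xi> \<omega> \<in> V}"
    using \<xi>r unfolding G(2) F(3) by auto
  finally have "\<forall>\<^sub>F n in sequentially. M'.prob {\<omega> \<in> space M'. \<xi> \<omega> \<in> V} - \<eta> < M'.prob (?F n)"
    using \<eta> by (intro order_tendstoD(1)) auto
  then obtain n where n: "M'.prob {\<omega> \<in> space M'. \<xi> \<omega> \<in> V} - \<eta> < M'.prob (?F n)"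
    by (auto simp: eventually_sequentially)
  \<comment> \<open>The box is larger by \<open>1\<close> than the supports, so that points which the time grid moves out of
     it lie outside the supports.\<close>
  obtain \<rho> :: "nat \<Rightarrow> nat" where \<rho>: "\<And>j w. real (\<rho> j) \<le> max \<bar>fst w\<bar> \<bar>snd w\<bar> \<Longrightarrow> cut_monomial j w = 0"
    using cut_monomial_support by metis
  define r where "r = real (Max (insert 1 (\<rho> ` {..<n})))"
  define R where "R = r + 1"
  have r: "0 < r" "\<And>j. j < n \<Longrightarrow> real (\<rho> j) \<le> r"
    unfolding r_def by (auto simp: Max_gr_iff intro!: Max_ge)
  have R: "0 < R" using r by (simp add: R_def)
  have supp: "cut_monomial j w = 0" if "j < n" "r \<le> max \<bar>fst w\<bar> \<bar>snd w\<bar>" for j w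
    using that r(2)[of j] by (intro \<rho>) linarith
  have Qs: "quadrant R \<in> sets (restrict_space borel plane)" by (simp add: quadrant_eq quadrant2_sets)
  have Qm: "(\<lambda>\<omega>. emeasure (\<xi> \<omega>) (quadrant R)) \<in> borel_measurable M'"
    using ppp_emeasure_measurable[OF ppp \<alpha> zero_less_one Qs] .
  obtain C :: nat where C: "M'.prob {\<omega> \<in> space M'. \<not> emeasure (\<xi> \<omega>) (quadrant R) \<le> of_nat C} < \<eta>"
    using ppp_tight[OF ppp R \<eta> Qm] .
  \<comment> \<open>\<open>\<epsilon>\<close> leaves room for \<open>C\<close> points; the last bound on \<open>D\<close> makes cells with two points unlikely\<close>
  define \<epsilon> where "\<epsilon> = 1 / (2 * (real n + 1) * (real C + 1))"
  have \<epsilon>: "0 < \<epsilon>" by (simp add: \<epsilon>_def)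
  obtain \<delta> where \<delta>: "0 < \<delta>" "\<And>j u v u' v'. j < n \<Longrightarrow> {u, v, u', v'} \<subseteq> {0..R} \<Longrightarrow> \<bar>u - u'\<bar> \<le> \<delta> \<Longrightarrow> \<bar>v - v'\<bar> \<le> \<delta> \<Longrightarrow>
      \<bar>cut_monomial j (u, v) - cut_monomial j (u', v')\<bar> \<le> \<epsilon>"
  proof (rule uniform_modulus[where \<psi> = cut_monomial and n = n and R = R, OF continuous_cut_monomial \<epsilon>])
    fix \<delta> assume "0 < \<delta>" "\<And>j u v u' v'. j < n \<Longrightarrow> {u, v, u', v'} \<subseteq> {0..R} \<Longrightarrow> \<bar>u - u'\<bar> \<le> \<delta> \<Longrightarrow> \<bar>v - v'\<bar> \<le> \<delta> \<Longrightarrow>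
      \<bar>cut_monomial j (u, v) - cut_monomial j (u', v')\<bar> \<le> \<epsilon>"
    then show thesis by (rule that)
  qed
  define c0 where "c0 = R * (R powr (\<alpha> * (1 - \<alpha>)))\<^sup>2"
  have c0: "0 \<le> c0" using R by (simp add: c0_def)
  obtain D where Dp: "0 < D" "R / real D \<le> \<delta> / 2" "R / real D * c0 \<le> \<eta>"
  proof -
    have "(\<lambda>D. R / real D) \<longlonglongrightarrow> 0" by real_asymp
    then have "\<forall>\<^sub>F D in sequentially. R / real D < min (\<delta> / 2) (\<eta> / (c0 + 1))"
      using \<delta>(1) \<eta> c0 by (intro order_tendstoD(2)) auto
    from eventually_conj[OF this eventually_gt_at_top[of 0]]
    obtain D where D: "R / real D < min (\<delta> / 2) (\<eta> / (c0 + 1))" "0 < D"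
      by (auto simp: eventually_sequentially)
    have "R / real D * c0 \<le> \<eta> / (c0 + 1) * (c0 + 1)"
      using D R c0 \<eta> by (intro mult_mono) auto
    also have "\<dots> = \<eta>" using c0 by simp
    finally show ?thesis using D that by auto
  qed
  define d where "d = R / real D"
  have dp: "0 < d" "real D * d = R" using R Dp by (auto simp: d_def)
  interpret gap_grid \<alpha> lam1 M N d D by unfold_locales (use dp Dp in auto)
  have mass: "(\<Sum>c\<in>cells. (cell_mass \<alpha> d c)\<^sup>2) \<le> \<eta>"
    using sum_cell_mass_square[OF \<alpha> dp(1), of D] Dp(3) unfolding dp(2) c0_def by (simp add: d_def)
  \<comment> \<open>the sets of nonempty cells compatible with the closed condition\<close>
  let ?J = "\<lambda>\<nu>. {c \<in> cells. emeasure \<nu> (cell d c) \<noteq> 0}"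
  let ?unit = "\<lambda>\<nu>. \<forall>c\<in>cells. emeasure \<nu> (cell d c) \<in> {0, 1}"
  define A where "A = {J \<in> Pow cells. card J \<le> C \<and> (\<exists>\<nu>\<in>radon_measures plane. probe_integrals \<nu> \<in> F n \<and> ?unit \<nu> \<and> ?J \<nu> = J)}"
  have cm: "(\<lambda>\<omega>. emeasure (\<xi> \<omega>) (cell d c)) \<in> borel_measurable M'" for c
    by (rule ppp_emeasure_measurable[OF ppp \<alpha> dp(1) cell_sets[OF dp(1)]])
  have J_ev: "{\<omega> \<in> space M'. c \<in> ?J (\<xi> \<omega>)} \<in> sets M'" for c
  proof (cases "c \<in> cells")
    case True
    have "{\<omega> \<in> space M'. emeasure (\<xi> \<omega>) (cell d c) \<noteq> 0} \<in> sets M'" using cm[of c] by measurable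
    then show ?thesis using True by simp
  next
    case False
    then show ?thesis by simp
  qed
  have law: "((\<lambda>t. prob {\<omega> \<in> space M. occupied t \<omega> \<in> A}) \<longlongrightarrow> M'.prob {\<omega> \<in> space M'. ?J (\<xi> \<omega>) \<in> A}) at_top"
  proof (rule random_set_law_tendsto[OF prob_space_axioms M'.prob_space_axioms, of cells])
    fix U assume U: "U \<subseteq> cells"
    then have fU: "finite U" using finite_subset by auto
    have "{\<omega> \<in> space M. occupied t \<omega> \<inter> U = {}} = {\<omega> \<in> space M. \<forall>k<horizon t. \<forall>c\<in>U. \<not> hit t c k (counts t \<omega>)}" for t
      using U by (auto simp: occupied_def)
    moreover have "{\<omega> \<in> space M'. ?J (\<xi> \<omega>) \<inter> U = {}} = {\<omega> \<in> space M'. \<forall>c\<in>U. emeasure (\<xi> \<omega>) (cell d c) = 0}"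
      using U by blast
    ultimately show "((\<lambda>t. prob {\<omega> \<in> space M. occupied t \<omega> \<inter> U = {}}) \<longlongrightarrow> M'.prob {\<omega> \<in> space M'. ?J (\<xi> \<omega>) \<inter> U = {}}) at_top"
      using void_limit[OF U] ppp_void[OF ppp \<alpha> dp(1) fU] by simp
  next
    show "finite cells" by simp
    show "occupied t \<omega> \<subseteq> cells" for t \<omega> unfolding occupied_def by (rule Collect_restrict)
    show "?J (\<xi> \<omega>) \<subseteq> cells" for \<omega> by (rule Collect_restrict)
    show "A \<subseteq> Pow cells" unfolding A_def by (rule Collect_restrict)
    show "{\<omega> \<in> space M. c \<in> occupied t \<omega>} \<in> events" for t c by (rule occupied_event)
    show "{\<omega> \<in> space M'. c \<in> ?J (\<xi> \<omega>)} \<in> M'.events" for c by (rule J_ev)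
  qed
  \<comment> \<open>off two unlikely events, the closed condition puts the set of nonempty cells into \<open>A\<close>\<close>
  let ?bad1 = "{\<omega> \<in> space M'. \<exists>c\<in>cells. emeasure (\<xi> \<omega>) (cell d c) \<notin> {0, 1}}"
  let ?bad2 = "{\<omega> \<in> space M'. \<not> emeasure (\<xi> \<omega>) (quadrant R) \<le> of_nat C}"
  let ?seen = "{\<omega> \<in> space M'. ?J (\<xi> \<omega>) \<in> A}"
  have bad1_ev: "?bad1 \<in> sets M'"
  proof -
    have "?bad1 = (\<Union>c\<in>cells. {\<omega> \<in> space M'. emeasure (\<xi> \<omega>) (cell d c) \<notin> {0, 1}})" by auto
    also have "\<dots> \<in> sets M'" using cm by (intro sets.finite_UN) auto
    finally show ?thesis .
  qed
  have bad2_ev: "?bad2 \<in> sets M'" using Qm by measurable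
  have seen_ev: "?seen \<in> sets M'"
  proof (rule M'.prob_random_set_mem(1)[where I=cells])
    show "?J (\<xi> \<omega>) \<subseteq> cells" for \<omega> by (rule Collect_restrict)
    show "A \<subseteq> Pow cells" unfolding A_def by (rule Collect_restrict)
    show "{\<omega> \<in> space M'. c \<in> ?J (\<xi> \<omega>)} \<in> M'.events" for c by (rule J_ev)
  qed simp
  have "?F n \<subseteq> ?seen \<union> (?bad1 \<union> ?bad2)"
  proof (rule subsetI, rule ccontr)
    fix \<omega> assume w: "\<omega> \<in> ?F n" and bad: "\<omega> \<notin> ?seen \<union> (?bad1 \<union> ?bad2)"
    have \<omega>: "\<omega> \<in> space M'" using w by auto
    have unit: "?unit (\<xi> \<omega>)" and le: "emeasure (\<xi> \<omega>) (quadrant R) \<le> of_nat C" using bad \<omega> by auto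
    have s: "sets (\<xi> \<omega>) = sets (restrict_space borel plane)" using \<xi>r[OF \<omega>] by (simp add: radon_measures_def)
    have "of_nat (card (?J (\<xi> \<omega>))) = (\<Sum>c\<in>?J (\<xi> \<omega>). (1 :: ennreal))" by simp
    also have "\<dots> = (\<Sum>c\<in>?J (\<xi> \<omega>). emeasure (\<xi> \<omega>) (cell d c))" using unit by (intro sum.cong) auto
    also have "\<dots> = emeasure (\<xi> \<omega>) (\<Union>c\<in>?J (\<xi> \<omega>). cell d c)"
      using cell_sets[OF dp(1)] s disjoint_cells by (intro sum_emeasure) auto
    also have "\<dots> \<le> emeasure (\<xi> \<omega>) (quadrant R)"
      using Union_cells[OF dp(1) Dp(1)] Qs s unfolding dp(2) by (intro emeasure_mono) auto
    also have "\<dots> \<le> of_nat C" by (rule le)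
    finally have "card (?J (\<xi> \<omega>)) \<le> C" by simp
    then have "?J (\<xi> \<omega>) \<in> A" unfolding A_def using w unit \<xi>r[OF \<omega>] by blast
    then show False using bad \<omega> by blast
  qed
  then have "M'.prob (?F n) \<le> M'.prob (?seen \<union> (?bad1 \<union> ?bad2))"
    by (rule M'.finite_measure_mono) (intro sets.Un seen_ev bad1_ev bad2_ev)
  also have "\<dots> \<le> M'.prob ?seen + M'.prob (?bad1 \<union> ?bad2)"
    by (intro measure_Un_le sets.Un seen_ev bad1_ev bad2_ev)
  also have "M'.prob (?bad1 \<union> ?bad2) \<le> M'.prob ?bad1 + M'.prob ?bad2"
    by (intro measure_Un_le bad1_ev bad2_ev)
  finally have seen: "M'.prob (?F n) \<le> M'.prob ?seen + 2 * \<eta>"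
    using ppp_not_simple[OF ppp \<alpha> dp(1), of cells] mass C by simp
  \<comment> \<open>what is needed of \<open>t\<close>: the law on the grid is close, and the errors of the time grid are small\<close>
  have ev_law: "\<forall>\<^sub>F t in at_top. M'.prob ?seen - \<eta> < prob {\<omega> \<in> space M. occupied t \<omega> \<in> A}"
    using law \<eta> by (intro order_tendstoD(1)) auto
  have ev_crowded: "\<forall>\<^sub>F t in at_top. prob {\<omega> \<in> space M. \<exists>k<horizon t. 2 \<le> counts t \<omega> k} < \<eta>"
    using crowded_limit \<eta> by (rule order_tendstoD(2))
  have ev_double: "\<forall>\<^sub>F t in at_top. prob {\<omega> \<in> space M. \<exists>c\<in>cells. \<exists>k<horizon t. \<exists>j<k. hit t c j (counts t \<omega>) \<and> hit t c k (counts t \<omega>)} < 2 * \<eta>"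
    using double_hit_limit[OF \<eta>] by eventually_elim (use mass in linarith)
  have "((\<lambda>t. R * (1 - exp (- (2 * (rt t * mesh t))))) \<longlongrightarrow> R * (1 - exp (- (2 * 0)))) at_top"
    by (intro tendsto_intros mesh_rate_limit)
  then have ev1: "\<forall>\<^sub>F t in at_top. R * (1 - exp (- (2 * (rt t * mesh t)))) < \<delta> / 2"
    using \<delta>(1) by (intro order_tendstoD(2)) auto
  have "((\<lambda>t. R * (1 - exp (- (mesh t * ln t / t)))) \<longlongrightarrow> R * (1 - exp (- 0))) at_top"
    by (intro tendsto_intros mesh_ln_limit)
  then have ev2: "\<forall>\<^sub>F t in at_top. R * (1 - exp (- (mesh t * ln t / t))) < \<delta> / 2"
    using \<delta>(1) by (intro order_tendstoD(2)) auto
  have "((\<lambda>t. R * exp (- (2 * (rt t * mesh t)))) \<longlongrightarrow> R * exp (- (2 * 0))) at_top"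
    by (intro tendsto_intros mesh_rate_limit)
  then have ev3: "\<forall>\<^sub>F t in at_top. r < R * exp (- (2 * (rt t * mesh t)))"
    by (intro order_tendstoD(1)) (auto simp: R_def)
  have ev4: "\<forall>\<^sub>F t in at_top. t * (1 + ln r / ln t) \<le> real (horizon t) * mesh t"
  proof -
    have "ln r < ln R" using r by (simp add: R_def)
    then have "\<forall>\<^sub>F t in at_top. (t - real (horizon t) * mesh t) / t * ln t < - ln r"
      using slots_before_limit[of D] unfolding dp(2) by (intro order_tendstoD(2)) auto
    then show ?thesis using eventually_gt_at_top[of 1]
    proof eventually_elim
      case (elim t)
      then have "0 < ln t" by simp
      then have "(t - real (horizon t) * mesh t) / t < - ln r / ln t" using elim(1) by (simp only: pos_less_divide_eq)
      then have "t - real (horizon t) * mesh t < - ln r / ln t * t" using elim(2) by (simp only: pos_divide_less_eq)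
      then show ?case by (simp add: algebra_simps)
    qed
  qed
  show ?thesis
    using ev_law ev_crowded ev_double ev1 ev2 ev3 ev4 eventually_gt_at_top[of 1]
  proof eventually_elim
    case (elim t)
    let ?occ = "{\<omega> \<in> space M. occupied t \<omega> \<in> A}"
    let ?crowded = "{\<omega> \<in> space M. \<exists>k<horizon t. 2 \<le> counts t \<omega> k}"
    let ?double = "{\<omega> \<in> space M. \<exists>c\<in>cells. \<exists>k<horizon t. \<exists>j<k. hit t c j (counts t \<omega>) \<and> hit t c k (counts t \<omega>)}"
    let ?gap = "{\<omega> \<in> space M. gap_process \<alpha> lam1 N t \<omega> \<in> V}"
    have crowded_ev: "?crowded \<in> events"
    proof -
      have "?crowded = (\<Union>k<horizon t. {\<omega> \<in> space M. 2 \<le> slot_count N (mesh t) k \<omega>})" by auto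
      also have "\<dots> \<in> events" using slot_count_measurable[OF mesh_pos] by (intro sets.finite_UN) auto
      finally show ?thesis .
    qed
    have double_ev: "?double \<in> events"
    proof -
      have "?double = (\<Union>c\<in>cells. \<Union>k<horizon t. \<Union>j<k. {\<omega> \<in> space M. hit t c j (counts t \<omega>)} \<inter> {\<omega> \<in> space M. hit t c k (counts t \<omega>)})"
        by blast
      also have "\<dots> \<in> events" by (intro sets.finite_UN sets.Int hit_event elim(8)) auto
      finally show ?thesis .
    qed
    have gap_ev: "?gap \<in> events"
      using measurable_sets[OF gap_process_measurable[OF process elim(8)] openin_sets_borel_of_topology[OF V]]
      by (simp add: vimage_def Int_def conj_commute)
    have "?occ \<subseteq> ?gap \<union> (?crowded \<union> ?double)"
    proof (rule subsetI, rule ccontr)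
      fix \<omega> assume occ: "\<omega> \<in> ?occ" and bad: "\<omega> \<notin> ?gap \<union> (?crowded \<union> ?double)"
      have w: "\<omega> \<in> space M" using occ by simp
      have simple: "counts t \<omega> k \<le> 1" if "k < horizon t" for k using bad w that by force
      have single: "\<not> hit t c k (counts t \<omega>)" if "c \<in> cells" "k < horizon t" "j < k" "hit t c j (counts t \<omega>)" for c j k
        using bad w that by blast
      from occ obtain \<nu> where \<nu>: "\<nu> \<in> radon_measures plane" "probe_integrals \<nu> \<in> F n" "?unit \<nu>" "?J \<nu> = occupied t \<omega>"
        and card: "card (occupied t \<omega>) \<le> C" by (auto simp: A_def)
      have close: "\<bar>probe_integrals (gap_process \<alpha> lam1 N t \<omega>) j - probe_integrals \<nu> j\<bar> < 1 / (real n + 1)" if j: "j < n" for j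
      proof -
        have pj: "probe j = (\<lambda>p. cut_monomial j (neg_exp (fst p), neg_exp (snd p)))" by (simp add: probe_def fun_eq_iff)
        have "continuous_on plane (probe j)" using probe_test_function[of j] by (simp add: test_functions_def)
        then have fm: "(\<lambda>p. cut_monomial j (neg_exp (fst p), neg_exp (snd p))) \<in> borel_measurable (restrict_space borel plane)"
          unfolding pj by (rule borel_measurable_continuous_on_restrict)
        have int: "integrable \<nu> (\<lambda>p. cut_monomial j (neg_exp (fst p), neg_exp (snd p)))"
          using integrable_test_function[OF \<nu>(1) probe_test_function[of j]] unfolding pj .
        have "\<bar>probe_integrals (gap_process \<alpha> lam1 N t \<omega>) j - probe_integrals \<nu> j\<bar> \<le> \<epsilon> * real (card (occupied t \<omega>))"
          unfolding probe_integrals_def pj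
        proof (rule integral_close[where \<delta> = \<delta> and \<psi> = "cut_monomial j", OF w elim(8) simple single r(1) supp[OF j] _ fm _ _ _ _ _ \<nu>(1) int _ \<nu>(4)])
          show "\<bar>cut_monomial j (u, v) - cut_monomial j (u', v')\<bar> \<le> \<epsilon>"
            if "{u, v, u', v'} \<subseteq> {0..width}" "\<bar>u - u'\<bar> \<le> \<delta>" "\<bar>v - v'\<bar> \<le> \<delta>" for u v u' v'
            using \<delta>(2)[OF j] that unfolding dp(2) by blast
          show "d \<le> \<delta> / 2" using Dp(2) by (simp add: d_def)
        qed (use elim \<nu>(3) in \<open>auto simp: dp(2) less_imp_le\<close>)
        also have "\<dots> \<le> \<epsilon> * real C" using card \<epsilon> by (intro mult_left_mono) auto
        also have "\<dots> < 1 / (real n + 1)"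
        proof -
          have "real C * (real n + 1) \<le> (real C + 1) * (real n + 1)" by (intro mult_right_mono) auto
          also have "\<dots> < 2 * ((real C + 1) * (real n + 1))" by (simp add: add_nonneg_pos)
          finally have "real C * (real n + 1) < 2 * (real n + 1) * (real C + 1)" by (simp only: mult_ac)
          then show ?thesis unfolding \<epsilon>_def by (simp add: divide_simps)
        qed
        finally show ?thesis .
      qed
      have "probe_integrals (gap_process \<alpha> lam1 N t \<omega>) \<in> G"
        using F(4)[OF \<nu>(2)] close by blast
      moreover have "gap_process \<alpha> lam1 N t \<omega> \<in> radon_measures plane"
        by (rule gap_process_radon[OF counting_pathI[OF process w] elim(8)])
      ultimately show False using bad w unfolding G(2) by blast
    qed
    then have "prob ?occ \<le> prob (?gap \<union> (?crowded \<union> ?double))"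
      by (rule finite_measure_mono) (intro sets.Un gap_ev crowded_ev double_ev)
    also have "\<dots> \<le> prob ?gap + prob (?crowded \<union> ?double)"
      by (intro measure_Un_le sets.Un gap_ev crowded_ev double_ev)
    also have "prob (?crowded \<union> ?double) \<le> prob ?crowded + prob ?double"
      by (intro measure_Un_le crowded_ev double_ev)
    finally have "prob ?occ \<le> prob ?gap + 3 * \<eta>" using elim(2,3) by simp
    then have "measure M' {\<omega> \<in> space M'. \<xi> \<omega> \<in> V} - 8 * \<eta> \<le> prob ?gap"
      using n seen elim(1) \<eta> by linarith
    then show ?case by (simp add: \<eta>_def)
  qed
qed

end

theorem theorem1p2:
  fixes \<alpha> lam1 :: real
    and M :: "'a measure" and N :: "real \<Rightarrow> 'a \<Rightarrow> nat"
    and M' :: "'b measure" and \<xi> :: "'b \<Rightarrow> (ereal \<times> ereal) measure"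
  assumes "0 < \<alpha>" and "\<alpha> < 1" and "0 < lam1"
    and "inhomogeneous_poisson_process M (rate \<alpha> lam1) N"
    and "poisson_point_process M' plane (limit_intensity \<alpha>) \<xi>"
  shows "converges_in_distribution (vague_topology plane) at_top
           M (gap_process \<alpha> lam1 N) M' \<xi>"
proof -
  interpret poisson_gaps \<alpha> lam1 M N
    by unfold_locales (use assms in auto)
  show ?thesis
  proof (rule converges_in_distributionI_open)
    show "prob_space M" by (rule prob_space_axioms)
    show "prob_space M'" "\<xi> \<in> measurable M' (borel_of_topology (vague_topology plane))"
      using assms(5) by (simp_all add: poisson_point_process_def)
    show "\<forall>\<^sub>F t in at_top. gap_process \<alpha> lam1 N t \<in> measurable M (borel_of_topology (vague_topology plane))"
      using eventually_gt_at_top[of 1] by eventually_elim (rule gap_process_measurable[OF process])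
    show "\<forall>\<^sub>F t in at_top. measure M' {\<omega> \<in> space M'. \<xi> \<omega> \<in> V} - e \<le> measure M {\<omega> \<in> space M. gap_process \<alpha> lam1 N t \<omega> \<in> V}"
      if "openin (vague_topology plane) V" "0 < e" for V e
      using open_set_lower_bound[OF assms(5) that] .
  qed
qed

end
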